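(* Let $\delta\in[1,2)$, and let $L_\infty(\mathcal{A}^*(\delta))$ be the corresponding labyrinth fractal, constructed as described in the context. Then for any two distinct points $x,y\in L_\infty(\mathcal{A}^*(\delta))$, the arc $a(x,y)$ that connects the two points in the fractal has box counting dimension $\dim_B(a(x,y))=\delta$.
   Context: **Patterns and limit sets.** For $m\ge1$ and $0\le i,j\le m-1$ let $S_{i,j,m}=[\frac im,\frac{i+1}m]\times[\frac jm,\frac{j+1}m]$ (column $i$, row $j$) and $\mathcal{S}_m=\{S_{i,j,m}: 0\le i,j\le m-1\}$. A nonempty $\mathcal{A}\subseteq\mathcal{S}_m$ is an $m$-pattern of width $m$; its elements are called white squares. For a square $Q=[x,x+q]\times[y,y+q]\subseteq[0,1]^2$ let $P_Q(z_x,z_y)=(qz_x+x,qz_y+y)$. Given a (finite or infinite) sequence of patterns $\mathcal{B}_1,\mathcal{B}_2,\dots$ of widths $w_1,w_2,\dots$, put $\mathcal{W}_1=\mathcal{B}_1$ and $\mathcal{W}_n=\{P_{W'}(W): W\in\mathcal{B}_n, W'\in\mathcal{W}_{n-1}\}\subseteq\mathcal{S}_{w_1\cdots w_n}$ for $n\ge2$ (white squares of level $n$). For an infinite sequence let $L_n=\bigcup_{W\in\mathcal{W}_n}W$ and $L_\infty=\bigcap_{n\ge1}L_n$, the limit set generated by the sequence. **Labyrinth patterns.** The graph $\mathcal{G}(\mathcal{A})$ has the white squares of $\mathcal{A}$ as vertices, two being adjacent iff they share a common side. A vertical exit pair of $\mathcal{A}$ consists of two white squares in the same column, one in the top and one in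 the bottom row; a horizontal exit pair consists of two white squares in the same row, one in the left and one in the right column. The squares of these pairs are the exits of $\mathcal{A}$. An $m$-pattern with $m\ge3$ is a labyrinth pattern if: (1) $\mathcal{G}(\mathcal{A})$ is a tree; (2) $\mathcal{A}$ has exactly one vertical and exactly one horizontal exit pair; (3) if a corner square of the $m\times m$ grid is white, then the diagonally opposite corner square is not white. A limit set generated by an infinite sequence of labyrinth patterns is called a mixed labyrinth fractal (self-similar if the sequence is constant). It is known to be a dendrite, so any two distinct points of it are connected by a unique arc in it. **Snake cross patterns.** For $k\ge1$ the $k$-th snake cross pattern $\mathcal{A}_k$ has width $m_k=4k+7$. Denote by $(x,y)$ (integers, $|x|,|y|\le 2k+3$) the square $S_{2k+3+x,\,2k+3+y,\,4k+7}$, so $(0,0)$ is the central square. Put $x_0=0$ and $x_j=(-1)^{j+1}(2j-1)$ for $1\le j\le k$. The top arm consists of the squares: $(0,1),(0,2)$; for each $j=1,\dots,k$, all $(x,2j)$ with $x$ between $x_{j-1}$ and $x_j$ (inclusive), and $(x_j,2j+1),(x_j,2j+2)$; all $(x,2k+2)$ with $x$ between $0$ and $x_k$ (inclusive); and $(0,2k+3)$. The white squares of $\mathcal{A}_k$ are the central square, the top arm, and the images of the top arm under rotation by $90^\circ,180^\circ,270^\circ$ about the central square. The path in $\mathcal{G}(\mathcal{A}_k)$ between any two distinct exits has $\ell_k=4k^2+4k+7$ squares. **Cross patterns.** For $k\ge1$ the cross pattern of width $2k+1$ consists of the squares $S_{i,j,2k+1}$ with $i=k$ or $j=k$. Let $\mathcal{A}_0$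 be the cross pattern of width $m_0=3$, and $\ell_0=3$. **Construction of $L_\infty(\mathcal{A}^*(\delta))$.** Let $d_k=\frac{\log\ell_k}{\log m_k}$ for $k\ge0$ (so $d_0=1$ and $d_k\to2$). - If $\delta=1$: $L_\infty(\mathcal{A}^*(1))$ is the mixed labyrinth fractal generated by the sequence of cross patterns of widths $2k+1$, $k=1,2,3,\dots$. - If $\delta=d_k$ for some $k\ge1$: $L_\infty(\mathcal{A}^*(\delta))$ is the self-similar labyrinth fractal generated by the constant sequence with all patterns equal to $\mathcal{A}_k$. - Otherwise, choose $k\ge0$ with $d_k<\delta<d_{k+1}$, and put $a=\log\ell_k$, $b=\log m_k$, $c=\log\ell_{k+1}$, $d=\log m_{k+1}$. Let $(p_j)_{j\ge1},(q_j)_{j\ge1}$ be sequences of positive integers such that $r_j=\frac{p_ja+q_jc}{p_jb+q_jd}$ is an increasing sequence with $\lim_{j\to\infty}r_j=\delta$ (such sequences exist). For $j\ge1$ let $\mathcal{A}^*_j$ be the labyrinth pattern of width $m_k^{p_j}m_{k+1}^{q_j}$ that equals the set of white squares of level $p_j+q_j$ built from the finite sequence consisting of $p_j$ copies of $\mathcal{A}_k$ followed by $q_j$ copies of $\mathcal{A}_{k+1}$. Then $L_\infty(\mathcal{A}^*(\delta))$ is the mixed labyrinth fractal generated by $(\mathcal{A}^*_j)_{j\ge1}$.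
   Formalization: When δ is neither 1 nor some d_k, the sequences (p_j),(q_j) are also required to satisfy log w_n / log(w_1⋯w_n) → 0 for the pattern widths w_n; without this the claim fails, e.g. if p_j, q_j grow so fast that the lower box dimension drops to d_k. *)

theory Defs
  imports "HOL-Analysis.Analysis"
begin

(* A pattern of width m is a pair (m, W): the index pair (i, j) in W stands for the white square
   in column i and row j, both counted from 0, i.e. for the set "square i j m". *)

type_synonym pattern = "nat \<times> (nat \<times> nat) set"

abbreviation width :: "pattern \<Rightarrow> nat" where "width \<equiv> fst"
abbreviation white :: "pattern \<Rightarrow> (nat \<times> nat) set" where "white \<equiv> snd"

definition square :: "nat \<Rightarrow> nat \<Rightarrow> nat \<Rightarrow> (real \<times> real) set" where
  "square i j m = {real i / real m .. (real i + 1) / real m} \<times> {real j / real m .. (real j + 1) / real m}"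

definition rescale :: "real \<Rightarrow> real \<Rightarrow> real \<Rightarrow> real \<times> real \<Rightarrow> real \<times> real" where
  "rescale x y q z = (q * fst z + x, q * snd z + y)"

(* The map "rescale (i' / M) (j' / M) (1 / M)" sends the unit square onto "square i' j' M".
   The next lemma is why substituting patterns into white squares is done on indices below. *)

lemma rescale_square:
  assumes "M > 0" "m > 0"
  shows "rescale (real i' / real M) (real j' / real M) (1 / real M) ` square i j m
       = square (i' * m + i) (j' * m + j) (M * m)"
proof -
  let ?f = "\<lambda>c t. 1 / real M * t + real c / real M"
  have interval: "?f c ` {real a / real m .. (real a + 1) / real m}
      = {real (c * m + a) / real (M * m) .. (real (c * m + a) + 1) / real (M * m)}" for c a
  proof -
    have le: "real a / real m \<le> (real a + 1) / real m"
      by (simp add: divide_right_mono)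
    have ends: "?f c (real a / real m) = real (c * m + a) / real (M * m)"
      "?f c ((real a + 1) / real m) = (real (c * m + a) + 1) / real (M * m)"
      using assms by (simp_all add: field_simps)
    show ?thesis
      using le assms ends by (simp only: image_affinity_atLeastAtMost) simp
  qed
  have "rescale (real i' / real M) (real j' / real M) (1 / real M) ` (X \<times> Y) = (?f i' ` X) \<times> (?f j' ` Y)"
    for X Y
    by (force simp: rescale_def)
  then show ?thesis
    unfolding square_def by (simp only: interval)
qed

definition subst_pattern :: "pattern \<Rightarrow> pattern \<Rightarrow> pattern" where
  "subst_pattern A B = (width A * width B,
     {(i' * width B + i, j' * width B + j) | i' j' i j. (i', j') \<in> white A \<and> (i, j) \<in> white B})"

(* Sequences of patterns are indexed from 0, so "level B n" holds the white squares of level n + 1. *)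

fun level :: "(nat \<Rightarrow> pattern) \<Rightarrow> nat \<Rightarrow> pattern" where
  "level B 0 = B 0"
| "level B (Suc n) = subst_pattern (level B n) (B (Suc n))"

definition limit_set :: "(nat \<Rightarrow> pattern) \<Rightarrow> (real \<times> real) set" where
  "limit_set B = (\<Inter>n. \<Union>(i, j)\<in>white (level B n). square i j (width (level B n)))"

definition cross :: "nat \<Rightarrow> pattern" where
  "cross k = (2 * k + 1, {(i, j). i < 2 * k + 1 \<and> j < 2 * k + 1 \<and> (i = k \<or> j = k)})"

(* Snake crosses are described in integer coordinates whose origin is the central square. *)

definition snake_turn :: "nat \<Rightarrow> int" where
  "snake_turn j = (if j = 0 then 0 else (-1) ^ (j + 1) * (2 * int j - 1))"

definition row_segment :: "int \<Rightarrow> int \<Rightarrow> int \<Rightarrow> (int \<times> int) set" where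
  "row_segment a b y = {min a b .. max a b} \<times> {y}"

definition top_arm :: "nat \<Rightarrow> (int \<times> int) set" where
  "top_arm k =
     {(0, 1), (0, 2)}
     \<union> (\<Union>j\<in>{1..k}. row_segment (snake_turn (j - 1)) (snake_turn j) (2 * int j)
          \<union> {(snake_turn j, 2 * int j + 1), (snake_turn j, 2 * int j + 2)})
     \<union> row_segment 0 (snake_turn k) (2 * int k + 2)
     \<union> {(0, 2 * int k + 3)}"

definition quarter_turn :: "int \<times> int \<Rightarrow> int \<times> int" where
  "quarter_turn = (\<lambda>(x, y). (- y, x))"

definition snake_cross :: "nat \<Rightarrow> pattern" where
  "snake_cross k = (4 * k + 7,
     (\<lambda>(x, y). (nat (2 * int k + 3 + x), nat (2 * int k + 3 + y))) `
       ({(0, 0)} \<union> (\<Union>r<4. (quarter_turn ^^ r) ` top_arm k)))"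

definition base_pattern :: "nat \<Rightarrow> pattern" where
  "base_pattern k = (if k = 0 then cross 1 else snake_cross k)"

(* The number of squares on the path between two distinct exits of "base_pattern k". *)

definition exit_path_length :: "nat \<Rightarrow> nat" where
  "exit_path_length k = (if k = 0 then 3 else 4 * k\<^sup>2 + 4 * k + 7)"

definition base_dim :: "nat \<Rightarrow> real" where
  "base_dim k = ln (real (exit_path_length k)) / ln (real (width (base_pattern k)))"

(* The white squares of level p + q built from p copies of "base_pattern k" followed by
   q copies of "base_pattern (k + 1)"; the shift by 1 comes from indexing levels from 0. *)

definition mixed_block :: "nat \<Rightarrow> nat \<Rightarrow> nat \<Rightarrow> pattern" where
  "mixed_block k p q =
     level (\<lambda>i. if i < p then base_pattern k else base_pattern (k + 1)) (p + q - 1)"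

definition mixing_ratio :: "nat \<Rightarrow> nat \<Rightarrow> nat \<Rightarrow> real" where
  "mixing_ratio k p q =
     (real p * ln (real (exit_path_length k)) + real q * ln (real (exit_path_length (k + 1)))) /
     (real p * ln (real (width (base_pattern k))) + real q * ln (real (width (base_pattern (k + 1)))))"

(* "generates_for \<delta> B": the sequence B is a possible outcome of the construction for \<delta>. *)

definition generates_for :: "real \<Rightarrow> (nat \<Rightarrow> pattern) \<Rightarrow> bool" where
  "generates_for \<delta> B \<longleftrightarrow>
     (if \<delta> = 1 then B = (\<lambda>n. cross (n + 1))
      else if \<exists>k\<ge>1. \<delta> = base_dim k then \<exists>k\<ge>1. \<delta> = base_dim k \<and> B = (\<lambda>n. base_pattern k)
      else \<exists>k p q. base_dim k < \<delta> \<and> \<delta> < base_dim (k + 1)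
         \<and> (\<forall>j. p j > 0 \<and> q j > 0)
         \<and> incseq (\<lambda>j. mixing_ratio k (p j) (q j))
         \<and> (\<lambda>j. mixing_ratio k (p j) (q j)) \<longlonglongrightarrow> \<delta>
         \<and> B = (\<lambda>j. mixed_block k (p j) (q j)))"

(* The width of a single pattern is negligible, on a logarithmic scale, against the product of
   all widths so far.  This holds automatically for \<delta> = 1 and \<delta> = base_dim k; for the mixed blocks
   it says that p j + q j is of smaller order than the sum of p i + q i over i < j.
   It cannot be dropped there: replacing (p j, q j) by (c j * p j, c j * q j) leaves the mixing
   ratios unchanged, but if c grows fast enough, then at the scales reached after the p j copies
   of "base_pattern k" in block j the box counting quotients tend to base_dim k, which is
   less than \<delta>, so the box counting dimension does not exist. *)

definition moderate_widths :: "(nat \<Rightarrow> pattern) \<Rightarrow> bool" where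
  "moderate_widths B \<longleftrightarrow>
     (\<lambda>n. ln (real (width (B n))) / ln (real (width (level B n)))) \<longlonglongrightarrow> 0"

(* Unbounded sets have the default diameter 0, hence the boundedness requirement. *)

definition covering_number :: "'a::metric_space set \<Rightarrow> real \<Rightarrow> nat" where
  "covering_number F \<epsilon> =
     (LEAST n. \<exists>C. finite C \<and> card C = n \<and> F \<subseteq> \<Union>C \<and> (\<forall>U\<in>C. bounded U \<and> diameter U \<le> \<epsilon>))"

(* The limit exists, i.e. the lower and upper box counting dimensions are both equal to s. *)

definition has_box_dimension :: "'a::metric_space set \<Rightarrow> real \<Rightarrow> bool" where
  "has_box_dimension F s \<longleftrightarrow>
     ((\<lambda>\<epsilon>. ln (real (covering_number F \<epsilon>)) / - ln \<epsilon>) \<longlongrightarrow> s) (at_right 0)"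

end

theory Submission
  imports Defs "HOL-Real_Asymp.Real_Asymp"
begin

text \<open>Every cross and every snake cross is a spider: a central square and four legs of \<open>h\<close> squares each
  that end in the exits, which lie in the middle of the four sides. A path between two exits thus has
  \<open>2 * h + 1\<close> squares. Substituting patterns into each other keeps the following picture on every
  level. A point of the limit set on the border of the unit square is the midpoint of a side
  (\<open>border_point_is_exit\<close>). Hence the parts of the limit set in two distinct white squares meet only
  if the squares are adjacent, and then in a single point (\<open>piece_inter\<close>). Since the white squares
  form a tree, each of these points cuts the limit set in two, and a connected subset of the limit
  set meets every white square in a connected set (\<open>connected_Int_piece\<close>).

  Lower bound. A connected set that contains two exits has to cross \<open>2 * h + 1\<close> squares of the first
  level, each of them again from exit to exit (\<open>crossed_pieces\<close>). By induction it meets as many squares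
  of level \<open>n\<close> as the product of the path lengths of the first \<open>n\<close> patterns
  (\<open>squares_met_between_exits\<close>). An arc crosses some square of some level from exit to exit: zooming into
  a square stretches distances by a factor of at least 3, so two distinct points cannot stay together
  in one square forever (\<open>thick_connected\<close>). This yields the same bound up to a constant factor.

  Upper bound. The image of an arc is irreducible between its end points: no proper closed connected
  subset contains both. At a cut point an irreducible set falls into two irreducible sets
  (\<open>irreducible_part\<close>). It therefore stays in two legs and the centre, that is in at most
  \<open>2 * h + 1\<close> squares, and in all but at most two of these it is irreducible between two exits
  (\<open>irreducible_piece\<close>). By induction, twice the product of the path lengths many squares of level
  \<open>n\<close> cover the arc (\<open>irreducible_cover\<close>).

  So at scale \<open>1 / M\<close>, where \<open>M\<close> is a product of widths, the covering number of an arc is comparable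
  to the product \<open>L\<close> of the corresponding path lengths (\<open>arc_covering_bounds\<close>). At the ends of
  mixed blocks \<open>ln L / ln M\<close> is a weighted average of the mixing ratios and tends to \<open>\<delta>\<close>, and the
  moderate widths make the scales in between harmless (\<open>tendsto_log_quotient_at_scales\<close>). A mixed
  block is a product of base patterns, so a fractal built from blocks sits in the fractal of the
  sequence of all these base patterns (\<open>arc_dimension_of_blocks\<close>), and the case distinction on
  \<open>\<delta>\<close> becomes a choice of blocks.\<close>

section \<open>Continua that are irreducible between two points\<close>

lemma connected_meets_cut:
  fixes A :: "'a::topological_space set"
  assumes "connected A" "A \<subseteq> Z \<union> R" "closed Z" "closed R" "A \<inter> Z \<noteq> {}" "A \<inter> R \<noteq> {}"
  shows "A \<inter> (Z \<inter> R) \<noteq> {}"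
  using assms unfolding connected_closed by blast

text \<open>If a piece of \<open>A \<inter> Z\<close> could be split off, then it could be split off on the side that avoids the only
  point of \<open>Z \<inter> R\<close>, and this would also disconnect \<open>A\<close>.\<close>
lemma connected_Int_cut:
  fixes A :: "'a::topological_space set"
  assumes A: "connected A" "A \<subseteq> Z \<union> R" and cl: "closed Z" "closed R"
    and one: "\<And>z z'. z \<in> Z \<inter> R \<Longrightarrow> z' \<in> Z \<inter> R \<Longrightarrow> z = z'"
  shows "connected (A \<inter> Z)"
proof (rule ccontr)
  assume "\<not> connected (A \<inter> Z)"
  then obtain E F where EF: "closed E" "closed F" "A \<inter> Z \<subseteq> E \<union> F" "E \<inter> F \<inter> (A \<inter> Z) = {}"
    "E \<inter> (A \<inter> Z) \<noteq> {}" "F \<inter> (A \<inter> Z) \<noteq> {}"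
    unfolding connected_closed by blast
  \<comment> \<open>\<open>F\<close> is the half without the common point of \<open>Z\<close> and \<open>R\<close>.\<close>
  have sep: False
    if "closed E" "closed F" "A \<inter> Z \<subseteq> E \<union> F" "E \<inter> F \<inter> (A \<inter> Z) = {}"
      "F \<inter> (A \<inter> Z) \<noteq> {}" "E \<inter> (A \<inter> Z) \<noteq> {}" "F \<inter> (Z \<inter> R) \<inter> A = {}" for E F
  proof -
    have "closed (F \<inter> Z)" "closed ((E \<inter> Z) \<union> R)" using that cl by auto
    moreover have "A \<subseteq> (F \<inter> Z) \<union> ((E \<inter> Z) \<union> R)" using that(3) A(2) by blast
    moreover have "(F \<inter> Z) \<inter> ((E \<inter> Z) \<union> R) \<inter> A = {}" using that(4,7) by blast
    moreover have "(F \<inter> Z) \<inter> A \<noteq> {}" "((E \<inter> Z) \<union> R) \<inter> A \<noteq> {}" using that(5,6) by blast+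
    ultimately show False
      using connected_closedD[OF A(1), of "F \<inter> Z" "(E \<inter> Z) \<union> R"] by auto
  qed
  have "F \<inter> (Z \<inter> R) \<inter> A = {} \<or> E \<inter> (Z \<inter> R) \<inter> A = {}"
    using EF(4) one by blast
  then show False
    using sep[of E F] sep[of F E] EF by (metis Un_commute inf_commute)
qed

text \<open>The part of the theory of arcs that survives cutting at a point. Unlike an arc with its
  parametrisation, an irreducible set can be intersected with the pieces of a fractal directly. The case
  \<open>u = v\<close> means \<open>A = {u}\<close> and is wanted: it occurs when a set only touches a piece.\<close>
definition irreducible_between :: "'a::topological_space set \<Rightarrow> 'a \<Rightarrow> 'a \<Rightarrow> bool" where
  "irreducible_between A u v \<longleftrightarrow> closed A \<and> connected A \<and> u \<in> A \<and> v \<in> A \<and>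
     (\<forall>A'. A' \<subseteq> A \<and> closed A' \<and> connected A' \<and> u \<in> A' \<and> v \<in> A' \<longrightarrow> A' = A)"

lemma irreducible_between_commute: "irreducible_between A u v \<longleftrightarrow> irreducible_between A v u"
  unfolding irreducible_between_def by blast

lemma irreducible_subset:
  assumes "irreducible_between A u v" "closed (A \<inter> Z)" "connected (A \<inter> Z)" "u \<in> Z" "v \<in> Z"
  shows "A \<subseteq> Z"
  using assms unfolding irreducible_between_def by blast

text \<open>A closed connected \<open>A' \<subseteq> A \<inter> Z\<close> through \<open>u\<close> and the cut point \<open>p\<close> can be completed with \<open>A \<inter> R\<close> to a
  connected subset of \<open>A\<close> through \<open>u\<close> and \<open>v\<close>, which is \<open>A\<close> by irreducibility.\<close>
lemma irreducible_half:
  fixes A :: "'a::t1_space set"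
  assumes A: "irreducible_between A u v" and sub: "A \<subseteq> Z \<union> R" and cl: "closed Z" "closed R"
    and one: "\<And>z z'. z \<in> Z \<inter> R \<Longrightarrow> z' \<in> Z \<inter> R \<Longrightarrow> z = z'"
    and uv: "u \<in> Z" "v \<in> R"
  obtains p where "p \<in> Z \<inter> R" "irreducible_between (A \<inter> Z) u p"
proof -
  have A': "closed A" "connected A" "u \<in> A" "v \<in> A" using A by (auto simp: irreducible_between_def)
  obtain p where p: "p \<in> A" "p \<in> Z" "p \<in> R"
    using connected_meets_cut[OF A'(2) sub cl] A' uv by blast
  have cR: "connected (A \<inter> R)"
    by (rule connected_Int_cut[OF A'(2), of R Z]) (use sub cl one in auto)
  have cZ: "connected (A \<inter> Z)"
    by (rule connected_Int_cut[OF A'(2) sub cl]) (use one in auto)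
  have "A' = A \<inter> Z" if h: "A' \<subseteq> A \<inter> Z" "closed A'" "connected A'" "u \<in> A'" "p \<in> A'" for A'
  proof -
    have "connected (A' \<union> (A \<inter> R))" using h cR p by (intro connected_Un) auto
    moreover have "closed (A' \<union> (A \<inter> R))" using h A'(1) cl by auto
    moreover have "A' \<union> (A \<inter> R) \<subseteq> A" "u \<in> A' \<union> (A \<inter> R)" "v \<in> A' \<union> (A \<inter> R)"
      using h(1,4) A'(4) uv by auto
    ultimately have "A' \<union> (A \<inter> R) = A"
      using A unfolding irreducible_between_def by metis
    then have "z \<in> A'" if "z \<in> A \<inter> Z" for z
      using that h(5) p one[of z p] by (cases "z \<in> R") auto
    then show ?thesis using h(1) by auto
  qed
  then have "irreducible_between (A \<inter> Z) u p"
    unfolding irreducible_between_def using cZ A' cl uv p by (simp add: closed_Int)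
  with that p show ?thesis by blast
qed

text \<open>An end point on the wrong side of the cut is replaced by the cut point. The Booleans record on which
  side an end point is counted, since the cut point itself belongs to both.\<close>
lemma irreducible_part:
  fixes A :: "'a::t1_space set"
  assumes A: "irreducible_between A u v" and sub: "A \<subseteq> Z \<union> R" and cl: "closed Z" "closed R"
    and one: "\<And>z z'. z \<in> Z \<inter> R \<Longrightarrow> z' \<in> Z \<inter> R \<Longrightarrow> z = z'"
    and ne: "A \<inter> Z \<noteq> {}"
    and u: "if uZ then u \<in> Z else u \<in> R" and v: "if vZ then v \<in> Z else v \<in> R"
  obtains u' v' where "irreducible_between (A \<inter> Z) u' v'"
    "if uZ then u' = u else u' \<in> Z \<inter> R" "if vZ then v' = v else v' \<in> Z \<inter> R"
proof -
  have A': "closed A" "connected A" "u \<in> A" "v \<in> A" using A by (auto simp: irreducible_between_def)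
  have cR: "connected (A \<inter> R)"
    by (rule connected_Int_cut[OF A'(2), of R Z]) (use sub cl one in auto)
  have cZ: "connected (A \<inter> Z)"
    by (rule connected_Int_cut[OF A'(2) sub cl]) (use one in auto)
  consider "uZ" "vZ" | "uZ" "\<not> vZ" | "\<not> uZ" "vZ" | "\<not> uZ" "\<not> vZ" by blast
  then show thesis
  proof cases
    case 1
    then have "A \<subseteq> Z" using irreducible_subset[OF A _ cZ] u v cl A' by auto
    then have "A \<inter> Z = A" by blast
    then show ?thesis using that[of u v] A 1 by auto
  next
    case 2
    obtain p where "p \<in> Z \<inter> R" "irreducible_between (A \<inter> Z) u p"
      using irreducible_half[OF A sub cl one] u v 2 by auto
    then show ?thesis using that[of u p] 2 by auto
  next
    case 3
    have A2: "irreducible_between A v u" using A by (simp add: irreducible_between_commute)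
    obtain p where "p \<in> Z \<inter> R" "irreducible_between (A \<inter> Z) v p"
      using irreducible_half[OF A2 sub cl one] u v 3 by auto
    then show ?thesis using that[of p v] 3 by (auto simp: irreducible_between_commute)
  next
    case 4
    \<comment> \<open>Both ends lie in \<open>R\<close>, so \<open>A\<close> does as well and only touches \<open>Z\<close> in the cut point.\<close>
    then have "A \<subseteq> R" using irreducible_subset[OF A _ cR] u v cl A' by auto
    then obtain p where "p \<in> A" "p \<in> Z \<inter> R" using ne by blast
    moreover have "z = p" if "z \<in> A \<inter> Z" for z
      by (rule one) (use that \<open>A \<subseteq> R\<close> \<open>p \<in> Z \<inter> R\<close> in blast)+
    ultimately have eq: "A \<inter> Z = {p}" by blast
    have "irreducible_between (A \<inter> Z) p p"
      unfolding eq irreducible_between_def by auto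
    then show ?thesis using that[of p p] 4 \<open>p \<in> Z \<inter> R\<close> by auto
  qed
qed

lemma irreducible_homeomorphic_image:
  assumes A: "irreducible_between A u v"
    and f: "continuous_on UNIV f" and g: "continuous_on UNIV g"
    and fg: "\<And>x. f (g x) = x" "\<And>x. g (f x) = x"
  shows "irreducible_between (g ` A) (g u) (g v)"
proof -
  have im_g: "g ` S = f -` S" for S using fg by (auto intro!: image_eqI[of _ g "f _"])
  have im_f: "f ` S = g -` S" for S using fg by (auto intro!: image_eqI[of _ f "g _"])
  have A': "closed A" "connected A" "u \<in> A" "v \<in> A" using A by (auto simp: irreducible_between_def)
  have "closed (g ` A)" unfolding im_g using A'(1) f by (rule closed_vimage)
  moreover have "connected (g ` A)" using A'(2) g by (meson connected_continuous_image continuous_on_subset subset_UNIV)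
  moreover have "A1 = g ` A" if h: "A1 \<subseteq> g ` A" "closed A1" "connected A1" "g u \<in> A1" "g v \<in> A1" for A1
  proof -
    have "closed (f ` A1)" unfolding im_f using h(2) g by (rule closed_vimage)
    moreover have "connected (f ` A1)"
      using h(3) f by (meson connected_continuous_image continuous_on_subset subset_UNIV)
    moreover have "f ` A1 \<subseteq> A" "u \<in> f ` A1" "v \<in> f ` A1" using h fg by (auto simp: im_g im_f)
    ultimately have "f ` A1 = A" using A unfolding irreducible_between_def by blast
    then show ?thesis using fg(2) by (auto simp: image_image)
  qed
  ultimately show ?thesis unfolding irreducible_between_def using A' by simp
qed

text \<open>Pulled back to the parameter interval, a connected subset that contains both end points is a connected
  subset of \<open>{0..1}\<close> containing 0 and 1.\<close>
lemma irreducible_arc_image: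
  fixes g :: "real \<Rightarrow> 'a::t2_space"
  assumes "arc g"
  shows "irreducible_between (path_image g) (pathstart g) (pathfinish g)"
proof -
  have pi: "path_image g = g ` {0..1}" by (simp add: path_image_def)
  have cont: "continuous_on {0..1} g" and inj: "inj_on g {0..1}"
    using assms by (auto simp: arc_def path_def)
  obtain f where f: "homeomorphism {0..1} (g ` {0..1}) g f"
    using homeomorphism_compact[OF compact_Icc cont _ inj] by auto
  have "A' = path_image g"
    if h: "A' \<subseteq> path_image g" "connected A'" "pathstart g \<in> A'" "pathfinish g \<in> A'" for A'
  proof -
    have c: "connected (f ` A')"
      using h(1,2) f by (metis connected_continuous_image continuous_on_subset homeomorphism_def pi)
    have fA: "f (g t) = t" if "t \<in> {0..1}" for t using f that by (simp add: homeomorphism_def)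
    have "0 \<in> f ` A'" using h(3) fA[of 0] by (force simp: pathstart_def)
    moreover have "1 \<in> f ` A'" using h(4) fA[of 1] by (force simp: pathfinish_def)
    ultimately have sub: "{0..1} \<subseteq> f ` A'"
      using c by (simp add: connected_contains_Icc)
    have "g ` {0..1} \<subseteq> A'"
    proof
      fix z assume "z \<in> g ` {0..1}"
      then obtain t where t: "t \<in> {0..1}" "z = g t" by blast
      then obtain a where a: "a \<in> A'" "t = f a" using sub by blast
      have "g (f a) = a" using a h(1) f pi by (auto simp: homeomorphism_def)
      then show "z \<in> A'" using a t by simp
    qed
    then show ?thesis using h(1) pi by blast
  qed
  moreover have "closed (path_image g)" by (simp add: assms arc_imp_path closed_path_image)
  ultimately show ?thesis
    unfolding irreducible_between_def using assms
    by (auto simp: connected_path_image arc_imp_path)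
qed

section \<open>Patterns made of a centre and four legs\<close>

text \<open>The four points at which a limit set can be entered: the midpoints of the sides of the unit square.\<close>
definition exits :: "(real \<times> real) set" where
  "exits = {(0, 1/2), (1, 1/2), (1/2, 0), (1/2, 1)}"

definition side_adjacent :: "nat \<times> nat \<Rightarrow> nat \<times> nat \<Rightarrow> bool" where
  "side_adjacent s t \<longleftrightarrow>
     \<bar>int (fst s) - int (fst t)\<bar> + \<bar>int (snd s) - int (snd t)\<bar> = 1"

definition cell_map :: "nat \<Rightarrow> nat \<times> nat \<Rightarrow> real \<times> real \<Rightarrow> real \<times> real" where
  "cell_map w s = rescale (real (fst s) / real w) (real (snd s) / real w) (1 / real w)"

definition cell_inv :: "nat \<Rightarrow> nat \<times> nat \<Rightarrow> real \<times> real \<Rightarrow> real \<times> real" where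
  "cell_inv w s = rescale (- real (fst s)) (- real (snd s)) (real w)"

lemma rescale_eq: "rescale x y q z = q *\<^sub>R z + (x, y)"
  by (cases z) (simp add: rescale_def)

lemma continuous_rescale [continuous_intros]: "continuous_on S (rescale x y q)"
  unfolding rescale_eq[abs_def] by (intro continuous_intros)

lemma continuous_cell_map: "continuous_on S (cell_map w s)"
  unfolding cell_map_def by (rule continuous_rescale)

lemma continuous_cell_inv: "continuous_on S (cell_inv w s)"
  unfolding cell_inv_def by (rule continuous_rescale)

lemma dist_rescale: "dist (rescale x y q z) (rescale x y q z') = \<bar>q\<bar> * dist z z'"
  by (simp add: rescale_eq dist_norm flip: scaleR_diff_right)

lemma cell_inv_map: "w > 0 \<Longrightarrow> cell_inv w s (cell_map w s z) = z"
  by (cases z) (simp add: cell_map_def cell_inv_def rescale_def field_simps)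

lemma cell_map_inv: "w > 0 \<Longrightarrow> cell_map w s (cell_inv w s z) = z"
  by (cases z) (simp add: cell_map_def cell_inv_def rescale_def field_simps)

lemma fst_cell_map: "fst (cell_map w s z) = (real (fst s) + fst z) / real w"
  and snd_cell_map: "snd (cell_map w s z) = (real (snd s) + snd z) / real w"
  by (simp_all add: cell_map_def rescale_def field_simps add_divide_distrib)

text \<open>\<open>leg\<close> numbers the four legs and \<open>rk\<close> is the distance from the centre, where \<open>leg\<close> has no meaning.
  Adjacency is only bounded from above: that consecutive squares of a leg touch is seen from any
  connected set that passes from one to the other.\<close>
locale spider =
  fixes Q :: pattern and h :: nat and leg rk :: "nat \<times> nat \<Rightarrow> nat"
  assumes width_ge: "3 \<le> width Q"
    and white_sub: "(i, j) \<in> white Q \<Longrightarrow> i < width Q \<and> j < width Q"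
    and h_pos: "1 \<le> h"
    and rk_le: "s \<in> white Q \<Longrightarrow> rk s \<le> h"
    and leg_less: "s \<in> white Q \<Longrightarrow> leg s < 4"
    and cell_unique: "s \<in> white Q \<Longrightarrow> t \<in> white Q \<Longrightarrow> rk s = rk t \<Longrightarrow> rk s = 0 \<or> leg s = leg t \<Longrightarrow> s = t"
    and adjacent_rk: "s \<in> white Q \<Longrightarrow> t \<in> white Q \<Longrightarrow> side_adjacent s t \<Longrightarrow>
      (rk s = rk t + 1 \<or> rk t = rk s + 1) \<and> (leg s = leg t \<or> rk s = 0 \<or> rk t = 0)"
    and border_fst: "(i, j) \<in> white Q \<Longrightarrow> i = 0 \<or> i + 1 = width Q \<Longrightarrow> rk (i, j) = h \<and> 2 * j + 1 = width Q"
    and border_snd: "(i, j) \<in> white Q \<Longrightarrow> j = 0 \<or> j + 1 = width Q \<Longrightarrow> rk (i, j) = h \<and> 2 * i + 1 = width Q"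
begin

lemma finite_white: "finite (white Q)"
  by (rule finite_subset[of _ "{..<width Q} \<times> {..<width Q}"]) (use white_sub in force)+

definition outer :: "nat \<Rightarrow> nat \<Rightarrow> (nat \<times> nat) set" where
  "outer r i = {s \<in> white Q. leg s = r \<and> i \<le> rk s}"

lemma outer_subset: "outer r i \<subseteq> white Q"
  by (auto simp: outer_def)

text \<open>A single square remains after finitely many cuts at the point where an outer part of a leg is
  attached: two cuts for a square on a leg and four cuts for the centre. A property preserved by
  cutting therefore passes from the whole pattern to each of its squares.\<close>
lemma isolate_cell:
  assumes all: "P (white Q)"
    and Int: "\<And>U r i. U \<subseteq> white Q \<Longrightarrow> 1 \<le> i \<Longrightarrow> P U \<Longrightarrow> P (U \<inter> outer r i)"
    and Diff: "\<And>U r i. U \<subseteq> white Q \<Longrightarrow> 1 \<le> i \<Longrightarrow> P U \<Longrightarrow> P (U - outer r i)"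
    and s: "s \<in> white Q"
  shows "P {s}"
proof (cases "rk s = 0")
  case True
  have "P (white Q - (\<Union>r<n. outer r 1))" for n
  proof (induction n)
    case 0
    then show ?case using all by simp
  next
    case (Suc n)
    have "P ((white Q - (\<Union>r<n. outer r 1)) - outer n 1)"
      by (rule Diff) (use Suc in auto)
    moreover have "(white Q - (\<Union>r<n. outer r 1)) - outer n 1 = white Q - (\<Union>r<Suc n. outer r 1)"
      by (auto simp: less_Suc_eq)
    ultimately show ?case by simp
  qed
  moreover have "t = s" if "t \<in> white Q - (\<Union>r<4. outer r 1)" for t
    by (rule cell_unique) (use that s True leg_less in \<open>auto simp: outer_def Suc_le_eq\<close>)
  then have "white Q - (\<Union>r<4. outer r 1) = {s}"
    using s True by (auto simp: outer_def)
  ultimately show ?thesis by metis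
next
  case False
  have "P (white Q \<inter> outer (leg s) (rk s) - outer (leg s) (Suc (rk s)))"
    by (intro Diff Int) (use all False in auto)
  moreover have "t = s" if "t \<in> outer (leg s) (rk s) - outer (leg s) (Suc (rk s))" for t
    by (rule cell_unique) (use that s in \<open>auto simp: outer_def\<close>)
  then have "white Q \<inter> outer (leg s) (rk s) - outer (leg s) (Suc (rk s)) = {s}"
    using s by (auto simp: outer_def)
  ultimately show ?thesis by simp
qed

text \<open>Counting rank positively on the first leg and negatively on the other squares is injective.\<close>
lemma card_two_legs_le:
  assumes "\<And>s. s \<in> J \<Longrightarrow> s \<in> white Q \<and> (rk s = 0 \<or> leg s = r \<or> leg s = r')"
  shows "card J \<le> 2 * h + 1"
proof -
  define f where "f s = (if leg s = r then int (rk s) else - int (rk s))" for s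
  have "inj_on f J"
  proof (rule inj_onI)
    fix s t assume st: "s \<in> J" "t \<in> J" "f s = f t"
    then have "rk s = rk t" "rk s = 0 \<or> leg s = leg t"
      using assms[of s] assms[of t] by (auto simp: f_def split: if_splits)
    then show "s = t" using cell_unique st assms by blast
  qed
  moreover have "f ` J \<subseteq> {- int h .. int h}"
    using assms rk_le by (force simp: f_def)
  ultimately have "card J \<le> card {- int h .. int h}"
    using card_inj_on_le by blast
  then show ?thesis by simp
qed

end

text \<open>\<open>Y\<close> stands for the limit set of the remaining patterns, a copy of which sits in every white square.\<close>
locale spider_tiling = spider +
  fixes Y :: "(real \<times> real) set"
  assumes compact_Y: "compact Y"
    and Y_unit: "z \<in> Y \<Longrightarrow> 0 \<le> fst z \<and> fst z \<le> 1 \<and> 0 \<le> snd z \<and> snd z \<le> 1"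
    and Y_border: "z \<in> Y \<Longrightarrow> fst z \<in> {0, 1} \<or> snd z \<in> {0, 1} \<Longrightarrow> z \<in> exits"
begin

abbreviation w :: nat where "w \<equiv> width Q"

lemma w_pos: "0 < w" using width_ge by linarith

definition piece :: "nat \<times> nat \<Rightarrow> (real \<times> real) set" where
  "piece s = cell_map w s ` Y"

definition part :: "(nat \<times> nat) set \<Rightarrow> (real \<times> real) set" where
  "part U = (\<Union>s\<in>U. piece s)"

lemma closed_piece: "closed (piece s)"
  unfolding piece_def
  by (intro compact_imp_closed compact_continuous_image continuous_cell_map compact_Y)

lemma closed_part: "U \<subseteq> white Q \<Longrightarrow> closed (part U)"
  unfolding part_def using finite_subset[OF _ finite_white] closed_piece by blast

lemma part_mono: "U \<subseteq> V \<Longrightarrow> part U \<subseteq> part V"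
  by (auto simp: part_def)

lemma part_split: "part U \<subseteq> part (U \<inter> V) \<union> part (U - V)"
  by (auto simp: part_def)

lemma piece_coords:
  assumes "z \<in> piece s"
  obtains u where "u \<in> Y" "z = cell_map w s u"
    "real w * fst z = real (fst s) + fst u" "real w * snd z = real (snd s) + snd u"
    "0 \<le> fst u" "fst u \<le> 1" "0 \<le> snd u" "snd u \<le> 1"
proof -
  obtain u where u: "u \<in> Y" "z = cell_map w s u" using assms by (auto simp: piece_def)
  then show thesis using that[of u] w_pos Y_unit[of u]
    by (auto simp: fst_cell_map snd_cell_map)
qed

lemma exits_eqs: "z \<in> exits \<Longrightarrow> (fst z = 0 \<or> fst z = 1) \<and> snd z = 1/2 \<or> (snd z = 0 \<or> snd z = 1) \<and> fst z = 1/2"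
  by (auto simp: exits_def)

text \<open>A common point has coordinates 0 and 1 in the two squares along the direction in which they differ, so
  it is an exit of both and its other coordinate is 1/2. This excludes diagonal neighbours. The explicit
  value shows that two squares share at most one point.\<close>
lemma piece_inter:
  assumes st: "s \<noteq> t" and z: "z \<in> piece s" "z \<in> piece t"
  shows "side_adjacent s t" "z \<in> cell_map w s ` exits"
    "z = ((real (fst s) + real (fst t) + 1) / (2 * real w), (real (snd s) + real (snd t) + 1) / (2 * real w))"
proof -
  obtain u where u: "u \<in> Y" "z = cell_map w s u"
    "real w * fst z = real (fst s) + fst u" "real w * snd z = real (snd s) + snd u"
    "0 \<le> fst u" "fst u \<le> 1" "0 \<le> snd u" "snd u \<le> 1" by (rule piece_coords[OF z(1)])
  obtain v where v: "v \<in> Y" "z = cell_map w t v"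
    "real w * fst z = real (fst t) + fst v" "real w * snd z = real (snd t) + snd v"
    "0 \<le> fst v" "fst v \<le> 1" "0 \<le> snd v" "snd v \<le> 1" by (rule piece_coords[OF z(2)])
  have dx: "real_of_int (int (fst s) - int (fst t)) = fst v - fst u" using u v by simp
  have dy: "real_of_int (int (snd s) - int (snd t)) = snd v - snd u" using u v by simp
  have bx: "\<bar>int (fst s) - int (fst t)\<bar> \<le> 1" using dx u v by linarith
  have "by": "\<bar>int (snd s) - int (snd t)\<bar> \<le> 1" using dy u v by linarith
  have nz: "int (fst s) - int (fst t) \<noteq> 0 \<or> int (snd s) - int (snd t) \<noteq> 0"
    using st by (auto simp: prod_eq_iff)
  have "(u \<in> exits \<and> v \<in> exits) \<and>
     ((snd s = snd t \<and> \<bar>int (fst s) - int (fst t)\<bar> = 1 \<and> snd u = 1/2 \<and> snd v = 1/2 \<and> fst u + fst v = 1) \<or>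
      (fst s = fst t \<and> \<bar>int (snd s) - int (snd t)\<bar> = 1 \<and> fst u = 1/2 \<and> fst v = 1/2 \<and> snd u + snd v = 1))"
  proof (cases "int (fst s) - int (fst t) = 0")
    case True
    then have "int (snd s) - int (snd t) = 1 \<or> int (snd s) - int (snd t) = -1" using nz "by" by linarith
    moreover from this have uv: "(snd v = 1 \<and> snd u = 0) \<or> (snd v = 0 \<and> snd u = 1)" using dy u v by auto
    moreover have ex: "u \<in> exits \<and> v \<in> exits" using uv Y_border[OF u(1)] Y_border[OF v(1)] by blast
    moreover have "fst u = 1/2" "fst v = 1/2" using uv exits_eqs[of u] exits_eqs[of v] ex by auto
    ultimately show ?thesis using True by auto
  next
    case False
    then have "int (fst s) - int (fst t) = 1 \<or> int (fst s) - int (fst t) = -1" using bx by linarith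
    moreover from this have uv: "(fst v = 1 \<and> fst u = 0) \<or> (fst v = 0 \<and> fst u = 1)" using dx u v by auto
    moreover have ex: "u \<in> exits \<and> v \<in> exits" using uv Y_border[OF u(1)] Y_border[OF v(1)] by blast
    moreover have "snd u = 1/2" "snd v = 1/2" using uv exits_eqs[of u] exits_eqs[of v] ex by auto
    moreover from this have "snd s = snd t" using dy by simp
    ultimately show ?thesis by auto
  qed
  then have ex: "u \<in> exits \<and> v \<in> exits" and
    one: "(snd s = snd t \<and> \<bar>int (fst s) - int (fst t)\<bar> = 1 \<and> snd u = 1/2 \<and> snd v = 1/2 \<and> fst u + fst v = 1) \<or>
      (fst s = fst t \<and> \<bar>int (snd s) - int (snd t)\<bar> = 1 \<and> fst u = 1/2 \<and> fst v = 1/2 \<and> snd u + snd v = 1)"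
    by blast+
  show "z \<in> cell_map w s ` exits" using ex u by blast
  show "side_adjacent s t" using one by (auto simp: side_adjacent_def)
  have "2 * (real w * fst z) = real (fst s) + real (fst t) + 1" "2 * (real w * snd z) = real (snd s) + real (snd t) + 1"
    using one u(3,4) v(3,4) by linarith+
  then show "z = ((real (fst s) + real (fst t) + 1) / (2 * real w), (real (snd s) + real (snd t) + 1) / (2 * real w))"
    using w_pos by (simp add: prod_eq_iff nonzero_eq_divide_eq mult.commute mult.left_commute)
qed

lemma exit_in_piece:
  assumes e: "e \<in> exits" "e \<in> piece s" and s: "s \<in> white Q"
  shows "rk s = h" "e \<in> cell_map w s ` exits"
proof -
  obtain u where u: "u \<in> Y" "e = cell_map w s u"
    "real w * fst e = real (fst s) + fst u" "real w * snd e = real (snd s) + snd u"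
    "0 \<le> fst u" "fst u \<le> 1" "0 \<le> snd u" "snd u \<le> 1" by (rule piece_coords[OF e(2)])
  have lt: "fst s < w" "snd s < w" using s white_sub[of "fst s" "snd s"] by auto
  have *: "(fst s = 0 \<and> fst u = 0) \<or> (fst s + 1 = w \<and> fst u = 1) \<or>
        (snd s = 0 \<and> snd u = 0) \<or> (snd s + 1 = w \<and> snd u = 1)"
  proof -
    consider "fst e = 0" | "fst e = 1" | "snd e = 0" | "snd e = 1" using e(1) by (auto simp: exits_def)
    then show ?thesis
    proof cases
      case 1 then show ?thesis using u by simp
    next
      case 2
      then have "real w = real (fst s) + fst u" using u by simp
      then have "real (fst s) + 1 = w \<and> fst u = 1" using lt u by linarith
      then show ?thesis by linarith
    next
      case 3 then show ?thesis using u by simp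
    next
      case 4
      then have "real w = real (snd s) + snd u" using u by simp
      then have "real (snd s) + 1 = w \<and> snd u = 1" using lt u by linarith
      then show ?thesis by linarith
    qed
  qed
  then have "u \<in> exits" using Y_border[OF u(1)] by auto
  then show "e \<in> cell_map w s ` exits" using u by blast
  show "rk s = h" using * s border_fst[of "fst s" "snd s"] border_snd[of "fst s" "snd s"] by auto
qed

lemma distinct_exits_distinct_pieces:
  assumes e: "e \<in> exits" "e \<in> piece s" "e' \<in> exits" "e' \<in> piece s" and s: "s \<in> white Q"
  shows "e = e'"
proof -
  obtain u where u: "u \<in> Y" "e = cell_map w s u"
    "real w * fst e = real (fst s) + fst u" "real w * snd e = real (snd s) + snd u"
    "0 \<le> fst u" "fst u \<le> 1" "0 \<le> snd u" "snd u \<le> 1" by (rule piece_coords[OF e(2)])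
  obtain v where v: "v \<in> Y" "e' = cell_map w s v"
    "real w * fst e' = real (fst s) + fst v" "real w * snd e' = real (snd s) + snd v"
    "0 \<le> fst v" "fst v \<le> 1" "0 \<le> snd v" "snd v \<le> 1" by (rule piece_coords[OF e(4)])
  have w3: "real w \<ge> 3" using width_ge by simp
  have d: "\<bar>real w * fst e - real w * fst e'\<bar> \<le> 1" "\<bar>real w * snd e - real w * snd e'\<bar> \<le> 1" using u v by linarith+
  have "real w * \<bar>fst e - fst e'\<bar> \<le> 1" "real w * \<bar>snd e - snd e'\<bar> \<le> 1"
    using d by (simp_all add: abs_mult flip: right_diff_distrib)
  then have "3 * \<bar>fst e - fst e'\<bar> \<le> 1" "3 * \<bar>snd e - snd e'\<bar> \<le> 1"
    using mult_right_mono[OF w3 abs_ge_zero[of "fst e - fst e'"]]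
      mult_right_mono[OF w3 abs_ge_zero[of "snd e - snd e'"]] by linarith+
  then show ?thesis using e(1,3) by (auto simp: exits_def)
qed

lemma cut_ranks:
  assumes z: "z \<in> piece s" "z \<in> piece t" and s: "s \<in> outer r i" and t: "t \<in> white Q - outer r i"
    and i: "1 \<le> i"
  shows "leg s = r" "rk s = i" "rk t = i - 1" "leg t = r \<or> i = 1"
proof -
  have st: "s \<noteq> t" "s \<in> white Q" "t \<in> white Q" using s t by (auto simp: outer_def)
  have "(rk s = rk t + 1 \<or> rk t = rk s + 1) \<and> (leg s = leg t \<or> rk s = 0 \<or> rk t = 0)"
    by (rule adjacent_rk[OF st(2,3) piece_inter(1)[OF st(1) z]])
  then show "leg s = r" "rk s = i" "rk t = i - 1" "leg t = r \<or> i = 1"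
    using s t i by (auto simp: outer_def)
qed

text \<open>The only squares on the two sides that can touch are the ones of rank \<open>i\<close> and \<open>i - 1\<close> on leg \<open>r\<close>.\<close>
lemma cut_point_unique:
  assumes z: "z \<in> part (outer r i) \<inter> part (white Q - outer r i)"
    and z': "z' \<in> part (outer r i) \<inter> part (white Q - outer r i)" and i: "1 \<le> i"
  shows "z = z'"
proof -
  obtain s t where st: "s \<in> outer r i" "t \<in> white Q - outer r i" "z \<in> piece s" "z \<in> piece t"
    using z by (auto simp: part_def)
  obtain s' t' where st': "s' \<in> outer r i" "t' \<in> white Q - outer r i" "z' \<in> piece s'" "z' \<in> piece t'"
    using z' by (auto simp: part_def)
  note c = cut_ranks[OF st(3,4,1,2) i] and c' = cut_ranks[OF st'(3,4,1,2) i]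
  have "s = s'" using c c' st st' outer_subset by (intro cell_unique) auto
  moreover have "t = t'" using c c' st st' by (intro cell_unique) auto
  moreover have "s \<noteq> t" using st by auto
  ultimately show ?thesis using piece_inter(3)[of s t z] piece_inter(3)[of s t z'] st st' by metis
qed

lemma sub_cut:
  assumes "U \<subseteq> white Q" "1 \<le> i"
  shows "closed (part (U \<inter> outer r i))" "closed (part (U - outer r i))"
    and "z \<in> part (U \<inter> outer r i) \<inter> part (U - outer r i) \<Longrightarrow>
      z' \<in> part (U \<inter> outer r i) \<inter> part (U - outer r i) \<Longrightarrow> z = z'"
proof -
  show "closed (part (U \<inter> outer r i))" "closed (part (U - outer r i))"
    using assms by (auto intro!: closed_part)
  have "part (U \<inter> outer r i) \<subseteq> part (outer r i)" "part (U - outer r i) \<subseteq> part (white Q - outer r i)"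
    using assms by (auto intro!: part_mono)
  then show "z = z'" if "z \<in> part (U \<inter> outer r i) \<inter> part (U - outer r i)"
      "z' \<in> part (U \<inter> outer r i) \<inter> part (U - outer r i)"
    using that by (intro cut_point_unique[OF _ _ assms(2)]) blast+
qed

lemma cut_point_exit:
  assumes U: "U \<subseteq> white Q"
    and z: "z \<in> part (U \<inter> outer r i) \<inter> part (U - outer r i)"
  shows "\<exists>s\<in>U \<inter> outer r i. z \<in> piece s \<inter> cell_map w s ` exits"
    "\<exists>t\<in>U - outer r i. z \<in> piece t \<inter> cell_map w t ` exits"
proof -
  obtain s t where st: "s \<in> U \<inter> outer r i" "t \<in> U - outer r i" "z \<in> piece s" "z \<in> piece t"
    using z by (auto simp: part_def)
  then have "s \<noteq> t" by auto
  then have "z \<in> cell_map w s ` exits" "z \<in> cell_map w t ` exits"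
    using piece_inter(2)[of s t z] piece_inter(2)[of t s z] st by auto
  with st show "\<exists>s\<in>U \<inter> outer r i. z \<in> piece s \<inter> cell_map w s ` exits"
    "\<exists>t\<in>U - outer r i. z \<in> piece t \<inter> cell_map w t ` exits" by blast+
qed

text \<open>Cutting a connected set at a single point leaves it connected on either side, so \<open>isolate_cell\<close>
  applies.\<close>
lemma connected_Int_piece:
  assumes A: "connected A" "A \<subseteq> part (white Q)" and s: "s \<in> white Q"
  shows "connected (A \<inter> piece s)"
proof -
  define P where "P U \<longleftrightarrow> connected (A \<inter> part U)" for U
  have "P {s}"
  proof (rule isolate_cell[OF _ _ _ s])
    have "A \<inter> part (white Q) = A" using A by blast
    then show "P (white Q)" using A by (simp add: P_def)
  next
    fix U r and i :: nat assume U: "U \<subseteq> white Q" "1 \<le> i" "P U"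
    have "connected ((A \<inter> part U) \<inter> part (U \<inter> outer r i))"
      by (rule connected_Int_cut[of _ _ "part (U - outer r i)"])
        (use U part_split[of U] sub_cut[OF U(1,2)] in \<open>auto simp: P_def\<close>)
    moreover have "(A \<inter> part U) \<inter> part (U \<inter> outer r i) = A \<inter> part (U \<inter> outer r i)"
      by (auto simp: part_def)
    ultimately show "P (U \<inter> outer r i)" by (simp add: P_def)
  next
    fix U r and i :: nat assume U: "U \<subseteq> white Q" "1 \<le> i" "P U"
    have "connected ((A \<inter> part U) \<inter> part (U - outer r i))"
      by (rule connected_Int_cut[of _ _ "part (U \<inter> outer r i)"])
        (use U part_split[of U] sub_cut[OF U(1,2)] in \<open>auto simp: P_def\<close>)
    moreover have "(A \<inter> part U) \<inter> part (U - outer r i) = A \<inter> part (U - outer r i)"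
      by (auto simp: part_def)
    ultimately show "P (U - outer r i)" by (simp add: P_def)
  qed
  then show ?thesis by (simp add: P_def part_def)
qed

text \<open>An end point is either an original end point, assigned to one chosen square that contains it, or an exit
  of the square in which it lies.\<close>
definition anchored :: "real \<times> real \<Rightarrow> nat \<times> nat \<Rightarrow> (nat \<times> nat) set \<Rightarrow> real \<times> real \<Rightarrow> bool" where
  "anchored x sx U u \<longleftrightarrow> (\<exists>t\<in>U. u \<in> piece t \<and> (u \<in> cell_map w t ` exits \<or> t = sx \<and> u = x))"

text \<open>Isolating the square by cuts, each cut turns a lost end point into the cut point, which is an exit of
  the squares it joins.\<close>
lemma irreducible_piece:
  assumes A: "irreducible_between A x y" "A \<subseteq> part (white Q)" and s: "s \<in> white Q"
    and sx: "sx \<in> white Q" "x \<in> piece sx" and sy: "sy \<in> white Q" "y \<in> piece sy"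
    and ne: "A \<inter> piece s \<noteq> {}"
  obtains u v where "irreducible_between (A \<inter> piece s) u v"
    "u \<in> cell_map w s ` exits \<or> s = sx \<and> u = x" "v \<in> cell_map w s ` exits \<or> s = sy \<and> v = y"
proof -
  define P where "P U \<longleftrightarrow> A \<inter> part U = {} \<or>
    (\<exists>u v. irreducible_between (A \<inter> part U) u v \<and> anchored x sx U u \<and> anchored y sy U v)" for U
  have step: "P V" if U: "U \<subseteq> white Q" "1 \<le> i" "P U"
    and V: "V = U \<inter> outer r i \<and> V' = U - outer r i \<or> V' = U \<inter> outer r i \<and> V = U - outer r i" for U V V' r i
  proof (cases "A \<inter> part V = {}")
    case True
    then show ?thesis by (simp add: P_def)
  next
    case False
    have UV: "U = V \<union> V'" using V by blast
    have sub: "part U \<subseteq> part V \<union> part V'" using UV by (auto simp: part_def)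
    have eq: "A \<inter> part U \<inter> part V = A \<inter> part V" using UV by (auto simp: part_def)
    have cl: "closed (part V)" "closed (part V')" using sub_cut(1,2)[OF U(1,2)] V by auto
    have one: "z = z'" if "z \<in> part V \<inter> part V'" "z' \<in> part V \<inter> part V'" for z z'
      using sub_cut(3)[OF U(1,2)] V that by (metis inf_commute)
    have ex: "anchored q sq V z" if "z \<in> part V \<inter> part V'" for q sq z
    proof -
      have "\<exists>t\<in>V. z \<in> piece t \<inter> cell_map w t ` exits"
        using cut_point_exit[OF U(1)] V that by (metis inf_commute)
      then show ?thesis by (auto simp: anchored_def)
    qed
    have "A \<inter> part U \<noteq> {}" using False eq by blast
    then obtain u v where uv: "irreducible_between (A \<inter> part U) u v" "anchored x sx U u" "anchored y sy U v"
      using U(3) by (auto simp: P_def)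
    have au: "if anchored x sx V u then u \<in> part V else u \<in> part V'"
      using uv(2) UV by (auto simp: anchored_def part_def)
    have av: "if anchored y sy V v then v \<in> part V else v \<in> part V'"
      using uv(3) UV by (auto simp: anchored_def part_def)
    obtain u' v' where "irreducible_between (A \<inter> part U \<inter> part V) u' v'"
       "if anchored x sx V u then u' = u else u' \<in> part V \<inter> part V'"
       "if anchored y sy V v then v' = v else v' \<in> part V \<inter> part V'"
      by (rule irreducible_part[OF uv(1) _ cl one _ au av]) (use sub False eq in blast)+
    then have "irreducible_between (A \<inter> part V) u' v'" "anchored x sx V u'" "anchored y sy V v'"
      using eq ex by (auto split: if_splits)
    then show ?thesis unfolding P_def by blast
  qed
  have "P {s}"
  proof (rule isolate_cell[OF _ _ _ s])
    have "A \<inter> part (white Q) = A" using A by blast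
    moreover have "anchored x sx (white Q) x" "anchored y sy (white Q) y"
      using sx sy by (auto simp: anchored_def)
    ultimately show "P (white Q)" unfolding P_def using A(1) by metis
  qed (use step in blast)+
  then obtain u v where "irreducible_between (A \<inter> piece s) u v" "anchored x sx {s} u" "anchored y sy {s} v"
    using ne by (auto simp: P_def part_def)
  then show thesis using that[of u v] by (simp add: anchored_def)
qed

text \<open>Cutting off a leg that holds no end point loses nothing of an irreducible set.\<close>
lemma irreducible_two_legs:
  assumes A: "irreducible_between A x y" "A \<subseteq> part (white Q)"
    and sx: "sx \<in> white Q" "x \<in> piece sx" and sy: "sy \<in> white Q" "y \<in> piece sy"
  shows "A \<subseteq> part {s \<in> white Q. rk s = 0 \<or> leg s = leg sx \<or> leg s = leg sy}"
proof -
  define D where "D n = (\<Union>r\<in>{..<n} - {leg sx, leg sy}. outer r 1)" for n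
  have "A \<subseteq> part (white Q - D n)" for n
  proof (induction n)
    case 0
    then show ?case using A by (simp add: D_def)
  next
    case (Suc n)
    show ?case
    proof (cases "n \<in> {leg sx, leg sy}")
      case True
      then have "D (Suc n) = D n" by (auto simp: D_def less_Suc_eq)
      then show ?thesis using Suc by simp
    next
      case False
      let ?U = "white Q - D n"
      have eq: "?U - outer n 1 = white Q - D (Suc n)"
        using False by (auto simp: D_def less_Suc_eq)
      have con: "connected (A \<inter> part (?U - outer n 1))"
        by (rule connected_Int_cut[of _ _ "part (?U \<inter> outer n 1)"])
          (use A Suc part_split[of ?U "outer n 1"] sub_cut[where U="?U" and i=1 and r=n] in \<open>auto simp: irreducible_between_def\<close>)
      have "sx \<in> ?U - outer n 1" "sy \<in> ?U - outer n 1"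
        using sx sy False by (auto simp: D_def outer_def)
      then have "x \<in> part (?U - outer n 1)" "y \<in> part (?U - outer n 1)"
        using sx sy by (auto simp: part_def)
      moreover have "closed (A \<inter> part (?U - outer n 1))"
        using A(1) sub_cut(2)[where U="?U" and i=1 and r=n] by (auto simp: irreducible_between_def)
      ultimately have "A \<subseteq> part (?U - outer n 1)" using irreducible_subset[OF A(1)] con by blast
      then show ?thesis by (simp only: eq)
    qed
  qed
  moreover have "white Q - D 4 \<subseteq> {s \<in> white Q. rk s = 0 \<or> leg s = leg sx \<or> leg s = leg sy}"
    using leg_less by (auto simp: D_def outer_def)
  ultimately show ?thesis using part_mono by blast
qed

text \<open>A connected set that lives on both sides of a cut contains the cut point, and so exhibits the two
  squares that touch there.\<close>
lemma crossing_point: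
  assumes A: "connected A" "A \<subseteq> part (white Q)" and i: "1 \<le> i"
    and s: "s \<in> outer r i" "A \<inter> piece s \<noteq> {}" and t: "t \<in> white Q - outer r i" "A \<inter> piece t \<noteq> {}"
  obtains z a b where "z \<in> A" "z \<in> piece a" "z \<in> piece b" "a \<in> white Q" "b \<in> white Q" "a \<noteq> b"
    "leg a = r" "rk a = i" "rk b = i - 1" "leg b = r \<or> i = 1"
    "z \<in> cell_map w a ` exits" "z \<in> cell_map w b ` exits"
proof -
  have "s \<in> white Q \<inter> outer r i" using s outer_subset by blast
  then have "A \<inter> part (white Q \<inter> outer r i) \<noteq> {}" "A \<inter> part (white Q - outer r i) \<noteq> {}"
    using s(2) t unfolding part_def by blast+
  then have "A \<inter> (part (white Q \<inter> outer r i) \<inter> part (white Q - outer r i)) \<noteq> {}"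
    using A(2) part_split[of "white Q" "outer r i"] sub_cut(1,2)[OF order_refl i, of r]
    by (intro connected_meets_cut[OF A(1)]) auto
  then obtain z a b where z: "z \<in> A" "a \<in> outer r i" "b \<in> white Q - outer r i" "z \<in> piece a" "z \<in> piece b"
    unfolding part_def by fast
  have "a \<noteq> b" using z by auto
  moreover have "z \<in> cell_map w a ` exits" "z \<in> cell_map w b ` exits"
    using piece_inter(2)[of a b z] piece_inter(2)[of b a z] z \<open>a \<noteq> b\<close> by auto
  ultimately show thesis
    using that z cut_ranks[OF z(4,5,2,3) i] outer_subset by blast
qed

text \<open>The set contains every cut point on the two legs that end in \<open>e\<close> and \<open>e'\<close>. Consecutive cut points are
  different exits of the square between them, and likewise for the last cut point and the exit at the
  end of a leg, and for the two cut points at the centre.\<close>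
lemma crossed_pieces:
  assumes A: "connected A" "A \<subseteq> part (white Q)"
    and e: "e \<in> A" "e \<in> exits" "e' \<in> A" "e' \<in> exits" "e \<noteq> e'"
  defines "G \<equiv> {s \<in> white Q. \<exists>z\<in>A \<inter> piece s. \<exists>z'\<in>A \<inter> piece s.
      z \<noteq> z' \<and> z \<in> cell_map w s ` exits \<and> z' \<in> cell_map w s ` exits}"
  shows "2 * h + 1 \<le> card G"
proof -
  obtain s where s: "s \<in> white Q" "e \<in> piece s" using A e by (auto simp: part_def)
  obtain t where t: "t \<in> white Q" "e' \<in> piece t" using A e by (auto simp: part_def)
  have "s \<noteq> t" using distinct_exits_distinct_pieces s t e by blast
  moreover have rk: "rk s = h" "rk t = h" using exit_in_piece e s t by auto
  ultimately have legs: "leg s \<noteq> leg t" using cell_unique[OF s(1) t(1)] by auto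
  have leg_cell: "\<exists>a\<in>G. leg a = leg s \<and> rk a = i"
    if i: "1 \<le> i" "i \<le> h" and s: "s \<in> white Q" "e \<in> piece s" and t: "t \<in> white Q" "e' \<in> piece t"
      and rk: "rk s = h" "rk t = h" and legs: "leg s \<noteq> leg t" and e: "e \<in> A" "e \<in> exits" "e' \<in> A" for i s t e e'
  proof -
    have cross: thesis if "1 \<le> k" "k \<le> h"
      and "\<And>z a b. z \<in> A \<Longrightarrow> z \<in> piece a \<Longrightarrow> z \<in> piece b \<Longrightarrow> a \<in> white Q \<Longrightarrow> b \<in> white Q \<Longrightarrow> a \<noteq> b \<Longrightarrow>
        leg a = leg s \<Longrightarrow> rk a = k \<Longrightarrow> rk b = k - 1 \<Longrightarrow> leg b = leg s \<or> k = 1 \<Longrightarrow>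
        z \<in> cell_map w a ` exits \<Longrightarrow> z \<in> cell_map w b ` exits \<Longrightarrow> thesis" for k thesis
      using crossing_point[OF A that(1), of s "leg s" t thesis] that s t rk legs e
      by (auto simp: outer_def)
    show ?thesis
    proof (rule cross[OF i])
      fix z a b
      assume z: "z \<in> A" "z \<in> piece a" "z \<in> piece b" "a \<in> white Q" "b \<in> white Q" "a \<noteq> b"
        "leg a = leg s" "rk a = i" "rk b = i - 1" "z \<in> cell_map w a ` exits"
      show ?thesis
      proof (cases "i = h")
        case True
        have "a = s" using cell_unique z s rk True by auto
        have "z \<noteq> e" using exit_in_piece(1)[of e b] e(2) z i True by auto
        then have "s \<in> G" unfolding G_def
          using exit_in_piece(2)[OF e(2) s(2,1)] z e s \<open>a = s\<close> by auto
        then show ?thesis using rk True by blast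
      next
        case False
        show ?thesis
        proof (rule cross[of "Suc i"])
          fix z' a' b'
          assume z': "z' \<in> A" "z' \<in> piece a'" "z' \<in> piece b'" "a' \<in> white Q" "b' \<in> white Q"
            "leg a' = leg s" "rk a' = Suc i" "rk b' = Suc i - 1" "leg b' = leg s \<or> Suc i = 1"
            "z' \<in> cell_map w b' ` exits"
          have "b' = a" using cell_unique z z' i by auto
          have "z \<noteq> z'"
          proof
            assume "z = z'"
            moreover have "b \<noteq> a'" using z(9) z'(7) by auto
            ultimately have "side_adjacent b a'" using piece_inter(1)[of b a' z] z(3) z'(2) by simp
            then show False using adjacent_rk[of b a'] z(5,9) z'(4,7) i(1) by auto
          qed
          then have "a \<in> G" unfolding G_def using z z' \<open>b' = a\<close> by auto
          then show ?thesis using z by blast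
        qed (use i False in auto)
      qed
    qed
  qed
  have centre: "\<exists>a\<in>G. rk a = 0"
  proof (rule crossing_point[OF A, of 1 s "leg s" t])
    fix z a b
    assume z: "z \<in> A" "z \<in> piece a" "z \<in> piece b" "a \<in> white Q" "b \<in> white Q"
        "leg a = leg s" "rk a = 1" "rk b = 1 - 1" "z \<in> cell_map w b ` exits"
    show ?thesis
    proof (rule crossing_point[OF A, of 1 t "leg t" s])
      fix z' a' b'
      assume z': "z' \<in> A" "z' \<in> piece a'" "z' \<in> piece b'" "a' \<in> white Q" "b' \<in> white Q"
        "leg a' = leg t" "rk a' = 1" "rk b' = 1 - 1" "z' \<in> cell_map w b' ` exits"
      have "b' = b" using cell_unique z z' by auto
      have "z \<noteq> z'"
      proof
        assume "z = z'"
        moreover have "a \<noteq> a'" using z(6) z'(6) legs by auto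
        ultimately have "side_adjacent a a'" using piece_inter(1)[of a a' z] z(2) z'(2) by simp
        then show False using adjacent_rk[of a a'] z(4,7) z'(4,7) by auto
      qed
      then have "b \<in> G" unfolding G_def using z z' \<open>b' = b\<close> by auto
      then show ?thesis using z by auto
    qed (use s t e rk legs h_pos in \<open>auto simp: outer_def\<close>)
  qed (use s t e rk legs h_pos in \<open>auto simp: outer_def\<close>)
  \<comment> \<open>This signed rank enumerates the path from one exit to the other, so it takes all
    values from \<open>- h\<close> to \<open>h\<close>.\<close>
  define f where "f a = (if leg a = leg s then int (rk a) else - int (rk a))" for a
  have "{- int h .. int h} \<subseteq> f ` G"
  proof
    fix n assume n: "n \<in> {- int h .. int h}"
    consider "n = 0" | "n > 0" | "n < 0" by linarith
    then show "n \<in> f ` G"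
    proof cases
      case 1
      then show ?thesis using centre by (force simp: f_def)
    next
      case 2
      then obtain a where "a \<in> G" "leg a = leg s" "rk a = nat n"
        using leg_cell[of "nat n" s e t e'] s t rk legs e n by force
      then show ?thesis using 2 by (auto simp: f_def intro!: image_eqI[of _ _ a])
    next
      case 3
      then obtain a where "a \<in> G" "leg a = leg t" "rk a = nat (- n)"
        using leg_cell[of "nat (- n)" t e' s e] s t rk legs e n by force
      then show ?thesis using 3 legs by (auto simp: f_def intro!: image_eqI[of _ _ a])
    qed
  qed
  moreover have "finite G" unfolding G_def using finite_white by simp
  ultimately have "card {- int h .. int h} \<le> card G" using surj_card_le by blast
  then show ?thesis by simp
qed

end

section \<open>Counting squares through all levels\<close>

lemma dist_prod_le: "dist (z :: real \<times> real) z' \<le> \<bar>fst z - fst z'\<bar> + \<bar>snd z - snd z'\<bar>"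
  by (simp add: dist_prod_def dist_real_def) (metis sqrt_sum_squares_le_sum_abs power2_abs)

lemma dist_cell_map: "w > 0 \<Longrightarrow> dist (cell_map w s z) (cell_map w s z') = dist z z' / real w"
  by (simp add: cell_map_def dist_rescale)

lemma dist_cell_inv: "dist (cell_inv w s z) (cell_inv w s z') = real w * dist z z'"
  by (simp add: cell_inv_def dist_rescale)

lemma bounded_diameter_cell_map:
  assumes "bounded U" "diameter U \<le> d" "w > 0" "0 \<le> d"
  shows "bounded (cell_map w s ` U) \<and> diameter (cell_map w s ` U) \<le> d / real w"
proof -
  have le: "dist a b \<le> d / real w" if ab: "a \<in> cell_map w s ` U" "b \<in> cell_map w s ` U" for a b
  proof -
    obtain p q where pq: "p \<in> U" "q \<in> U" "a = cell_map w s p" "b = cell_map w s q" using ab by blast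
    have "dist p q \<le> d" using diameter_bounded_bound[OF assms(1) pq(1,2)] assms(2) by linarith
    then show ?thesis using pq assms by (simp add: dist_cell_map divide_right_mono)
  qed
  then have "bounded (cell_map w s ` U)" unfolding bounded_two_points by blast
  moreover have "diameter (cell_map w s ` U) \<le> d / real w"
    by (rule diameter_le) (use le assms(4) in \<open>simp_all only: dist_norm divide_nonneg_nonneg of_nat_0_le_iff simp_thms\<close>)
  ultimately show ?thesis ..
qed

text \<open>All squares of the grid count here, whether white or not, as a cover of a set knows nothing about white
  squares.\<close>
definition squares_met :: "(real \<times> real) set \<Rightarrow> nat \<Rightarrow> (nat \<times> nat) set" where
  "squares_met A M = {(i, j). i < M \<and> j < M \<and> A \<inter> square i j M \<noteq> {}}"

lemma finite_squares_met: "finite (squares_met A M)"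
  by (rule finite_subset[of _ "{..<M} \<times> {..<M}"]) (auto simp: squares_met_def)

lemma card_squares_met_unit:
  assumes "A \<noteq> {}" "\<And>z. z \<in> A \<Longrightarrow> 0 \<le> fst z \<and> fst z \<le> 1 \<and> 0 \<le> snd z \<and> snd z \<le> 1"
  shows "card (squares_met A 1) = 1"
proof -
  have "A \<inter> square 0 0 1 \<noteq> {}" using assms by (force simp: square_def)
  then have "squares_met A 1 = {(0, 0)}" by (auto simp: squares_met_def)
  then show ?thesis by simp
qed

text \<open>Fine squares inside different coarse squares are different, so the counts in the magnified pieces add
  up.\<close>
lemma card_squares_met_refine:
  assumes G: "finite G" "\<And>s. s \<in> G \<Longrightarrow> fst s < w \<and> snd s < w" and M: "M > 0" and w: "w > 0"
    and K: "\<And>s. s \<in> G \<Longrightarrow> K \<le> card (squares_met (cell_inv w s ` (A \<inter> B s)) M)"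
  shows "card G * K \<le> card (squares_met A (w * M))"
proof -
  let ?S = "SIGMA s:G. squares_met (cell_inv w s ` (A \<inter> B s)) M"
  let ?f = "\<lambda>(s, t). (fst s * M + fst t, snd s * M + snd t)"
  have "inj_on ?f ?S"
  proof (rule inj_onI, clarsimp simp: squares_met_def)
    fix a b i j a' b' i' j' :: nat
    assume lt: "i < M" "j < M" "i' < M" "j' < M"
      and eq: "a * M + i = a' * M + i'" "b * M + j = b' * M + j'"
    have "(a * M + i) div M = (a' * M + i') div M" "(b * M + j) div M = (b' * M + j') div M"
      using eq by simp_all
    then have "a = a'" "b = b'" using lt by simp_all
    then show "a = a' \<and> b = b' \<and> i = i' \<and> j = j'" using eq by simp
  qed
  moreover have "?f ` ?S \<subseteq> squares_met A (w * M)"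
  proof
    fix p assume "p \<in> ?f ` ?S"
    then obtain a b i j where s: "(a, b) \<in> G" "(i, j) \<in> squares_met (cell_inv w (a, b) ` (A \<inter> B (a, b))) M"
      "p = (a * M + i, b * M + j)" by force
    have lt: "a < w" "b < w" "i < M" "j < M" using s G(2)[of "(a, b)"] by (auto simp: squares_met_def)
    have less: "c * M + k < w * M" if "c < w" "k < M" for c k
    proof -
      have "c * M + k < Suc c * M" using that by simp
      also have "\<dots> \<le> w * M" using that by (intro mult_le_mono1) simp
      finally show ?thesis .
    qed
    obtain z where z: "z \<in> A" "cell_inv w (a, b) z \<in> square i j M" using s by (auto simp: squares_met_def)
    have "cell_map w (a, b) (cell_inv w (a, b) z) \<in> cell_map w (a, b) ` square i j M"
      using z by blast
    then have "z \<in> square (a * M + i) (b * M + j) (w * M)"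
      using rescale_square[OF w M, of a b i j] w by (simp add: cell_map_inv) (simp add: cell_map_def)
    then show "p \<in> squares_met A (w * M)" using s(3) less lt z by (auto simp: squares_met_def)
  qed
  ultimately have "card ?S \<le> card (squares_met A (w * M))"
    using card_inj_on_le finite_squares_met by blast
  moreover have "card ?S = (\<Sum>s\<in>G. card (squares_met (cell_inv w s ` (A \<inter> B s)) M))"
    using G finite_squares_met by (intro card_SigmaI) auto
  moreover have "card G * K \<le> (\<Sum>s\<in>G. card (squares_met (cell_inv w s ` (A \<inter> B s)) M))"
    using sum_mono[of G "\<lambda>_. K"] K by simp
  ultimately show ?thesis by linarith
qed

text \<open>\<open>X n\<close> is the limit set of the patterns from index \<open>n\<close> on; it is tiled by copies of \<open>X (Suc n)\<close>. Stating
  bounds for all \<open>n\<close> at once lets them be proved by magnifying one square of the first pattern.\<close>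
locale spider_tower =
  fixes C :: "nat \<Rightarrow> pattern" and h :: "nat \<Rightarrow> nat" and leg rk :: "nat \<Rightarrow> nat \<times> nat \<Rightarrow> nat"
    and X :: "nat \<Rightarrow> (real \<times> real) set"
  assumes spider: "spider (C n) (h n) (leg n) (rk n)"
    and compact_X: "compact (X n)"
    and X_unit: "z \<in> X n \<Longrightarrow> 0 \<le> fst z \<and> fst z \<le> 1 \<and> 0 \<le> snd z \<and> snd z \<le> 1"
    and X_border: "z \<in> X n \<Longrightarrow> fst z \<in> {0, 1} \<or> snd z \<in> {0, 1} \<Longrightarrow> z \<in> exits"
    and X_subset: "X n \<subseteq> (\<Union>s\<in>white (C n). cell_map (width (C n)) s ` X (Suc n))"
begin

sublocale tile: spider_tiling "C n" "h n" "leg n" "rk n" "X (Suc n)" for n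
  by (intro spider_tiling.intro spider_tiling_axioms.intro spider)
    (use compact_X X_unit X_border in blast)+

definition total_width :: "nat \<Rightarrow> nat \<Rightarrow> nat" where
  "total_width n m = (\<Prod>i<m. width (C (n + i)))"

definition crossing_length :: "nat \<Rightarrow> nat \<Rightarrow> nat" where
  "crossing_length n m = (\<Prod>i<m. 2 * h (n + i) + 1)"

lemma total_width_Suc: "total_width n (Suc m) = width (C n) * total_width (Suc n) m"
  unfolding total_width_def by (subst prod.lessThan_Suc_shift) simp

lemma crossing_length_Suc: "crossing_length n (Suc m) = (2 * h n + 1) * crossing_length (Suc n) m"
  unfolding crossing_length_def by (subst prod.lessThan_Suc_shift) simp

lemma total_width_pos: "total_width n m > 0"
  unfolding total_width_def using tile.w_pos by (simp add: prod_pos)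

lemma X_subset_part: "X n \<subseteq> tile.part n (white (C n))"
  using X_subset by (auto simp: tile.part_def tile.piece_def)

definition pull :: "nat \<Rightarrow> nat \<times> nat \<Rightarrow> (real \<times> real) set \<Rightarrow> (real \<times> real) set" where
  "pull n s A = cell_inv (width (C n)) s ` (A \<inter> tile.piece n s)"

lemma pull_subset: "pull n s A \<subseteq> X (Suc n)"
  using tile.w_pos[of n] by (auto simp: pull_def tile.piece_def cell_inv_map)

lemma pull_exits:
  "z \<in> cell_map (width (C n)) s ` exits \<Longrightarrow> cell_inv (width (C n)) s z \<in> exits"
  using tile.w_pos[of n] by (auto simp: cell_inv_map)

lemma pull_eq_iff:
  "cell_inv (width (C n)) s z = cell_inv (width (C n)) s z' \<longleftrightarrow> z = z'"
  using tile.w_pos[of n] by (metis cell_map_inv)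

lemma connected_pull:
  assumes "connected A" "A \<subseteq> X n" "s \<in> white (C n)"
  shows "connected (pull n s A)"
  unfolding pull_def using assms X_subset_part[of n]
  by (intro connected_continuous_image continuous_cell_inv tile.connected_Int_piece) auto

lemma irreducible_pull:
  assumes "irreducible_between (A \<inter> tile.piece n s) u v"
  shows "irreducible_between (pull n s A) (cell_inv (width (C n)) s u) (cell_inv (width (C n)) s v)"
  unfolding pull_def
  by (rule irreducible_homeomorphic_image[OF assms, of "cell_map (width (C n)) s"])
    (use tile.w_pos[of n] in \<open>auto intro: continuous_cell_map continuous_cell_inv simp: cell_map_inv cell_inv_map\<close>)

text \<open>With \<open>L\<close> sets for exit to exit pieces and \<open>2 * L\<close> sets for all others, one level adds up to at most
  \<open>(2 * h + 1) * L + 2 * L\<close>, because only the squares chosen for the two end points can be of the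
  second kind. This is at most \<open>2 * (2 * h + 1) * L\<close>, so the factor 2 does not grow with the level.\<close>
lemma irreducible_cover:
  assumes "irreducible_between A x y" "A \<subseteq> X n"
  shows "\<exists>F. finite F \<and> card F \<le> (if x \<in> exits \<and> y \<in> exits then 1 else 2) * crossing_length n m \<and> A \<subseteq> \<Union>F \<and>
    (\<forall>U\<in>F. bounded U \<and> diameter U \<le> 2 / real (total_width n m))"
  using assms
proof (induction m arbitrary: n A x y)
  case 0
  have "bounded A" using 0(2) compact_X[of n] by (meson bounded_subset compact_imp_bounded)
  moreover have "diameter A \<le> 2"
  proof (rule diameter_le)
    fix z z' assume "z \<in> A" "z' \<in> A"
    then have "z \<in> X n" "z' \<in> X n" using 0(2) by auto
    then show "norm (z - z') \<le> 2"
      using X_unit[of z n] X_unit[of z' n] dist_prod_le[of z z'] unfolding dist_norm by linarith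
  qed simp
  ultimately show ?case by (intro exI[of _ "{A}"]) (simp add: total_width_def crossing_length_def)
next
  case (Suc m)
  let ?w = "width (C n)"
  let ?ex = "x \<in> exits \<and> y \<in> exits"
  have A: "A \<subseteq> tile.part n (white (C n))" using Suc.prems X_subset_part by blast
  have xy: "x \<in> A" "y \<in> A" using Suc.prems by (auto simp: irreducible_between_def)
  obtain sx where sx: "sx \<in> white (C n)" "x \<in> tile.piece n sx" using A xy by (auto simp: tile.part_def)
  obtain sy where sy: "sy \<in> white (C n)" "y \<in> tile.piece n sy" using A xy by (auto simp: tile.part_def)
  define J where "J = {s \<in> white (C n). rk n s = 0 \<or> leg n s = leg n sx \<or> leg n s = leg n sy}"
  have AJ: "A \<subseteq> tile.part n J"
    unfolding J_def by (rule tile.irreducible_two_legs[OF Suc.prems(1) A sx sy])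
  have cardJ: "card J \<le> 2 * h n + 1" by (rule tile.card_two_legs_le) (auto simp: J_def)
  have finJ: "finite J" using tile.finite_white[of n] by (auto simp: J_def)
  \<comment> \<open>The cost of a square, where every end point that is not an exit counts extra.\<close>
  define k where "k s = (if ?ex then 1 else 1 + (if s = sx then 1 else 0) + (if s = sy then 1 else (0::nat)))" for s
  have "\<exists>F. finite F \<and> card F \<le> k s * crossing_length (Suc n) m \<and> A \<inter> tile.piece n s \<subseteq> \<Union>F \<and>
      (\<forall>U\<in>F. bounded U \<and> diameter U \<le> 2 / real (total_width n (Suc m)))" if s: "s \<in> J" for s
  proof (cases "A \<inter> tile.piece n s = {}")
    case True
    then show ?thesis by (intro exI[of _ "{}"]) simp
  next
    case False
    have sW: "s \<in> white (C n)" using s by (simp add: J_def)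
    obtain u v where uv: "irreducible_between (A \<inter> tile.piece n s) u v"
      "u \<in> cell_map ?w s ` exits \<or> s = sx \<and> u = x" "v \<in> cell_map ?w s ` exits \<or> s = sy \<and> v = y"
      by (rule tile.irreducible_piece[OF Suc.prems(1) A sW sx sy False])
    let ?u = "cell_inv ?w s u" and ?v = "cell_inv ?w s v"
    obtain F where F: "finite F" "card F \<le> (if ?u \<in> exits \<and> ?v \<in> exits then 1 else 2) * crossing_length (Suc n) m"
      "pull n s A \<subseteq> \<Union>F" "\<And>U. U \<in> F \<Longrightarrow> bounded U \<and> diameter U \<le> 2 / real (total_width (Suc n) m)"
      using Suc.IH[OF irreducible_pull[OF uv(1)] pull_subset] by blast
    have ku: "?u \<in> exits" if "x \<in> exits \<or> s \<noteq> sx"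
    proof -
      have "u \<in> cell_map ?w s ` exits" using that uv(2) tile.exit_in_piece(2)[of x n s] sx by blast
      then show ?thesis by (rule pull_exits)
    qed
    have kv: "?v \<in> exits" if "y \<in> exits \<or> s \<noteq> sy"
    proof -
      have "v \<in> cell_map ?w s ` exits" using that uv(3) tile.exit_in_piece(2)[of y n s] sy by blast
      then show ?thesis by (rule pull_exits)
    qed
    have "(if ?u \<in> exits \<and> ?v \<in> exits then 1 else 2) \<le> k s"
      using ku kv by (auto simp: k_def)
    then have "card F \<le> k s * crossing_length (Suc n) m" using F(2) by (meson le_trans mult_le_mono1)
    then have "card ((`) (cell_map ?w s) ` F) \<le> k s * crossing_length (Suc n) m"
      using card_image_le[OF F(1)] le_trans by blast
    moreover have "A \<inter> tile.piece n s \<subseteq> \<Union>((`) (cell_map ?w s) ` F)"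
    proof
      fix z assume "z \<in> A \<inter> tile.piece n s"
      then have "cell_inv ?w s z \<in> \<Union>F" using F(3) by (auto simp: pull_def)
      then obtain U where "U \<in> F" "cell_inv ?w s z \<in> U" by blast
      then have "z \<in> cell_map ?w s ` U"
        using cell_map_inv[OF tile.w_pos, of n s z] by force
      then show "z \<in> \<Union>((`) (cell_map ?w s) ` F)" using \<open>U \<in> F\<close> by blast
    qed
    moreover have "\<forall>U\<in>(`) (cell_map ?w s) ` F. bounded U \<and> diameter U \<le> 2 / real (total_width n (Suc m))"
      using bounded_diameter_cell_map[OF _ _ tile.w_pos[of n], of _ "2 / real (total_width (Suc n) m)" s] F(4)
      by (auto simp: total_width_Suc mult.commute)
    ultimately show ?thesis using F(1) by (intro exI[of _ "(`) (cell_map ?w s) ` F"]) simp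
  qed
  then obtain F where F: "\<And>s. s \<in> J \<Longrightarrow> finite (F s) \<and> card (F s) \<le> k s * crossing_length (Suc n) m \<and>
      A \<inter> tile.piece n s \<subseteq> \<Union>(F s) \<and> (\<forall>U\<in>F s. bounded U \<and> diameter U \<le> 2 / real (total_width n (Suc m)))"
    by metis
  have "card (\<Union>s\<in>J. F s) \<le> (\<Sum>s\<in>J. card (F s))" by (rule card_UN_le[OF finJ])
  also have "\<dots> \<le> (\<Sum>s\<in>J. k s * crossing_length (Suc n) m)" using F by (intro sum_mono) blast
  also have "\<dots> = (\<Sum>s\<in>J. k s) * crossing_length (Suc n) m" by (simp add: sum_distrib_right)
  also have "\<dots> \<le> ((if ?ex then 1 else 2) * (2 * h n + 1)) * crossing_length (Suc n) m"
  proof (rule mult_le_mono1)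
    have delta: "(\<Sum>s\<in>J. if s = t then 1 else (0::nat)) \<le> 1" for t using finJ by simp
    show "(\<Sum>s\<in>J. k s) \<le> (if ?ex then 1 else 2) * (2 * h n + 1)"
    proof (cases ?ex)
      case True
      then show ?thesis using cardJ by (simp add: k_def)
    next
      case False
      then have "(\<Sum>s\<in>J. k s) = (\<Sum>s\<in>J. 1 + (if s = sx then 1 else 0) + (if s = sy then 1 else 0))"
        by (intro sum.cong refl) (simp only: k_def if_False)
      also have "\<dots> = card J + (\<Sum>s\<in>J. if s = sx then 1 else 0) + (\<Sum>s\<in>J. if s = sy then 1 else 0)"
        unfolding sum.distrib by (simp only: sum_constant mult_1_right of_nat_id)
      also have "\<dots> \<le> 2 * (2 * h n + 1)"
      proof -
        have "card J + (\<Sum>s\<in>J. if s = sx then 1 else 0) + (\<Sum>s\<in>J. if s = sy then 1 else 0)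
            \<le> (2 * h n + 1) + 1 + 1"
          by (intro add_mono cardJ delta)
        also have "\<dots> \<le> 2 * (2 * h n + 1)" using tile.h_pos[of n] by simp
        finally show ?thesis .
      qed
      finally show ?thesis using False by (simp only: if_False)
    qed
  qed
  finally have "card (\<Union>s\<in>J. F s) \<le> (if ?ex then 1 else 2) * crossing_length n (Suc m)"
    by (simp only: crossing_length_Suc mult.assoc)
  moreover have "finite (\<Union>s\<in>J. F s)" using finJ F by blast
  moreover have "A \<subseteq> \<Union>(\<Union>s\<in>J. F s)"
  proof
    fix z assume z: "z \<in> A"
    then obtain s where "s \<in> J" "z \<in> tile.piece n s" using AJ by (auto simp: tile.part_def)
    then show "z \<in> \<Union>(\<Union>s\<in>J. F s)" using F[of s] z by blast
  qed
  moreover have "\<forall>U\<in>(\<Union>s\<in>J. F s). bounded U \<and> diameter U \<le> 2 / real (total_width n (Suc m))"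
    using F by blast
  ultimately show ?case by (intro exI[of _ "\<Union>s\<in>J. F s"] conjI)
qed

lemma card_squares_met_step:
  assumes "G \<subseteq> white (C n)" "\<And>s. s \<in> G \<Longrightarrow> K \<le> card (squares_met (pull n s A) (total_width (Suc n) m))"
  shows "card G * K \<le> card (squares_met A (total_width n (Suc m)))"
  unfolding total_width_Suc
proof (rule card_squares_met_refine[where B = "tile.piece n"])
  show "finite G" using assms(1) tile.finite_white finite_subset by blast
  show "fst s < width (C n) \<and> snd s < width (C n)" if "s \<in> G" for s
    using tile.white_sub[of "fst s" "snd s" n] that assms(1) by auto
qed (use total_width_pos tile.w_pos assms in \<open>auto simp: pull_def\<close>)

text \<open>Every crossed square of the first pattern contains, after magnification, a connected set with two exits.\<close>
lemma squares_met_between_exits: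
  assumes "connected A" "A \<subseteq> X n" "e \<in> A" "e \<in> exits" "e' \<in> A" "e' \<in> exits" "e \<noteq> e'"
  shows "crossing_length n m \<le> card (squares_met A (total_width n m))"
  using assms
proof (induction m arbitrary: n A e e')
  case 0
  have "card (squares_met A 1) = 1" by (rule card_squares_met_unit) (use 0 X_unit in blast)+
  then show ?case by (simp add: total_width_def crossing_length_def)
next
  case (Suc m)
  let ?w = "width (C n)"
  define G where "G = {s \<in> white (C n). \<exists>z\<in>A \<inter> tile.piece n s. \<exists>z'\<in>A \<inter> tile.piece n s.
      z \<noteq> z' \<and> z \<in> cell_map ?w s ` exits \<and> z' \<in> cell_map ?w s ` exits}"
  have "2 * h n + 1 \<le> card G"
    unfolding G_def using Suc.prems X_subset_part[of n] by (intro tile.crossed_pieces[of A n e e']) auto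
  then have "crossing_length n (Suc m) \<le> card G * crossing_length (Suc n) m"
    unfolding crossing_length_Suc by (rule mult_le_mono1)
  also have "\<dots> \<le> card (squares_met A (total_width n (Suc m)))"
  proof (rule card_squares_met_step)
    show "G \<subseteq> white (C n)" by (auto simp: G_def)
    fix s assume "s \<in> G"
    then obtain z z' where z: "s \<in> white (C n)" "z \<in> A \<inter> tile.piece n s" "z' \<in> A \<inter> tile.piece n s"
      "z \<noteq> z'" "z \<in> cell_map ?w s ` exits" "z' \<in> cell_map ?w s ` exits"
      unfolding G_def by blast
    show "crossing_length (Suc n) m \<le> card (squares_met (pull n s A) (total_width (Suc n) m))"
    proof (rule Suc.IH)
      show "connected (pull n s A)" using connected_pull Suc.prems z by blast
      show "cell_inv ?w s z \<in> pull n s A" "cell_inv ?w s z' \<in> pull n s A"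
        using z by (auto simp: pull_def)
    qed (use z pull_exits pull_eq_iff pull_subset in auto)
  qed
  finally show ?case .
qed

text \<open>The lower bound up to a constant factor. The constant makes the property insensitive to finitely many
  levels.\<close>
definition thick :: "nat \<Rightarrow> (real \<times> real) set \<Rightarrow> bool" where
  "thick n A \<longleftrightarrow> (\<exists>c>0. \<forall>m. c * real (crossing_length n m) \<le> real (card (squares_met A (total_width n m))))"

lemma thick_if_two_exits:
  assumes "connected A" "A \<subseteq> X n" "e \<in> A" "e \<in> exits" "e' \<in> A" "e' \<in> exits" "e \<noteq> e'"
  shows "thick n A"
  unfolding thick_def using squares_met_between_exits[OF assms] by (intro exI[of _ 1]) simp

lemma thick_if_pull_thick:
  assumes A: "A \<subseteq> X n" "A \<noteq> {}" and s: "s \<in> white (C n)" and th: "thick (Suc n) (pull n s A)"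
  shows "thick n A"
proof -
  obtain c where c: "c > 0" "\<And>m. c * real (crossing_length (Suc n) m) \<le> real (card (squares_met (pull n s A) (total_width (Suc n) m)))"
    using th by (auto simp: thick_def)
  define c' where "c' = min 1 (c / real (2 * h n + 1))"
  have c': "0 < c'" "c' \<le> 1" using c by (auto simp: c'_def)
  have "c' * real (2 * h n + 1) \<le> (c / real (2 * h n + 1)) * real (2 * h n + 1)"
    by (intro mult_right_mono) (auto simp: c'_def)
  then have c'_le: "c' * real (2 * h n + 1) \<le> c" by simp
  have "c' * real (crossing_length n m) \<le> real (card (squares_met A (total_width n m)))" for m
  proof (cases m)
    case 0
    have "card (squares_met A 1) = 1" by (rule card_squares_met_unit) (use A X_unit in blast)+
    then show ?thesis using c' 0 by (simp add: total_width_def crossing_length_def)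
  next
    case (Suc k)
    have "c' * real (crossing_length n m) = (c' * real (2 * h n + 1)) * real (crossing_length (Suc n) k)"
      by (simp only: Suc crossing_length_Suc of_nat_mult mult.assoc)
    also have "\<dots> \<le> c * real (crossing_length (Suc n) k)" using c'_le by (rule mult_right_mono) simp
    also have "\<dots> \<le> real (card (squares_met (pull n s A) (total_width (Suc n) k)))" by (rule c)
    also have "\<dots> \<le> real (card (squares_met A (total_width n m)))"
      using card_squares_met_step[of "{s}" n "card (squares_met (pull n s A) (total_width (Suc n) k))" A k] s Suc by simp
    finally show ?thesis .
  qed
  then show ?thesis unfolding thick_def using c'(1) by blast
qed

lemma dist_pull: "3 * dist z z' \<le> dist (cell_inv (width (C n)) s z) (cell_inv (width (C n)) s z')"
  using tile.width_ge[of n] by (simp add: dist_cell_inv mult_right_mono)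

lemma dist_le_2: "z \<in> X n \<Longrightarrow> z' \<in> X n \<Longrightarrow> dist z z' \<le> 2"
  using X_unit[of z n] X_unit[of z' n] dist_prod_le[of z z'] by linarith

text \<open>Either \<open>x\<close> shares the square of the exit \<open>e\<close>, and magnifying it brings the two points at least three
  times further apart; or the set leaves this square through its inner cut point, which is a second
  exit of the square. Since the limit sets have diameter at most 2, the first case cannot go on.\<close>
lemma thick_if_exit_far:
  assumes "connected A" "A \<subseteq> X n" "e \<in> A" "e \<in> exits" "x \<in> A" "2 / 3 ^ N < dist x e"
  shows "thick n A"
  using assms
proof (induction N arbitrary: n A e x)
  case 0
  then show ?case using dist_le_2[of x n e] by auto
next
  case (Suc N)
  let ?w = "width (C n)"
  have A: "A \<subseteq> tile.part n (white (C n))" using Suc.prems X_subset_part by blast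
  obtain s where s: "s \<in> white (C n)" "x \<in> tile.piece n s" using A Suc.prems by (auto simp: tile.part_def)
  obtain t where t: "t \<in> white (C n)" "e \<in> tile.piece n t" using A Suc.prems by (auto simp: tile.part_def)
  have et: "rk n t = h n" "e \<in> cell_map ?w t ` exits" using tile.exit_in_piece t Suc.prems by auto
  have con: "connected (pull n t A)" using connected_pull Suc.prems t by blast
  have e': "cell_inv ?w t e \<in> pull n t A" "cell_inv ?w t e \<in> exits"
    using Suc.prems t et pull_exits by (auto simp: pull_def)
  have "thick (Suc n) (pull n t A)"
  proof (cases "s = t")
    case True
    have "2 / 3 ^ N < dist (cell_inv ?w t x) (cell_inv ?w t e)"
      using dist_pull[of x e n t] Suc.prems(6) by simp
    moreover have "cell_inv ?w t x \<in> pull n t A" using Suc.prems s True by (auto simp: pull_def)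
    ultimately show ?thesis using Suc.IH[OF con pull_subset e'] by blast
  next
    case False
    have s_in: "s \<in> white (C n) - tile.outer n (leg n t) (h n)" "A \<inter> tile.piece n s \<noteq> {}"
      using tile.cell_unique[of s n t] tile.rk_le[of s n] False s t et Suc.prems by (auto simp: tile.outer_def)
    have t_in: "t \<in> tile.outer n (leg n t) (h n)" "A \<inter> tile.piece n t \<noteq> {}"
      using t et Suc.prems by (auto simp: tile.outer_def)
    obtain z a b where z: "z \<in> A" "z \<in> tile.piece n a" "z \<in> tile.piece n b"
        "a \<in> white (C n)" "b \<in> white (C n)" "leg n a = leg n t" "rk n a = h n" "rk n b = h n - 1"
        "z \<in> cell_map ?w a ` exits"
      by (rule tile.crossing_point[OF Suc.prems(1) A tile.h_pos t_in s_in]; rule that; assumption)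
    have "a = t" using tile.cell_unique z t et by auto
    have "z \<noteq> e" using tile.exit_in_piece(1)[of e n b] z Suc.prems(4) tile.h_pos[of n] by auto
    moreover have "cell_inv ?w t z \<in> pull n t A" using z \<open>a = t\<close> by (auto simp: pull_def)
    ultimately show ?thesis
      using thick_if_two_exits[OF con pull_subset e'(1,2), of "cell_inv ?w t z"] z(9) \<open>a = t\<close>
      by (simp add: pull_exits pull_eq_iff)
  qed
  then show ?case using thick_if_pull_thick Suc.prems t by blast
qed

lemma thick_if_exit:
  assumes "connected A" "A \<subseteq> X n" "e \<in> A" "e \<in> exits" "x \<in> A" "x \<noteq> e"
  shows "thick n A"
proof -
  obtain N where "(1/3::real) ^ N < dist x e / 2"
    using real_arch_pow_inv[of "dist x e / 2" "1/3"] assms by auto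
  then have "2 / 3 ^ N < dist x e" by (simp add: power_one_over field_simps)
  then show ?thesis using thick_if_exit_far assms by blast
qed

text \<open>As long as both points share a square, magnify. Otherwise the set contains the cut point on the inner
  side of the square of larger rank, to which the previous lemma applies unless this cut point is the
  given point. In that case the point also lies in the next square towards the centre, and
  the sum of the ranks decreases.\<close>
lemma thick_if_far:
  assumes "connected A" "A \<subseteq> X n" "x \<in> A" "y \<in> A" "2 / 3 ^ N < dist x y"
  shows "thick n A"
  using assms
proof (induction N arbitrary: n A x y)
  case 0
  then show ?case using dist_le_2[of x n y] by auto
next
  case (Suc N)
  let ?w = "width (C n)"
  have A: "A \<subseteq> tile.part n (white (C n))" using Suc.prems X_subset_part by blast
  have claim: "thick n A"
    if "k = rk n s + rk n t" "x \<in> A" "y \<in> A" "2 / 3 ^ Suc N < dist x y"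
      "s \<in> white (C n)" "x \<in> tile.piece n s" "t \<in> white (C n)" "y \<in> tile.piece n t" for k s t x y
    using that
  proof (induction k arbitrary: s t x y rule: less_induct)
    case (less k)
    have main: "thick n A"
      if le: "rk n t \<le> rk n s" and ne: "s \<noteq> t" and k: "k = rk n s + rk n t"
        and xy: "x \<in> A" "y \<in> A" "2 / 3 ^ Suc N < dist x y"
        and s: "s \<in> white (C n)" "x \<in> tile.piece n s" and t: "t \<in> white (C n)" "y \<in> tile.piece n t"
      for s t x y
    proof -
      have "1 \<le> rk n s" using tile.cell_unique[of s n t] le ne s t by (cases "rk n s = 0") auto
      have t_in: "t \<in> white (C n) - tile.outer n (leg n s) (rk n s)" "A \<inter> tile.piece n t \<noteq> {}"
        using tile.cell_unique[of s n t] ne le s t xy by (auto simp: tile.outer_def)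
      have s_in: "s \<in> tile.outer n (leg n s) (rk n s)" "A \<inter> tile.piece n s \<noteq> {}"
        using s xy by (auto simp: tile.outer_def)
      obtain z a b where z: "z \<in> A" "z \<in> tile.piece n a" "z \<in> tile.piece n b"
        "a \<in> white (C n)" "b \<in> white (C n)" "leg n a = leg n s" "rk n a = rk n s" "rk n b = rk n s - 1"
        "z \<in> cell_map ?w a ` exits"
        by (rule tile.crossing_point[OF Suc.prems(1) A \<open>1 \<le> rk n s\<close> s_in t_in]; rule that; assumption)
      have "a = s" using tile.cell_unique z s by auto
      show ?thesis
      proof (cases "x = z")
        case True
        show ?thesis
          by (rule less.IH[OF _ refl xy, of b t]) (use z True t k \<open>1 \<le> rk n s\<close> in auto)
      next
        case False
        have "thick (Suc n) (pull n s A)"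
          by (rule thick_if_exit[of _ _ "cell_inv ?w s z" "cell_inv ?w s x"])
            (use connected_pull Suc.prems s z \<open>a = s\<close> xy False pull_subset pull_exits pull_eq_iff
              in \<open>auto simp: pull_def\<close>)
        then show ?thesis using thick_if_pull_thick Suc.prems s by blast
      qed
    qed
    show ?case
    proof (cases "s = t")
      case True
      have "2 / 3 ^ N < dist (cell_inv ?w s x) (cell_inv ?w s y)"
        using dist_pull[of x y n s] less.prems(4) by simp
      moreover have "cell_inv ?w s x \<in> pull n s A" "cell_inv ?w s y \<in> pull n s A"
        using less.prems True by (auto simp: pull_def)
      ultimately have "thick (Suc n) (pull n s A)"
        using Suc.IH[OF connected_pull pull_subset] Suc.prems less.prems(5) by blast
      then show ?thesis using thick_if_pull_thick Suc.prems less.prems(5) by blast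
    next
      case False
      then show ?thesis
        using main[of t s x y] main[of s t y x] less.prems
        by (cases "rk n t \<le> rk n s") (auto simp: dist_commute)
    qed
  qed
  obtain s where s: "s \<in> white (C n)" "x \<in> tile.piece n s" using A Suc.prems by (auto simp: tile.part_def)
  obtain t where t: "t \<in> white (C n)" "y \<in> tile.piece n t" using A Suc.prems by (auto simp: tile.part_def)
  show ?case using claim[OF refl Suc.prems(3,4,5) s t] .
qed

lemma thick_connected:
  assumes "connected A" "A \<subseteq> X n" "x \<in> A" "y \<in> A" "x \<noteq> y"
  shows "thick n A"
proof -
  obtain N where "(1/3::real) ^ N < dist x y / 2"
    using real_arch_pow_inv[of "dist x y / 2" "1/3"] assms by auto
  then have "2 / 3 ^ N < dist x y" by (simp add: power_one_over field_simps)
  then show ?thesis using thick_if_far assms by blast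
qed

end

section \<open>Cross and snake cross patterns are spiders\<close>

definition quadrant :: "int \<times> int \<Rightarrow> nat" where
  "quadrant = (\<lambda>(x, y). if \<bar>x\<bar> < y then 0 else if \<bar>y\<bar> < - x then 1 else if \<bar>x\<bar> < - y then 2 else 3)"

text \<open>Rotates a point of the plane into the cone \<open>\<bar>x\<bar> < y\<close> above the diagonals.\<close>
definition turn_to_top :: "int \<times> int \<Rightarrow> int \<times> int" where
  "turn_to_top = (\<lambda>(x, y). if \<bar>x\<bar> < y then (x, y) else if \<bar>y\<bar> < - x then (y, - x)
     else if \<bar>x\<bar> < - y then (- x, - y) else (- y, x))"

definition four_arms :: "(int \<times> int) set \<Rightarrow> (int \<times> int) set" where
  "four_arms T = {(0, 0)} \<union> (\<Union>r<4. (quarter_turn ^^ r) ` T)"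

lemma four_arms_eq:
  "four_arms T = {(0, 0)} \<union> T \<union> (\<lambda>(x, y). (- y, x)) ` T \<union> (\<lambda>(x, y). (- x, - y)) ` T \<union> (\<lambda>(x, y). (y, - x)) ` T"
proof -
  have "{..<4::nat} = {0, 1, 2, 3}" by auto
  moreover have "quarter_turn ^^ 0 = id" "quarter_turn ^^ 1 = (\<lambda>(x, y). (- y, x))"
    "quarter_turn ^^ 2 = (\<lambda>(x, y). (- x, - y))" "quarter_turn ^^ 3 = (\<lambda>(x, y). (y, - x))"
    by (auto simp: quarter_turn_def fun_eq_iff numeral_2_eq_2 numeral_3_eq_3)
  ultimately show ?thesis by (simp add: four_arms_def Un_assoc)
qed

lemma four_arms_centre: "(0, 0) \<in> four_arms T"
  by (simp add: four_arms_def)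

lemma four_arms_rotations:
  assumes "(x, y) \<in> T"
  shows "(x, y) \<in> four_arms T" "(- y, x) \<in> four_arms T" "(- x, - y) \<in> four_arms T" "(y, - x) \<in> four_arms T"
  unfolding four_arms_eq
  using assms imageI[OF assms, of "\<lambda>(x, y). (- y, x)"] imageI[OF assms, of "\<lambda>(x, y). (- x, - y)"]
    imageI[OF assms, of "\<lambda>(x, y). (y, - x)"] by simp_all

text \<open>An arm inside the cone above the diagonals has rotations inside the other three cones, so the four arms
  are disjoint.\<close>
lemma four_arms_cases:
  assumes T: "T \<subseteq> {(x, y). \<bar>x\<bar> < y}" and p: "(x, y) \<in> four_arms T"
  shows "(x, y) = (0, 0) \<or>
    (\<bar>x\<bar> < y \<and> (x, y) \<in> T \<and> quadrant (x, y) = 0 \<and> turn_to_top (x, y) = (x, y)) \<or>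
    (\<bar>y\<bar> < - x \<and> (y, - x) \<in> T \<and> quadrant (x, y) = 1 \<and> turn_to_top (x, y) = (y, - x)) \<or>
    (\<bar>x\<bar> < - y \<and> (- x, - y) \<in> T \<and> quadrant (x, y) = 2 \<and> turn_to_top (x, y) = (- x, - y)) \<or>
    (\<bar>y\<bar> < x \<and> (- y, x) \<in> T \<and> quadrant (x, y) = 3 \<and> turn_to_top (x, y) = (- y, x))"
proof -
  have cone: "\<bar>x\<bar> < y" if "(x, y) \<in> T" for x y using T that by auto
  consider "(x, y) = (0, 0)" | "(x, y) \<in> T" | "(y, - x) \<in> T" | "(- x, - y) \<in> T" | "(- y, x) \<in> T"
    using p by (auto simp: four_arms_eq)
  then show ?thesis
  proof cases
    case 1 then show ?thesis by simp
  next
    case 2 then show ?thesis using cone[OF 2] by (simp add: quadrant_def turn_to_top_def)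
  next
    case 3
    have "\<bar>y\<bar> < - x" using cone[OF 3] .
    then have "\<not> \<bar>x\<bar> < y" by linarith
    then show ?thesis using 3 \<open>\<bar>y\<bar> < - x\<close> by (simp add: quadrant_def turn_to_top_def)
  next
    case 4
    have "\<bar>x\<bar> < - y" using cone[OF 4] by simp
    then have "\<not> \<bar>x\<bar> < y" "\<not> \<bar>y\<bar> < - x" by linarith+
    then show ?thesis using 4 \<open>\<bar>x\<bar> < - y\<close> by (simp add: quadrant_def turn_to_top_def)
  next
    case 5
    have "\<bar>y\<bar> < x" using cone[OF 5] by simp
    then have "\<not> \<bar>x\<bar> < y" "\<not> \<bar>y\<bar> < - x" "\<not> \<bar>x\<bar> < - y" by linarith+
    then show ?thesis using 5 \<open>\<bar>y\<bar> < x\<close> by (simp add: quadrant_def turn_to_top_def)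
  qed
qed

text \<open>Squares in different cones are never adjacent, so all properties of a spider reduce to properties of the
  top arm with its numbering \<open>\<rho>\<close>.\<close>
lemma spider_if_four_arms:
  fixes T :: "(int \<times> int) set" and \<rho> :: "int \<times> int \<Rightarrow> int" and c h :: nat
  assumes Q: "width Q = 2 * c + 1"
      "\<And>i j. (i, j) \<in> white Q \<Longrightarrow> (int i - int c, int j - int c) \<in> four_arms T"
    and pos: "1 \<le> c" "1 \<le> h"
    and cone: "\<And>x y. (x, y) \<in> T \<Longrightarrow> \<bar>x\<bar> < y \<and> y \<le> int c"
    and range: "\<And>s. s \<in> T \<Longrightarrow> 1 \<le> \<rho> s \<and> \<rho> s \<le> int h"
    and inj: "\<And>s t. s \<in> T \<Longrightarrow> t \<in> T \<Longrightarrow> \<rho> s = \<rho> t \<Longrightarrow> s = t"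
    and adj: "\<And>x y x' y'. (x, y) \<in> T \<Longrightarrow> (x', y') \<in> T \<Longrightarrow> \<bar>x - x'\<bar> + \<bar>y - y'\<bar> = 1 \<Longrightarrow>
      \<rho> (x, y) = \<rho> (x', y') + 1 \<or> \<rho> (x', y') = \<rho> (x, y) + 1"
    and first: "(0, 1) \<in> T \<Longrightarrow> \<rho> (0, 1) = 1"
    and last: "\<And>x. (x, int c) \<in> T \<Longrightarrow> x = 0 \<and> \<rho> (x, int c) = int h"
  shows "\<exists>leg rk. spider Q h leg rk"
proof -
  define co where "co = (\<lambda>(i, j). (int i - int c, int j - int c))"
  define rk where "rk s = (if co s = (0, 0) then 0 else nat (\<rho> (turn_to_top (co s))))" for s
  define leg where "leg s = quadrant (co s)" for s
  have co_inj: "co s = co t \<Longrightarrow> s = t" for s t by (auto simp: co_def split: prod.splits)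
  let ?cone = "\<lambda>l x y a b. \<bar>x\<bar> < y \<and> l = (0::nat) \<and> a = x \<and> b = y \<or>
    \<bar>y\<bar> < - x \<and> l = 1 \<and> a = y \<and> b = - x \<or> \<bar>x\<bar> < - y \<and> l = 2 \<and> a = - x \<and> b = - y \<or>
    \<bar>y\<bar> < x \<and> l = 3 \<and> a = - y \<and> b = x"
  have cell: "co s = (0, 0) \<and> rk s = 0 \<or>
    (\<exists>x y a b. co s = (x, y) \<and> leg s < 4 \<and> rk s = nat (\<rho> (a, b)) \<and> (a, b) \<in> T \<and>
      (?cone (leg s) x y a b))"
    if "s \<in> white Q" for s
  proof -
    obtain i j where s: "s = (i, j)" by force
    obtain x y where xy: "co s = (x, y)" by force
    have four: "(x, y) \<in> four_arms T" using Q(2)[of i j] that s xy by (simp add: co_def)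
    have cone1: "T \<subseteq> {(x, y). \<bar>x\<bar> < y}" using cone by blast
    from four_arms_cases[OF cone1 four] show ?thesis
      by (elim disjE conjE) (auto simp: xy rk_def leg_def)
  qed
  \<comment> \<open>In every cone the larger coordinate has absolute value below \<open>c\<close>, except at the exit.\<close>
  have border: "rk s = h \<and> (\<bar>x\<bar> = int c \<longrightarrow> y = 0) \<and> (\<bar>y\<bar> = int c \<longrightarrow> x = 0)"
    if bd: "s \<in> white Q" "co s = (x, y)" "\<bar>x\<bar> = int c \<or> \<bar>y\<bar> = int c" for s x y
  proof -
    obtain a b where ab: "rk s = nat (\<rho> (a, b))" "(a, b) \<in> T"
       "?cone (leg s) x y a b"
      using cell[OF bd(1)] bd(2,3) pos by auto
    have b: "b = int c" using cone[OF ab(2)] ab(3) bd(3) by linarith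
    then have "a = 0" "\<rho> (a, b) = int h" using last[of a] ab(2) by auto
    then show ?thesis using ab b pos by auto
  qed
  have "spider Q h leg rk"
  proof
    show "3 \<le> width Q" using Q(1) pos by simp
    show "1 \<le> h" by (rule pos)
    show "i < width Q \<and> j < width Q" if "(i, j) \<in> white Q" for i j
    proof -
      have "\<bar>int i - int c\<bar> \<le> int c \<and> \<bar>int j - int c\<bar> \<le> int c"
        using cell[OF that] cone by (auto simp: co_def) (smt (verit))+
      then show ?thesis using Q(1) by linarith
    qed
    show "rk s \<le> h" if "s \<in> white Q" for s
      using cell[OF that] range by (auto simp: nat_le_iff)
    show "leg s < 4" if "s \<in> white Q" for s
      by (auto simp: leg_def quadrant_def split: prod.splits)
    show "s = t" if st: "s \<in> white Q" "t \<in> white Q" "rk s = rk t" "rk s = 0 \<or> leg s = leg t" for s t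
    proof (cases "rk s = 0")
      case True
      have "co u = (0, 0)" if "u \<in> white Q" "rk u = 0" for u
        using cell[OF that(1)] that(2) range by (auto dest!: range)
      then have "co s = co t" using True st by simp
      then show ?thesis by (rule co_inj)
    next
      case False
      obtain x y a b where s: "co s = (x, y)" "rk s = nat (\<rho> (a, b))" "(a, b) \<in> T"
        "leg s = 0 \<and> a = x \<and> b = y \<or> leg s = 1 \<and> a = y \<and> b = - x \<or>
         leg s = 2 \<and> a = - x \<and> b = - y \<or> leg s = 3 \<and> a = - y \<and> b = x"
        using cell[OF st(1)] False by auto
      obtain x' y' a' b' where t: "co t = (x', y')" "rk t = nat (\<rho> (a', b'))" "(a', b') \<in> T"
        "leg t = 0 \<and> a' = x' \<and> b' = y' \<or> leg t = 1 \<and> a' = y' \<and> b' = - x' \<or>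
         leg t = 2 \<and> a' = - x' \<and> b' = - y' \<or> leg t = 3 \<and> a' = - y' \<and> b' = x'"
        using cell[OF st(2)] False st(3) by auto
      have "\<rho> (a, b) = \<rho> (a', b')" using st(3) s(2) t(2) range[OF s(3)] range[OF t(3)] by linarith
      then have "(a, b) = (a', b')" using inj s t by blast
      moreover have "leg s = leg t" using st(4) False by simp
      ultimately have "co s = co t" using s(1,4) t(1,4) by auto
      then show ?thesis by (rule co_inj)
    qed
    show "(rk s = rk t + 1 \<or> rk t = rk s + 1) \<and> (leg s = leg t \<or> rk s = 0 \<or> rk t = 0)"
      if st: "s \<in> white Q" "t \<in> white Q" "side_adjacent s t" for s t
    proof -
      obtain x y where xy: "co s = (x, y)" by force
      obtain x' y' where xy': "co t = (x', y')" by force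
      have d: "\<bar>x - x'\<bar> + \<bar>y - y'\<bar> = 1"
        using st(3) xy xy' by (auto simp: co_def side_adjacent_def split: prod.splits)
      have one: "rk u = 1" if u: "u \<in> white Q" "co u = (v, w)" "\<bar>v\<bar> + \<bar>w\<bar> = 1" for u v w
      proof -
        obtain a b where ab: "rk u = nat (\<rho> (a, b))" "(a, b) \<in> T" "\<bar>a\<bar> + \<bar>b\<bar> = 1"
          using cell[OF u(1)] u(2,3) by auto
        then have "a = 0" "b = 1" using cone[OF ab(2)] by linarith+
        then show ?thesis using ab first by simp
      qed
      consider "co s = (0, 0)" "rk s = 0" | "co t = (0, 0)" "rk t = 0" | "co s \<noteq> (0, 0)" "co t \<noteq> (0, 0)"
        using rk_def by metis
      then show ?thesis
      proof cases
        case 1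
        then have "rk t = 1" using one[OF st(2) xy'] d xy by simp
        then show ?thesis using 1 by simp
      next
        case 2
        then have "rk s = 1" using one[OF st(1) xy] d xy' by simp
        then show ?thesis using 2 by simp
      next
        case 3
        obtain a b where s: "rk s = nat (\<rho> (a, b))" "(a, b) \<in> T"
          "?cone (leg s) x y a b"
          using cell[OF st(1)] 3(1) xy by auto
        obtain a' b' where t: "rk t = nat (\<rho> (a', b'))" "(a', b') \<in> T"
          "?cone (leg t) x' y' a' b'"
          using cell[OF st(2)] 3(2) xy' by auto
        have same: "leg s = leg t \<and> \<bar>a - a'\<bar> + \<bar>b - b'\<bar> = 1"
        proof
          have d': "y = y' \<and> x' = x + 1 \<or> y = y' \<and> x = x' + 1 \<or> x = x' \<and> y' = y + 1 \<or> x = x' \<and> y = y' + 1"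
            using d by linarith
          show legs: "leg s = leg t"
            using s(3)[unfolded abs_less_iff] t(3)[unfolded abs_less_iff] d' by (elim disjE conjE; linarith)
          show "\<bar>a - a'\<bar> + \<bar>b - b'\<bar> = 1"
            using s(3) t(3) d legs by (elim disjE conjE) simp_all
        qed
        then have "\<rho> (a, b) = \<rho> (a', b') + 1 \<or> \<rho> (a', b') = \<rho> (a, b) + 1" using adj s t by blast
        then have "rk s = rk t + 1 \<or> rk t = rk s + 1"
          using s(1) t(1) range[OF s(2)] range[OF t(2)] by linarith
        then show ?thesis using same by blast
      qed
    qed
    show "rk (i, j) = h \<and> 2 * j + 1 = width Q" if "(i, j) \<in> white Q" "i = 0 \<or> i + 1 = width Q" for i j
    proof -
      have "\<bar>int i - int c\<bar> = int c" using that(2) Q(1) by auto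
      then show ?thesis using border[OF that(1), of "int i - int c" "int j - int c"] Q(1) by (auto simp: co_def)
    qed
    show "rk (i, j) = h \<and> 2 * i + 1 = width Q" if "(i, j) \<in> white Q" "j = 0 \<or> j + 1 = width Q" for i j
    proof -
      have "\<bar>int j - int c\<bar> = int c" using that(2) Q(1) by auto
      then show ?thesis using border[OF that(1), of "int i - int c" "int j - int c"] Q(1) by (auto simp: co_def)
    qed
  qed
  then show ?thesis by blast
qed

lemma spider_cross:
  assumes "1 \<le> k"
  shows "\<exists>leg rk. spider (cross k) k leg rk"
proof (rule spider_if_four_arms[where c = k and T = "{(0, y) |y. 1 \<le> y \<and> y \<le> int k}" and \<rho> = snd])
  fix i j assume ij: "(i, j) \<in> white (cross k)"
  then have ij: "i \<le> 2 * k" "j \<le> 2 * k" "i = k \<or> j = k" by (auto simp: cross_def)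
  let ?T = "{(0, y) |y. 1 \<le> y \<and> y \<le> int k}"
  have arms: "(0, y) \<in> four_arms ?T" "(- y, 0) \<in> four_arms ?T" "(0, - y) \<in> four_arms ?T" "(y, 0) \<in> four_arms ?T"
    if "0 \<le> y" "y \<le> int k" for y
  proof -
    have "y = 0 \<or> (0, y) \<in> ?T" using that by auto
    then show "(0, y) \<in> four_arms ?T" "(- y, 0) \<in> four_arms ?T" "(0, - y) \<in> four_arms ?T" "(y, 0) \<in> four_arms ?T"
      using four_arms_centre[of ?T] four_arms_rotations[of 0 y ?T] by auto
  qed
  show "(int i - int k, int j - int k) \<in> four_arms ?T"
    using ij arms[of "int i - int k"] arms[of "int k - int i"] arms[of "int j - int k"] arms[of "int k - int j"]
    by (cases "i \<le> k"; cases "j \<le> k") auto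
qed (use assms in \<open>auto simp: cross_def\<close>)

definition turn_sign :: "int \<Rightarrow> int" where
  "turn_sign j = (if odd j then 1 else - 1)"

lemma turn_sign_cases: "turn_sign j = 1 \<or> turn_sign j = - 1"
  by (simp add: turn_sign_def)

lemma turn_sign_Suc: "turn_sign (j + 1) = - turn_sign j"
  by (simp add: turn_sign_def)

lemma snake_turn_eq: "snake_turn j = (if j = 0 then 0 else turn_sign (int j) * (2 * int j - 1))"
  by (simp add: snake_turn_def turn_sign_def)

text \<open>The position of a square along the snake. Row \<open>2 * j\<close> is traversed in the direction \<open>turn_sign j\<close> from
  \<open>turn_sign j * x = 3 - 2 * j\<close> (from 0 if \<open>j = 1\<close>) to \<open>2 * j - 1\<close>, and row \<open>2 * j + 1\<close> consists of a
  single square. The squares before row \<open>2 * j\<close> number \<open>2 * (j - 1) * (j - 1) + 2\<close> if \<open>j \<ge> 2\<close>.\<close>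
definition arm_rank :: "nat \<Rightarrow> int \<times> int \<Rightarrow> int" where
  "arm_rank k = (\<lambda>(x, y). let j = y div 2 in
     if y = 1 then 1
     else if y = 2 * int k + 3 then 2 * (int k * int k) + 2 * int k + 3
     else if even y then 2 * (j * j) - 2 * j + 2 + turn_sign j * x
     else 2 * (j * j) + 2)"

text \<open>The graph of \<open>arm_rank\<close> on the top arm as a case distinction: first square, even row, odd row,
  exit. The last even row, \<open>j = k + 1\<close>, stops at \<open>x = 0\<close> below the exit.\<close>
definition arm_cell :: "int \<Rightarrow> int \<Rightarrow> int \<Rightarrow> int \<Rightarrow> bool" where
  "arm_cell k x y r \<longleftrightarrow> (x = 0 \<and> y = 1 \<and> r = 1) \<or>
    (\<exists>j. 1 \<le> j \<and> j \<le> k + 1 \<and> y = 2 * j \<and> (if j = 1 then 0 else 3 - 2 * j) \<le> turn_sign j * x \<and> turn_sign j * x \<le> 2 * j - 1 \<and>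
      (j = k + 1 \<longrightarrow> turn_sign j * x \<le> 0) \<and> r = 2 * (j * j) - 2 * j + 2 + turn_sign j * x) \<or>
    (\<exists>j. 1 \<le> j \<and> j \<le> k \<and> y = 2 * j + 1 \<and> turn_sign j * x = 2 * j - 1 \<and> r = 2 * (j * j) + 2) \<or>
    (x = 0 \<and> y = 2 * k + 3 \<and> r = 2 * (k * k) + 2 * k + 3)"

lemma arm_cell_cases:
  assumes "arm_cell k x y r"
  obtains "x = 0" "y = 1" "r = 1"
  | j where "1 \<le> j" "j \<le> k + 1" "y = 2 * j" "(if j = 1 then 0 else 3 - 2 * j) \<le> turn_sign j * x" "turn_sign j * x \<le> 2 * j - 1"
      "j = k + 1 \<Longrightarrow> turn_sign j * x \<le> 0" "r = 2 * (j * j) - 2 * j + 2 + turn_sign j * x"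
  | j where "1 \<le> j" "j \<le> k" "y = 2 * j + 1" "turn_sign j * x = 2 * j - 1" "r = 2 * (j * j) + 2"
  | "x = 0" "y = 2 * k + 3" "r = 2 * (k * k) + 2 * k + 3"
  using assms unfolding arm_cell_def by blast

lemma arm_cell_row:
  assumes "1 \<le> k" "1 \<le> j" "j \<le> k + 1" "y = 2 * int j" "(if j = 1 then 0 else 3 - 2 * int j) \<le> turn_sign (int j) * x"
      "turn_sign (int j) * x \<le> 2 * int j - 1" "j = k + 1 \<Longrightarrow> turn_sign (int j) * x \<le> 0"
  shows "arm_cell (int k) x y (arm_rank k (x, y))"
proof -
  have "arm_rank k (x, y) = 2 * (int j * int j) - 2 * int j + 2 + turn_sign (int j) * x"
    using assms(4) by (simp add: arm_rank_def Let_def) presburger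
  moreover have "int j = int k + 1 \<longrightarrow> turn_sign (int j) * x \<le> 0"
  proof
    assume "int j = int k + 1"
    then have "j = k + 1" by linarith
    then show "turn_sign (int j) * x \<le> 0" by (rule assms(7))
  qed
  ultimately show ?thesis
    unfolding arm_cell_def
    by (intro disjI2[OF disjI1] exI[of _ "int j"]) (use assms(1-6) in \<open>simp split: if_splits\<close>)
qed

lemma top_arm_cell:
  assumes k: "1 \<le> k" and "(x, y) \<in> top_arm k"
  shows "arm_cell (int k) x y (arm_rank k (x, y))"
proof -
  consider "(x, y) = (0, 1)" | "(x, y) = (0, 2)"
    | j where "1 \<le> j" "j \<le> k" "(x, y) \<in> row_segment (snake_turn (j - 1)) (snake_turn j) (2 * int j)"
    | j where "1 \<le> j" "j \<le> k" "(x, y) = (snake_turn j, 2 * int j + 1)"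
    | j where "1 \<le> j" "j \<le> k" "(x, y) = (snake_turn j, 2 * int j + 2)"
    | "(x, y) \<in> row_segment 0 (snake_turn k) (2 * int k + 2)" | "(x, y) = (0, 2 * int k + 3)"
    using assms(2) unfolding top_arm_def Un_iff UN_iff insert_iff empty_iff
    by (elim disjE bexE) (simp_all, blast+)
  then show ?thesis
  proof cases
    case 1
    then show ?thesis by (simp add: arm_cell_def arm_rank_def)
  next
    case 2
    then show ?thesis using k by (intro arm_cell_row[of k 1]) auto
  next
    case (3 j)
    have xy: "y = 2 * int j" "min (snake_turn (j - 1)) (snake_turn j) \<le> x" "x \<le> max (snake_turn (j - 1)) (snake_turn j)"
      using 3(3) by (auto simp: row_segment_def)
    have st: "snake_turn (j - 1) = (if j = 1 then 0 else - turn_sign (int j) * (2 * int j - 3))"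
    proof (cases "j = 1")
      case False
      then have "int j = int (j - 1) + 1" using 3 by linarith
      then show ?thesis using False 3 turn_sign_Suc[of "int (j - 1)"] by (auto simp: snake_turn_eq)
    qed (simp add: snake_turn_eq)
    have st': "snake_turn j = turn_sign (int j) * (2 * int j - 1)" using 3 by (simp add: snake_turn_eq)
    have b: "(if j = 1 then 0 else 3 - 2 * int j) \<le> turn_sign (int j) * x \<and> turn_sign (int j) * x \<le> 2 * int j - 1"
      using xy(2,3) st st' turn_sign_cases[of "int j"] 3(1) by (auto split: if_splits)
    show ?thesis
      by (rule arm_cell_row[of k j]) (use k 3 xy b in \<open>auto split: if_splits\<close>)
  next
    case (4 j)
    then have "turn_sign (int j) * x = 2 * int j - 1" using turn_sign_cases[of "int j"] by (auto simp: snake_turn_eq)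
    moreover have "arm_rank k (x, y) = 2 * (int j * int j) + 2"
      using 4 by (auto simp: arm_rank_def Let_def)
    ultimately show ?thesis unfolding arm_cell_def
      by (intro disjI2[OF disjI2[OF disjI1]] exI[of _ "int j"]) (use 4 in auto)
  next
    case (5 j)
    have "turn_sign (int (Suc j)) * x = 1 - 2 * int j"
      using 5 turn_sign_cases[of "int j"] turn_sign_Suc[of "int j"] by (auto simp: snake_turn_eq add.commute)
    then show ?thesis using k 5 by (intro arm_cell_row[of k "Suc j"]) auto
  next
    case 6
    have xy: "y = 2 * int k + 2" "min 0 (snake_turn k) \<le> x" "x \<le> max 0 (snake_turn k)"
      using 6 by (auto simp: row_segment_def)
    have u: "1 - 2 * int k \<le> turn_sign (int (k + 1)) * x" "turn_sign (int (k + 1)) * x \<le> 0"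
      using xy(2,3) k turn_sign_cases[of "int k"] turn_sign_Suc[of "int k"] by (auto simp: snake_turn_eq add.commute)
    show ?thesis
      using k
    proof (rule arm_cell_row)
      show "(if k + 1 = 1 then 0 else 3 - 2 * int (k + 1)) \<le> turn_sign (int (k + 1)) * x"
        using u(1) k by (simp add: add.commute)
      show "turn_sign (int (k + 1)) * x \<le> 2 * int (k + 1) - 1"
        by (rule order_trans[OF u(2)]) simp
      show "turn_sign (int (k + 1)) * x \<le> 0" by (rule u(2))
    qed (use xy in auto)
  next
    case 7
    then show ?thesis by (simp add: arm_cell_def arm_rank_def)
  qed
qed

lemma square_mono: "0 \<le> a \<Longrightarrow> a \<le> b \<Longrightarrow> a * a \<le> b * (b::int)"
  by (simp add: mult_mono)

lemma arm_cell_bounds: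
  assumes k: "1 \<le> k" and a: "arm_cell k x y r"
  shows "\<bar>x\<bar> < y" "y \<le> 2 * k + 3" "y = 2 * k + 3 \<Longrightarrow> x = 0 \<and> r = 2 * (k * k) + 2 * k + 3"
    "1 \<le> r" "r \<le> 2 * (k * k) + 2 * k + 3"
proof -
  have "\<bar>x\<bar> < y \<and> y \<le> 2 * k + 3 \<and> (y = 2 * k + 3 \<longrightarrow> x = 0 \<and> r = 2 * (k * k) + 2 * k + 3) \<and>
     1 \<le> r \<and> r \<le> 2 * (k * k) + 2 * k + 3"
    using a
  proof (cases rule: arm_cell_cases)
    case 1
    then show ?thesis using k by (simp add: add_increasing)
  next
    case (2 j)
    have sq: "0 \<le> (j - 1) * (j - 1)" by simp
    have exp: "(j - 1) * (j - 1) = j * j - 2 * j + 1" by (simp add: algebra_simps)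
    have "\<bar>x\<bar> < y" using 2(1,3-5) turn_sign_cases[of j] by (auto split: if_splits)
    moreover have "1 \<le> r" using 2(4,7) sq exp by (cases "j = 1") auto
    moreover have "r \<le> 2 * (k * k) + 2 * k + 3"
    proof (cases "j = k + 1")
      case True
      have "j * j = k * k + 2 * k + 1" by (simp add: True algebra_simps)
      then show ?thesis using 2(6,7) True by linarith
    next
      case False
      then have "j * j \<le> k * k" using 2 by (intro square_mono) auto
      then show ?thesis using 2 k by linarith
    qed
    moreover have "y \<noteq> 2 * k + 3" using 2 by presburger
    moreover have "y \<le> 2 * k + 3" using 2 by linarith
    ultimately show ?thesis by simp
  next
    case (3 j)
    have "j * j \<le> k * k" "0 \<le> j * j" using 3 by (auto intro: square_mono)
    moreover have "\<bar>x\<bar> < y" using 3 turn_sign_cases[of j] by auto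
    ultimately show ?thesis using 3 k by auto
  next
    case 4
    have "0 \<le> k * k" by simp
    then show ?thesis using 4 k by auto
  qed
  then show "\<bar>x\<bar> < y" "y \<le> 2 * k + 3" "y = 2 * k + 3 \<Longrightarrow> x = 0 \<and> r = 2 * (k * k) + 2 * k + 3"
    "1 \<le> r" "r \<le> 2 * (k * k) + 2 * k + 3" by auto
qed

text \<open>The snake climbs row by row, so the numbers in a higher row exceed those in a lower one; this is the
  inequality \<open>j * j \<le> (i - 1) * (i - 1)\<close> for \<open>j < i\<close> in each case.\<close>
lemma arm_cell_row_mono:
  assumes k: "1 \<le> k" and a: "arm_cell k x y r" and a': "arm_cell k x' y' r'" and less: "y < y'"
  shows "r < r'"
proof -
  have sq: "a * a \<le> b * b - 2 * b + 1" if "0 \<le> a" "a < b" for a b :: int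
  proof -
    have "a * a \<le> (b - 1) * (b - 1)" using that by (intro square_mono) auto
    also have "\<dots> = b * b - 2 * b + 1" by (simp add: algebra_simps)
    finally show ?thesis .
  qed
  show ?thesis
    using a
  proof (cases rule: arm_cell_cases)
    case a: 1
    from a' show ?thesis
    proof (cases rule: arm_cell_cases)
      case 1 then show ?thesis using a less by simp
    next
      case (2 j)
      show ?thesis
      proof (cases "j = 1")
        case True
        then show ?thesis using a 2 by simp
      next
        case False
        then have "1 * 1 \<le> j * j - 2 * j + 1" using 2(1) by (intro sq) auto
        moreover have "3 - 2 * j \<le> turn_sign j * x'" using 2(4) False by simp
        ultimately show ?thesis using a(3) 2(7) by linarith
      qed
    next
      case (3 j) then show ?thesis using a sq[of 0 j] by auto
    next
      case 4 then show ?thesis using a k by (auto simp: add_nonneg_pos)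
    qed
  next
    case a: (2 j)
    from a' show ?thesis
    proof (cases rule: arm_cell_cases)
      case 1 then show ?thesis using a less by simp
    next
      case (2 i)
      then have "j < i" using a less by simp
      then have "j * j \<le> i * i - 2 * i + 1" "i \<noteq> 1" using sq[of j i] a by auto
      then show ?thesis using 2(4,7) a(5,7) by (simp split: if_splits)
    next
      case (3 i)
      then have "j \<le> i" using a less by simp
      then have "j * j \<le> i * i" using a by (intro square_mono) auto
      then show ?thesis using 3 a by linarith
    next
      case 4
      show ?thesis
      proof (cases "j = k + 1")
        case True
        have "j * j = k * k + 2 * k + 1" by (simp add: True algebra_simps)
        then show ?thesis using a(6,7) True 4 by linarith
      next
        case False
        then have "j * j \<le> k * k" using a by (intro square_mono) auto
        then show ?thesis using a 4 k by linarith
      qed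
    qed
  next
    case a: (3 j)
    from a' show ?thesis
    proof (cases rule: arm_cell_cases)
      case 1 then show ?thesis using a less by simp
    next
      case (2 i)
      then have "j < i" using a less by simp
      then have "j * j \<le> i * i - 2 * i + 1" using sq[of j i] a by auto
      then show ?thesis using 2(1,4,7) a(1,5) \<open>j < i\<close> by (simp split: if_splits)
    next
      case (3 i)
      then have "j < i" using a less by simp
      then have "j * j \<le> i * i - 2 * i + 1" using sq[of j i] a by auto
      then show ?thesis using 3(5) a(1,5) \<open>j < i\<close> by linarith
    next
      case 4
      have "j * j \<le> k * k" using a by (intro square_mono) auto
      then show ?thesis using a 4 k by linarith
    qed
  next
    case a: 4
    then show ?thesis using arm_cell_bounds(2)[OF k a'] less by simp
  qed
qed

text \<open>Within a row the snake keeps its direction, so the position is \<open>turn_sign j * x\<close> up to a constant.\<close>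
lemma arm_cell_same_row:
  assumes k: "1 \<le> k" and a: "arm_cell k x y r" and a': "arm_cell k x' y r'"
  shows "\<exists>j. r' - r = turn_sign j * (x' - x)"
  using a
proof (cases rule: arm_cell_cases)
  case 1
  have "x' = 0" using arm_cell_bounds(1)[OF k a'] 1 by simp
  moreover have "r' = 1" using a' 1 k unfolding arm_cell_def by auto
  ultimately show ?thesis using 1 by simp
next
  case a: (2 j)
  from a' show ?thesis
  proof (cases rule: arm_cell_cases)
    case 1 show ?thesis using 1(2) a(3) by presburger
  next
    case (2 i)
    then have "i = j" using a(3) by simp
    then show ?thesis using 2(7) a(7) by (intro exI[of _ j]) (simp add: right_diff_distrib)
  next
    case (3 i) show ?thesis using 3(3) a(3) by presburger
  next
    case 4 show ?thesis using 4(2) a(3) by presburger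
  qed
next
  case a: (3 j)
  from a' show ?thesis
  proof (cases rule: arm_cell_cases)
    case 1 then show ?thesis using a(1,3) by simp
  next
    case (2 i) show ?thesis using 2(3) a(3) by presburger
  next
    case (3 i)
    then have "i = j" using a(3) by simp
    then show ?thesis using 3(4,5) a(4,5) by (intro exI[of _ j]) (simp add: right_diff_distrib)
  next
    case 4 then show ?thesis using a(2,3) by simp
  qed
next
  case 4
  then show ?thesis using arm_cell_bounds(3)[OF k a'] by simp
qed

lemma arm_cell_inj:
  assumes k: "1 \<le> k" and a: "arm_cell k x y r" and a': "arm_cell k x' y' r"
  shows "x = x' \<and> y = y'"
proof -
  have y: "y = y'"
    using arm_cell_row_mono[OF k a a'] arm_cell_row_mono[OF k a' a] by (cases y y' rule: linorder_cases) auto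
  obtain j where "turn_sign j * (x' - x) = 0" using arm_cell_same_row[OF k a] a' y by force
  then show ?thesis using y turn_sign_cases[of j] by auto
qed

lemma arm_cell_next_row:
  assumes k: "1 \<le> k" and a: "arm_cell k x y r" and a': "arm_cell k x (y + 1) r'"
  shows "r' = r + 1"
  using a
proof (cases rule: arm_cell_cases)
  case a: 1
  from a' show ?thesis
  proof (cases rule: arm_cell_cases)
    case 1 then show ?thesis using a by simp
  next
    case (2 j)
    then have "j = 1" using a by simp
    then show ?thesis using 2 a by simp
  next
    case (3 j) then show ?thesis using a(2) by presburger
  next
    case 4 then show ?thesis using a k by simp
  qed
next
  case a: (2 j)
  from a' show ?thesis
  proof (cases rule: arm_cell_cases)
    case 1 then show ?thesis using a(1,3) by simp
  next
    case (2 i) show ?thesis using 2(3) a(3) by presburger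
  next
    case (3 i)
    then have "i = j" using a by simp
    then show ?thesis using 3(4,5) a(7) by simp
  next
    case 4
    then have j: "j = k + 1" using a by simp
    have "j * j = k * k + 2 * k + 1" by (simp add: j algebra_simps)
    then show ?thesis using 4 a j by simp
  qed
next
  case a: (3 j)
  from a' show ?thesis
  proof (cases rule: arm_cell_cases)
    case 1 then show ?thesis using a(1,3) by simp
  next
    case (2 i)
    then have i: "i = j + 1" using a by simp
    have "turn_sign i * x = 1 - 2 * j" using a(4) by (simp add: i turn_sign_Suc)
    moreover have "i * i = j * j + 2 * j + 1" by (simp add: i algebra_simps)
    ultimately show ?thesis using 2(7) a(5) i by simp
  next
    case (3 i) show ?thesis using 3(3) a(3) by presburger
  next
    case 4 show ?thesis using 4(2) a(3) by presburger
  qed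
next
  case 4
  then show ?thesis using arm_cell_bounds(2)[OF k a'] by simp
qed

lemma spider_snake_cross:
  assumes k: "1 \<le> k"
  shows "\<exists>leg rk. spider (snake_cross k) (2 * k\<^sup>2 + 2 * k + 3) leg rk"
proof -
  have cell: "arm_cell (int k) x y (arm_rank k (x, y))" if "(x, y) \<in> top_arm k" for x y
    by (rule top_arm_cell[OF k that])
  have ik: "1 \<le> int k" using k by simp
  have h: "int (2 * k\<^sup>2 + 2 * k + 3) = 2 * (int k * int k) + 2 * int k + 3"
    by (simp add: power2_eq_square)
  note b = arm_cell_bounds[OF ik cell]
  have cone: "\<bar>x\<bar> < y \<and> y \<le> int (2 * k + 3)" if "(x, y) \<in> top_arm k" for x y
    using b[OF that] by simp
  show ?thesis
  proof (rule spider_if_four_arms[where c = "2 * k + 3" and T = "top_arm k" and \<rho> = "arm_rank k"])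
    show "width (snake_cross k) = 2 * (2 * k + 3) + 1" by (simp add: snake_cross_def)
    show "(int i - int (2 * k + 3), int j - int (2 * k + 3)) \<in> four_arms (top_arm k)"
      if ij: "(i, j) \<in> white (snake_cross k)" for i j
    proof -
      obtain p where p: "p \<in> four_arms (top_arm k)"
        "(i, j) = (\<lambda>(x, y). (nat (2 * int k + 3 + x), nat (2 * int k + 3 + y))) p"
        using ij unfolding snake_cross_def four_arms_def snd_conv by (rule imageE)
      obtain x y where "p = (x, y)" by force
      then have xy: "(x, y) \<in> four_arms (top_arm k)"
        "i = nat (2 * int k + 3 + x)" "j = nat (2 * int k + 3 + y)"
        using p by auto
      have "\<bar>x\<bar> \<le> 2 * int k + 3 \<and> \<bar>y\<bar> \<le> 2 * int k + 3"
        using xy(1) cone by (auto simp: four_arms_eq) (smt (verit) of_nat_add of_nat_mult of_nat_numeral)+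
      then show ?thesis using xy by (simp add: abs_le_iff)
    qed
    fix x y assume xy: "(x, y) \<in> top_arm k"
    show "\<bar>x\<bar> < y \<and> y \<le> int (2 * k + 3)" by (rule cone[OF xy])
  next
    fix s assume "s \<in> top_arm k"
    then show "1 \<le> arm_rank k s \<and> arm_rank k s \<le> int (2 * k\<^sup>2 + 2 * k + 3)"
      using b[of "fst s" "snd s"] unfolding h by simp
  next
    fix s t assume "s \<in> top_arm k" "t \<in> top_arm k" "arm_rank k s = arm_rank k t"
    then show "s = t"
      using arm_cell_inj[OF ik cell[of "fst s" "snd s"], of "fst t" "snd t"] cell[of "fst t" "snd t"]
      by (auto simp: prod_eq_iff)
  next
    fix x y x' y' assume xy: "(x, y) \<in> top_arm k" "(x', y') \<in> top_arm k" and d: "\<bar>x - x'\<bar> + \<bar>y - y'\<bar> = 1"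
    have "(y = y' \<and> (x' = x + 1 \<or> x = x' + 1)) \<or> (x = x' \<and> (y' = y + 1 \<or> y = y' + 1))"
      using d by linarith
    then consider "y = y'" "x' - x = 1 \<or> x' - x = - 1" | "x = x'" "y' = y + 1" | "x = x'" "y = y' + 1"
      by linarith
    then show "arm_rank k (x, y) = arm_rank k (x', y') + 1 \<or> arm_rank k (x', y') = arm_rank k (x, y) + 1"
    proof cases
      case 1
      obtain j where "arm_rank k (x', y') - arm_rank k (x, y) = turn_sign j * (x' - x)"
        using arm_cell_same_row[OF ik cell[OF xy(1)]] cell[OF xy(2)] 1(1) by metis
      then show ?thesis using 1(2) turn_sign_cases[of j] by auto
    next
      case 2
      then show ?thesis using arm_cell_next_row[OF ik cell[OF xy(1)]] cell[OF xy(2)] by simp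
    next
      case 3
      then show ?thesis using arm_cell_next_row[OF ik cell[OF xy(2)]] cell[OF xy(1)] by simp
    qed
  next
    show "arm_rank k (0, 1) = 1" by (simp add: arm_rank_def)
  next
    fix x assume x: "(x, int (2 * k + 3)) \<in> top_arm k"
    show "x = 0 \<and> arm_rank k (x, int (2 * k + 3)) = int (2 * k\<^sup>2 + 2 * k + 3)"
      using b(3)[OF x] unfolding h by auto
  qed auto
qed

section \<open>Limit sets as towers of spiders\<close>

lemma spider_base_pattern:
  "\<exists>leg rk. spider (base_pattern k) ((exit_path_length k - 1) div 2) leg rk"
proof (cases "k = 0")
  case True
  then show ?thesis using spider_cross[of 1] by (simp add: base_pattern_def exit_path_length_def)
next
  case False
  have "(exit_path_length k - 1) div 2 = 2 * k\<^sup>2 + 2 * k + 3"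
    using False by (simp add: exit_path_length_def)
  then show ?thesis using spider_snake_cross[of k] False by (simp add: base_pattern_def)
qed

lemma exit_path_length_odd: "2 * ((exit_path_length k - 1) div 2) + 1 = exit_path_length k"
  by (simp add: exit_path_length_def)

text \<open>The union of the white squares; a limit set is the intersection of the regions of its levels.\<close>
definition region :: "pattern \<Rightarrow> (real \<times> real) set" where
  "region P = (\<Union>s\<in>white P. square (fst s) (snd s) (width P))"

definition well_formed :: "pattern \<Rightarrow> bool" where
  "well_formed P \<longleftrightarrow> 0 < width P \<and> white P \<subseteq> {..<width P} \<times> {..<width P}"

lemma limit_set_region: "limit_set B = (\<Inter>n. region (level B n))"
  by (simp add: limit_set_def region_def case_prod_unfold)

lemma width_subst [simp]: "width (subst_pattern A B) = width A * width B"
  by (simp add: subst_pattern_def)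

lemma white_subst:
  "white (subst_pattern A B) =
    (\<lambda>(s, t). (fst s * width B + fst t, snd s * width B + snd t)) ` (white A \<times> white B)"
  by (force simp: subst_pattern_def)

lemma white_subst_UN:
  "white (subst_pattern A B) =
    (\<Union>s\<in>white A. (\<lambda>t. (fst s * width B + fst t, snd s * width B + snd t)) ` white B)"
  by (force simp: subst_pattern_def)

lemma subst_pattern_assoc:
  "subst_pattern (subst_pattern A B) D = subst_pattern A (subst_pattern B D)"
proof (rule prod_eqI)
  show "white (subst_pattern (subst_pattern A B) D) = white (subst_pattern A (subst_pattern B D))"
    by (simp add: white_subst_UN image_UN image_image algebra_simps) blast
qed (simp add: mult.assoc)

text \<open>A level is defined by refining the previous one from below; reading it from above, as the first pattern
  with the later ones substituted into it, exhibits the self-similar structure.\<close>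
lemma level_Suc_shift:
  "level B (Suc n) = subst_pattern (B 0) (level (\<lambda>i. B (Suc i)) n)"
  by (induction n) (simp_all add: subst_pattern_assoc)

lemma region_subst:
  assumes "0 < width A" "0 < width B"
  shows "region (subst_pattern A B) = (\<Union>s\<in>white A. cell_map (width A) s ` region B)"
proof -
  have "square (fst s * width B + fst t) (snd s * width B + snd t) (width A * width B) =
      cell_map (width A) s ` square (fst t) (snd t) (width B)" for s t
    using rescale_square[OF assms, of "fst s" "snd s" "fst t" "snd t"] by (simp add: cell_map_def)
  then have "region (subst_pattern A B) =
      (\<Union>(s, t)\<in>white A \<times> white B. cell_map (width A) s ` square (fst t) (snd t) (width B))"
    by (simp add: region_def white_subst case_prod_unfold)
  then show ?thesis by (auto simp: region_def image_UN)
qed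

lemma well_formed_subst:
  assumes "well_formed A" "well_formed B"
  shows "well_formed (subst_pattern A B)"
proof -
  have less: "a * width B + b < width A * width B" if "a < width A" "b < width B" for a b
  proof -
    have "a * width B + b < Suc a * width B" using that by simp
    also have "\<dots> \<le> width A * width B" using that by (intro mult_le_mono1) simp
    finally show ?thesis .
  qed
  have "i < width P \<and> j < width P" if "(i, j) \<in> white P" "well_formed P" for i j P
    using that by (auto simp: well_formed_def)
  then show ?thesis using assms less by (auto simp: well_formed_def white_subst)
qed

lemma well_formed_level: "(\<And>n. well_formed (B n)) \<Longrightarrow> well_formed (level B n)"
  by (induction n) (simp_all add: well_formed_subst)

lemma region_unit:
  assumes "well_formed P" "z \<in> region P"
  shows "0 \<le> fst z \<and> fst z \<le> 1 \<and> 0 \<le> snd z \<and> snd z \<le> 1"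
proof -
  obtain i j where ij: "(i, j) \<in> white P" "z \<in> square i j (width P)" using assms(2) by (auto simp: region_def)
  then have lt: "i < width P" "j < width P" using assms(1) by (auto simp: well_formed_def)
  then have le: "real i + 1 \<le> real (width P)" "real j + 1 \<le> real (width P)" "0 < real (width P)" by linarith+
  have "(real i + 1) / real (width P) \<le> 1" "(real j + 1) / real (width P) \<le> 1"
    using le by simp_all
  moreover have "0 \<le> real i / real (width P)" "0 \<le> real j / real (width P)" by simp_all
  moreover have "real i / real (width P) \<le> fst z" "fst z \<le> (real i + 1) / real (width P)"
    "real j / real (width P) \<le> snd z" "snd z \<le> (real j + 1) / real (width P)"
    using ij(2) by (auto simp: square_def)
  ultimately show ?thesis by linarith
qed

lemma region_subst_subset:
  assumes A: "well_formed A" and B: "well_formed B"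
  shows "region (subst_pattern A B) \<subseteq> region A"
proof -
  have "0 < width A" "0 < width B" using A B by (auto simp: well_formed_def)
  moreover have "cell_map (width A) s ` region B \<subseteq> square (fst s) (snd s) (width A)" for s
  proof -
    have "region B \<subseteq> square 0 0 1" using region_unit[OF B] by (force simp: square_def)
    then have "cell_map (width A) s ` region B \<subseteq> cell_map (width A) s ` square 0 0 1" by blast
    also have "\<dots> = square (fst s) (snd s) (width A)"
      using rescale_square[OF \<open>0 < width A\<close>, of 1 "fst s" "snd s" 0 0] by (simp add: cell_map_def)
    finally show ?thesis .
  qed
  ultimately have "region (subst_pattern A B) \<subseteq> (\<Union>s\<in>white A. square (fst s) (snd s) (width A))"
    by (simp only: region_subst) blast
  then show ?thesis by (simp only: region_def[of A])
qed

lemma region_level_antimono: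
  assumes "\<And>n. well_formed (B n)" "m \<le> n"
  shows "region (level B n) \<subseteq> region (level B m)"
  using assms(2)
proof (induction n rule: dec_induct)
  case (step n)
  then show ?case using region_subst_subset[OF well_formed_level[of B n, OF assms(1)] assms(1)[of "Suc n"]] by auto
qed simp

lemma compact_region:
  assumes "well_formed P"
  shows "compact (region P)"
proof -
  have "finite (white P)" using assms finite_subset unfolding well_formed_def by blast
  then show ?thesis unfolding region_def
    by (intro compact_UN) (auto simp: square_def intro: compact_Times)
qed

lemma compact_limit_set:
  assumes "\<And>n. well_formed (B n)"
  shows "compact (limit_set B)"
proof -
  have "limit_set B = region (level B 0) \<inter> (\<Inter>n. region (level B n))"
    unfolding limit_set_region by blast
  moreover have "closed (\<Inter>n. region (level B n))"
    by (intro closed_INT ballI compact_imp_closed compact_region well_formed_level assms)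
  ultimately show ?thesis
    using compact_region[OF well_formed_level[of B 0, OF assms]] by (metis compact_Int_closed)
qed

text \<open>On every level the point lies in one of finitely many squares of the first pattern. As the regions
  decrease, one of these squares works for all levels.\<close>
lemma limit_set_subset_pieces:
  assumes wf: "\<And>n. well_formed (B n)"
  shows "limit_set B \<subseteq> (\<Union>s\<in>white (B 0). cell_map (width (B 0)) s ` limit_set (\<lambda>i. B (Suc i)))"
proof
  fix z assume z: "z \<in> limit_set B"
  let ?w = "width (B 0)"
  let ?R = "\<lambda>n. region (level (\<lambda>i. B (Suc i)) n)"
  have wf': "well_formed (level (\<lambda>i. B (Suc i)) n)" for n by (rule well_formed_level) (rule wf)
  have w: "0 < ?w" using wf by (simp add: well_formed_def)
  have in_step: "\<exists>s\<in>white (B 0). z \<in> cell_map ?w s ` ?R n" for n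
  proof -
    have "z \<in> region (level B (Suc n))" using z by (auto simp: limit_set_region simp del: level.simps)
    then show ?thesis
      using wf'[of n] w unfolding level_Suc_shift by (subst (asm) region_subst) (auto simp: well_formed_def)
  qed
  have fin: "finite (white (B 0))" using wf[of 0] finite_subset unfolding well_formed_def by blast
  have "\<exists>s\<in>white (B 0). \<forall>n. z \<in> cell_map ?w s ` ?R n"
  proof (rule ccontr)
    assume "\<not> ?thesis"
    then obtain N where N: "\<And>s. s \<in> white (B 0) \<Longrightarrow> z \<notin> cell_map ?w s ` ?R (N s)" by metis
    obtain s where s: "s \<in> white (B 0)" "z \<in> cell_map ?w s ` ?R (Max (N ` white (B 0)))"
      using in_step by blast
    have "?R (Max (N ` white (B 0))) \<subseteq> ?R (N s)"
      by (rule region_level_antimono) (use wf fin s in auto)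
    then show False using N[OF s(1)] s(2) by blast
  qed
  then obtain s where s: "s \<in> white (B 0)" "\<And>n. z \<in> cell_map ?w s ` ?R n" by blast
  have "cell_inv ?w s z \<in> ?R n" for n
    using s(2)[of n] w by (auto simp: cell_inv_map)
  then have "cell_inv ?w s z \<in> limit_set (\<lambda>i. B (Suc i))" by (simp add: limit_set_region)
  then show "z \<in> (\<Union>s\<in>white (B 0). cell_map ?w s ` limit_set (\<lambda>i. B (Suc i)))"
    using s(1) cell_map_inv[OF w, of s z] by force
qed

lemma spider_well_formed: "spider Q h leg rk \<Longrightarrow> well_formed Q"
  using spider.width_ge[of Q h leg rk] spider.white_sub[of Q h leg rk]
  by (fastforce simp: well_formed_def)

text \<open>On each side of a pattern only the middle square can be white. The distance of a border point from the
  midpoint of its side is thus divided by the width when passing from a level to the one above, for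
  all levels, so it is 0.\<close>
lemma border_point_is_exit:
  fixes X :: "nat \<Rightarrow> (real \<times> real) set"
  assumes unit: "\<And>n z. z \<in> X n \<Longrightarrow> 0 \<le> fst z \<and> fst z \<le> 1 \<and> 0 \<le> snd z \<and> snd z \<le> 1"
    and sub: "\<And>n. X n \<subseteq> (\<Union>s\<in>white (C n). cell_map (width (C n)) s ` X (Suc n))"
    and w: "\<And>n. 3 \<le> width (C n)" and lt: "\<And>n s. s \<in> white (C n) \<Longrightarrow> fst s < width (C n) \<and> snd s < width (C n)"
    and b_fst: "\<And>n s. s \<in> white (C n) \<Longrightarrow> fst s = 0 \<or> fst s + 1 = width (C n) \<Longrightarrow> 2 * snd s + 1 = width (C n)"
    and b_snd: "\<And>n s. s \<in> white (C n) \<Longrightarrow> snd s = 0 \<or> snd s + 1 = width (C n) \<Longrightarrow> 2 * fst s + 1 = width (C n)"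
    and z: "z \<in> X n" "fst z \<in> {0, 1} \<or> snd z \<in> {0, 1}"
  shows "z \<in> exits"
proof -
  have key: "\<exists>s u. s \<in> white (C n) \<and> u \<in> X (Suc n) \<and>
      real (width (C n)) * fst z = real (fst s) + fst u \<and> real (width (C n)) * snd z = real (snd s) + snd u"
    if z: "z \<in> X n" for n z
  proof -
    obtain s u where "s \<in> white (C n)" "u \<in> X (Suc n)" "z = cell_map (width (C n)) s u"
      using z sub[of n] by blast
    then show ?thesis using w[of n] by (intro exI[of _ s] exI[of _ u]) (auto simp: fst_cell_map snd_cell_map)
  qed
  have edge: "(a = 0 \<or> a + 1 = m) \<and> v \<in> {0, 1}"
    if e: "real m * t = real a + v" "t \<in> {0, 1}" "a < m" "0 \<le> v" "v \<le> 1" for m a :: nat and t v :: real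
  proof -
    consider "real a + v = 0" | "real a + v = real m" using e(1,2) by auto
    then show ?thesis
    proof cases
      case 1
      then have "real a = 0" "v = 0" using e(4) by linarith+
      then show ?thesis by simp
    next
      case 2
      have "real a + 1 \<le> real m" using e(3) by linarith
      then have "real a + 1 = real m" "v = 1" using 2 e(5) by linarith+
      moreover from this have "a + 1 = m" by linarith
      ultimately show ?thesis by simp
    qed
  qed
  have shrink: "\<bar>t - 1/2\<bar> \<le> e / 3"
    if "real m * t = real a + v" "2 * a + 1 = m" "3 \<le> m" "\<bar>v - 1/2\<bar> \<le> e" for m a :: nat and t v e :: real
  proof -
    have "real m = 2 * real a + 1" using that(2) by linarith
    then have "real m * (t - 1/2) = v - 1/2" using that(1) by (simp add: algebra_simps)
    then have "real m * \<bar>t - 1/2\<bar> = \<bar>v - 1/2\<bar>" by (metis abs_mult abs_of_nat)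
    moreover have "3 * \<bar>t - 1/2\<bar> \<le> real m * \<bar>t - 1/2\<bar>" using that(3) by (intro mult_right_mono) auto
    ultimately have "3 * \<bar>t - 1/2\<bar> \<le> e" using that(4) by (metis order_trans)
    then show ?thesis by simp
  qed
  have small: "(fst z \<in> {0, 1} \<longrightarrow> \<bar>snd z - 1/2\<bar> \<le> 1 / 3 ^ k) \<and> (snd z \<in> {0, 1} \<longrightarrow> \<bar>fst z - 1/2\<bar> \<le> 1 / 3 ^ k)"
    if "z \<in> X n" for k n z
    using that
  proof (induction k arbitrary: n z)
    case 0
    then show ?case using unit[OF 0] by (auto simp: abs_le_iff)
  next
    case (Suc k)
    obtain s u where su: "s \<in> white (C n)" "u \<in> X (Suc n)"
      "real (width (C n)) * fst z = real (fst s) + fst u" "real (width (C n)) * snd z = real (snd s) + snd u"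
      using key[OF Suc.prems] by blast
    note u = unit[OF su(2)] and IH = Suc.IH[OF su(2)] and ltn = lt[OF su(1)]
    have "\<bar>snd z - 1/2\<bar> \<le> 1 / 3 ^ k / 3" if "fst z \<in> {0, 1}"
    proof -
      have "(fst s = 0 \<or> fst s + 1 = width (C n)) \<and> fst u \<in> {0, 1}"
        by (rule edge[OF su(3) that]) (use ltn u in auto)
      then show ?thesis using shrink[OF su(4) b_fst[OF su(1)] w] IH by blast
    qed
    moreover have "\<bar>fst z - 1/2\<bar> \<le> 1 / 3 ^ k / 3" if "snd z \<in> {0, 1}"
    proof -
      have "(snd s = 0 \<or> snd s + 1 = width (C n)) \<and> snd u \<in> {0, 1}"
        by (rule edge[OF su(4) that]) (use ltn u in auto)
      then show ?thesis using shrink[OF su(3) b_snd[OF su(1)] w] IH by blast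
    qed
    ultimately show ?case by (simp add: mult.commute)
  qed
  have zero: "t = 1/2" if "\<And>k. \<bar>t - 1/2\<bar> \<le> 1 / 3 ^ k" for t :: real
  proof (rule ccontr)
    assume "t \<noteq> 1/2"
    then obtain k where "(1/3::real) ^ k < \<bar>t - 1/2\<bar>" using real_arch_pow_inv[of "\<bar>t - 1/2\<bar>" "1/3"] by auto
    then show False using that[of k] by (simp add: power_one_over)
  qed
  have "(fst z \<in> {0, 1} \<longrightarrow> snd z = 1/2) \<and> (snd z \<in> {0, 1} \<longrightarrow> fst z = 1/2)"
    using zero[of "fst z"] zero[of "snd z"] small[OF z(1)] by blast
  then show ?thesis using z(2) by (cases z) (auto simp: exits_def)
qed

lemma spider_tower_limit_sets:
  assumes sp: "\<And>n. spider (C n) (h n) (leg n) (rk n)"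
  shows "spider_tower C h leg rk (\<lambda>n. limit_set (\<lambda>i. C (n + i)))"
proof -
  let ?X = "\<lambda>n. limit_set (\<lambda>i. C (n + i))"
  have wf: "well_formed (C n)" for n using spider_well_formed[OF sp] .
  have unit: "0 \<le> fst z \<and> fst z \<le> 1 \<and> 0 \<le> snd z \<and> snd z \<le> 1" if "z \<in> ?X n" for z n
  proof -
    have "z \<in> region (level (\<lambda>i. C (n + i)) 0)" using that unfolding limit_set_region by blast
    then show ?thesis using region_unit[OF wf, of z n] by simp
  qed
  have sub: "?X n \<subseteq> (\<Union>s\<in>white (C n). cell_map (width (C n)) s ` ?X (Suc n))" for n
    using limit_set_subset_pieces[of "\<lambda>i. C (n + i)"] wf by simp
  show ?thesis
  proof (rule spider_tower.intro)
    fix n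
    show "spider (C n) (h n) (leg n) (rk n)" by (rule sp)
    show "compact (?X n)" by (rule compact_limit_set) (rule wf)
    show "?X n \<subseteq> (\<Union>s\<in>white (C n). cell_map (width (C n)) s ` ?X (Suc n))" by (rule sub)
    fix z assume z: "z \<in> ?X n"
    show "0 \<le> fst z \<and> fst z \<le> 1 \<and> 0 \<le> snd z \<and> snd z \<le> 1" by (rule unit[OF z])
    show "z \<in> exits" if "fst z \<in> {0, 1} \<or> snd z \<in> {0, 1}"
    proof (rule border_point_is_exit[OF unit sub _ _ _ _ z that])
      fix m s assume s: "s \<in> white (C m)"
      show "fst s < width (C m) \<and> snd s < width (C m)"
        using spider.white_sub[OF sp, of "fst s" "snd s" m] s by simp
      show "2 * snd s + 1 = width (C m)" if "fst s = 0 \<or> fst s + 1 = width (C m)"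
        using spider.border_fst[OF sp, of "fst s" "snd s" m] s that by simp
      show "2 * fst s + 1 = width (C m)" if "snd s = 0 \<or> snd s + 1 = width (C m)"
        using spider.border_snd[OF sp, of "fst s" "snd s" m] s that by simp
    qed (use spider.width_ge[OF sp] in auto)
  qed
qed

lemma covering_number_le:
  assumes "finite F" "A \<subseteq> \<Union>F" "\<And>U. U \<in> F \<Longrightarrow> bounded U \<and> diameter U \<le> \<epsilon>"
  shows "covering_number A \<epsilon> \<le> card F"
  unfolding covering_number_def by (rule Least_le) (use assms in blast)

lemma covering_number_attained:
  assumes "finite F" "A \<subseteq> \<Union>F" "\<And>U. U \<in> F \<Longrightarrow> bounded U \<and> diameter U \<le> \<epsilon>"
  shows "\<exists>G. finite G \<and> card G = covering_number A \<epsilon> \<and> A \<subseteq> \<Union>G \<and>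
    (\<forall>U\<in>G. bounded U \<and> diameter U \<le> \<epsilon>)"
  unfolding covering_number_def by (rule LeastI_ex) (use assms in blast)

text \<open>A set of diameter at most one mesh width meets at most four columns and four rows of the grid.\<close>
lemma card_squares_met_le_cover:
  assumes M: "0 < M" and G: "finite G" "A \<subseteq> \<Union>G" "\<And>U. U \<in> G \<Longrightarrow> bounded U \<and> diameter U \<le> 1 / real M"
  shows "card (squares_met A M) \<le> 16 * card G"
proof -
  have one: "card (squares_met U M) \<le> 16" if U: "bounded U" "diameter U \<le> 1 / real M" for U
  proof (cases "U = {}")
    case True
    then show ?thesis by (simp add: squares_met_def)
  next
    case False
    then obtain p where p: "p \<in> U" by blast
    have near: "int i \<in> {\<lceil>real M * t - 2\<rceil> .. \<lceil>real M * t - 2\<rceil> + 3}"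
      if "real i / real M \<le> t'" "t' \<le> (real i + 1) / real M" "\<bar>t - t'\<bar> \<le> 1 / real M" for i :: nat and t t' :: real
    proof -
      have "real i \<le> real M * t'" "real M * t' \<le> real i + 1" using that(1,2) M by (simp_all add: field_simps)
      moreover have "\<bar>real M * t - real M * t'\<bar> \<le> 1"
      proof -
        have "\<bar>real M * t - real M * t'\<bar> = real M * \<bar>t - t'\<bar>"
          by (simp add: abs_mult flip: right_diff_distrib)
        also have "\<dots> \<le> real M * (1 / real M)" using that(3) by (rule mult_left_mono) simp
        finally show ?thesis using M by simp
      qed
      ultimately have "real M * t - 2 \<le> real i" "real i \<le> real M * t + 1" by linarith+
      then show ?thesis by (simp, linarith)
    qed
    let ?I = "\<lambda>t. {\<lceil>real M * t - 2\<rceil> .. \<lceil>real M * t - 2\<rceil> + 3}"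
    have "(\<lambda>(i, j). (int i, int j)) ` squares_met U M \<subseteq> ?I (fst p) \<times> ?I (snd p)"
    proof clarify
      fix i j assume "(i, j) \<in> squares_met U M"
      then obtain q where q: "q \<in> U" "q \<in> square i j M" by (auto simp: squares_met_def)
      have "dist p q \<le> 1 / real M" using diameter_bounded_bound[OF U(1) p q(1)] U(2) by linarith
      then have "\<bar>fst p - fst q\<bar> \<le> 1 / real M" "\<bar>snd p - snd q\<bar> \<le> 1 / real M"
        using dist_fst_le[of p q] dist_snd_le[of p q] by (simp_all add: dist_real_def)
      then show "int i \<in> ?I (fst p) \<and> int j \<in> ?I (snd p)"
        using q(2) near[of i "fst q" "fst p"] near[of j "snd q" "snd p"] by (auto simp: square_def)
    qed
    moreover have "inj_on (\<lambda>(i, j). (int i, int j)) (squares_met U M)" by (auto simp: inj_on_def)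
    ultimately have "card (squares_met U M) \<le> card (?I (fst p) \<times> ?I (snd p))"
      by (intro card_inj_on_le) auto
    then show ?thesis by (simp add: card_cartesian_product)
  qed
  have "squares_met A M \<subseteq> (\<Union>U\<in>G. squares_met U M)" using G(2) by (fastforce simp: squares_met_def)
  then have "card (squares_met A M) \<le> card (\<Union>U\<in>G. squares_met U M)"
    using G(1) finite_squares_met by (intro card_mono) auto
  also have "\<dots> \<le> (\<Sum>U\<in>G. card (squares_met U M))" by (rule card_UN_le[OF G(1)])
  also have "\<dots> \<le> (\<Sum>U\<in>G. 16)" using one G(3) by (intro sum_mono) blast
  finally show ?thesis by simp
qed

lemma arc_covering_bounds:
  fixes C :: "nat \<Rightarrow> pattern" and h :: "nat \<Rightarrow> nat"
  assumes sp: "\<And>n. \<exists>leg rk. spider (C n) (h n) leg rk"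
    and g: "arc g" "path_image g \<subseteq> limit_set C"
  defines "M \<equiv> \<lambda>n. \<Prod>i<n. width (C i)" and "L \<equiv> \<lambda>n. \<Prod>i<n. 2 * h i + 1"
  obtains c where "c > 0"
    "\<And>n \<epsilon>. 2 / real (M n) \<le> \<epsilon> \<Longrightarrow> covering_number (path_image g) \<epsilon> \<le> 2 * L n"
    "\<And>n \<epsilon>. 0 < \<epsilon> \<Longrightarrow> \<epsilon> \<le> 1 / real (M n) \<Longrightarrow> c * real (L n) \<le> real (covering_number (path_image g) \<epsilon>)"
proof -
  obtain leg rk where "\<And>n. spider (C n) (h n) (leg n) (rk n)" using sp by metis
  then interpret spider_tower C h leg rk "\<lambda>n. limit_set (\<lambda>i. C (n + i))"
    by (rule spider_tower_limit_sets)
  let ?A = "path_image g"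
  have A: "?A \<subseteq> limit_set (\<lambda>i. C (0 + i))" using g(2) by simp
  have scales: "M n = total_width 0 n" "L n = crossing_length 0 n" for n by (simp_all add: M_def L_def total_width_def crossing_length_def)
  have cover: "\<exists>F. finite F \<and> card F \<le> 2 * L n \<and> ?A \<subseteq> \<Union>F \<and> (\<forall>U\<in>F. bounded U \<and> diameter U \<le> 2 / real (M n))" for n
  proof -
    obtain F where F: "finite F" "card F \<le> (if pathstart g \<in> exits \<and> pathfinish g \<in> exits then 1 else 2) * crossing_length 0 n"
      "?A \<subseteq> \<Union>F" "\<forall>U\<in>F. bounded U \<and> diameter U \<le> 2 / real (total_width 0 n)"
      using irreducible_cover[OF irreducible_arc_image[OF g(1)] A] by blast
    have "card F \<le> 2 * crossing_length 0 n" using F(2) by (auto split: if_splits)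
    then show ?thesis using F unfolding scales by blast
  qed
  have "pathstart g \<noteq> pathfinish g" using arc_distinct_ends[OF g(1)] by metis
  then have "thick 0 ?A"
    using g(1) by (intro thick_connected[OF _ A, of "pathstart g" "pathfinish g"])
      (auto intro: connected_path_image arc_imp_path)
  then obtain c where c: "c > 0" "\<And>m. c * real (crossing_length 0 m) \<le> real (card (squares_met ?A (total_width 0 m)))"
    by (auto simp: thick_def)
  have M_ge: "3 ^ n \<le> M n" for n
    unfolding M_def
  proof (induction n)
    case (Suc n)
    then show ?case using mult_le_mono[OF Suc tile.width_ge[of n]] by (simp add: mult.commute)
  qed simp
  show thesis
  proof (rule that[of "c / 16"])
    show "c / 16 > 0" using c by simp
    show "covering_number ?A \<epsilon> \<le> 2 * L n" if e: "2 / real (M n) \<le> \<epsilon>" for n \<epsilon>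
    proof -
      obtain F where F: "finite F" "card F \<le> 2 * L n" "?A \<subseteq> \<Union>F"
        "\<forall>U\<in>F. bounded U \<and> diameter U \<le> 2 / real (M n)" using cover[of n] by blast
      have "bounded U \<and> diameter U \<le> \<epsilon>" if "U \<in> F" for U
        using F(4) that e by force
      then have "covering_number ?A \<epsilon> \<le> card F" by (rule covering_number_le[OF F(1,3)])
      then show ?thesis using F by linarith
    qed
    show "c / 16 * real (L n) \<le> real (covering_number ?A \<epsilon>)" if e: "0 < \<epsilon>" "\<epsilon> \<le> 1 / real (M n)" for n \<epsilon>
    proof -
      obtain k where "(1/3::real) ^ k < \<epsilon> / 2" using real_arch_pow_inv[of "\<epsilon> / 2" "1/3"] e by auto
      then have k: "2 / 3 ^ k < \<epsilon>" by (simp add: power_one_over field_simps)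
      have "(3::real) ^ k \<le> real (M k)" using M_ge[of k] by (metis of_nat_le_iff of_nat_numeral of_nat_power)
      then have "2 / real (M k) \<le> 2 / 3 ^ k"
        using total_width_pos[of 0 k] by (intro divide_left_mono) (auto simp: scales)
      then have "2 / real (M k) \<le> \<epsilon>" using k by linarith
      obtain F where F: "finite F" "?A \<subseteq> \<Union>F"
        "\<forall>U\<in>F. bounded U \<and> diameter U \<le> 2 / real (M k)" using cover[of k] by blast
      have F': "bounded U \<and> diameter U \<le> \<epsilon>" if "U \<in> F" for U
        using F(3) that \<open>2 / real (M k) \<le> \<epsilon>\<close> by force
      obtain G where G: "finite G" "card G = covering_number ?A \<epsilon>" "?A \<subseteq> \<Union>G"
        "\<forall>U\<in>G. bounded U \<and> diameter U \<le> \<epsilon>"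
        using covering_number_attained[OF F(1,2) F'] by blast
      have "card (squares_met ?A (M n)) \<le> 16 * card G"
      proof (rule card_squares_met_le_cover[OF _ G(1,3)])
        show "0 < M n" using total_width_pos[of 0 n] by (simp add: scales)
        show "bounded U \<and> diameter U \<le> 1 / real (M n)" if "U \<in> G" for U
          using G(4) that e by force
      qed
      then have "c * real (L n) \<le> 16 * real (card G)" using c(2)[of n] unfolding scales by linarith
      then show ?thesis using G(2) by simp
    qed
  qed
qed

section \<open>Box dimension along a sequence of blocks\<close>

text \<open>It is enough to control \<open>N\<close> at scales \<open>1 / m j\<close> whose logarithms are asymptotically equal from one
  to the next. The number of squares at scale \<open>\<epsilon>\<close> between \<open>1 / m (j + 1)\<close> and \<open>1 / m j\<close> is bounded below
  at index \<open>j\<close> and above at index \<open>j + 2\<close>, where doubling absorbs the factor in \<open>2 / m j\<close>, and the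
  quotient of logarithms does not notice the difference.\<close>
lemma tendsto_log_quotient_at_scales:
  fixes m a :: "nat \<Rightarrow> real" and N :: "real \<Rightarrow> real"
  assumes m0: "1 < m 0" and double: "\<And>j. 2 * m j \<le> m (Suc j)"
    and a: "\<And>j. 0 < a j" and c: "0 < c"
    and upper: "\<And>j \<epsilon>. 2 / m j \<le> \<epsilon> \<Longrightarrow> N \<epsilon> \<le> 2 * a j"
    and lower: "\<And>j \<epsilon>. 0 < \<epsilon> \<Longrightarrow> \<epsilon> \<le> 1 / m j \<Longrightarrow> c * a j \<le> N \<epsilon>"
    and ratio: "(\<lambda>j. ln (a j) / ln (m j)) \<longlonglongrightarrow> s"
    and growth: "(\<lambda>j. ln (m (Suc j)) / ln (m j)) \<longlonglongrightarrow> 1"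
  shows "((\<lambda>\<epsilon>. ln (N \<epsilon>) / - ln \<epsilon>) \<longlongrightarrow> s) (at_right 0)"
proof -
  have m_ge: "2 ^ j < m j" for j
  proof (induction j)
    case (Suc j)
    then show ?case using double[of j] by simp
  qed (use m0 in simp)
  have m_gt1: "1 < m j" for j using m_ge[of j] one_le_power[of "2::real" j] by linarith
  have ln_m: "0 < ln (m j)" for j using m_gt1[of j] by simp
  have m_Suc: "m j < m (Suc j)" for j using double[of j] m_gt1[of j] by linarith
  have m_mono: "strict_mono m" using m_Suc by (simp add: strict_mono_Suc_iff)
  have m_top: "filterlim m at_top sequentially"
  proof (rule filterlim_at_top_mono)
    show "filterlim (\<lambda>j. 2 ^ j :: real) at_top sequentially" by real_asymp
    show "eventually (\<lambda>j. 2 ^ j \<le> m j) sequentially" using m_ge by (simp add: less_imp_le)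
  qed
  have ln_top: "filterlim (\<lambda>j. ln (m j)) at_top sequentially"
    by (rule filterlim_compose[OF ln_at_top m_top])
  have "\<exists>j. m j \<le> 1 / \<epsilon> \<and> 1 / \<epsilon> < m (Suc j)" if e: "0 < \<epsilon>" "\<epsilon> < 1 / m 0" for \<epsilon>
  proof -
    have e0: "m 0 < 1 / \<epsilon>" using e m_gt1[of 0] by (simp add: field_simps)
    obtain K where K: "1 / \<epsilon> < m K"
      using filterlim_at_top_dense[of m sequentially] m_top by (meson eventually_sequentially le_refl)
    define k where "k = (LEAST k. 1 / \<epsilon> < m k)"
    have k: "1 / \<epsilon> < m k" unfolding k_def by (rule LeastI[of _ K]) (rule K)
    then have "k \<noteq> 0" using e0 by (intro notI) simp
    then obtain j where j: "k = Suc j" using not0_implies_Suc by blast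
    have "\<not> 1 / \<epsilon> < m j" using not_less_Least[of j "\<lambda>k. 1 / \<epsilon> < m k"] j by (simp add: k_def)
    then show ?thesis using k j by (intro exI[of _ j]) simp
  qed
  \<comment> \<open>\<open>J \<epsilon>\<close> is the index of the last scale that is not finer than \<open>\<epsilon>\<close>.\<close>
  then obtain J where J: "\<And>\<epsilon>. 0 < \<epsilon> \<Longrightarrow> \<epsilon> < 1 / m 0 \<Longrightarrow> m (J \<epsilon>) \<le> 1 / \<epsilon> \<and> 1 / \<epsilon> < m (Suc (J \<epsilon>))"
    by metis
  have small: "eventually (\<lambda>\<epsilon>. 0 < \<epsilon> \<and> \<epsilon> < d) (at_right 0)" if "0 < d" for d :: real
    using eventually_at_right_real[OF that] by (rule eventually_mono) simp
  have J_top: "filterlim J at_top (at_right 0)"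
    unfolding filterlim_at_top
  proof
    fix K
    have "0 < min (1 / m 0) (1 / m K)" using m_gt1[of 0] m_gt1[of K] by simp
    from small[OF this] show "eventually (\<lambda>\<epsilon>. K \<le> J \<epsilon>) (at_right 0)"
    proof (rule eventually_mono)
      fix \<epsilon> assume e: "0 < \<epsilon> \<and> \<epsilon> < min (1 / m 0) (1 / m K)"
      then have "m K < 1 / \<epsilon>" using m_gt1[of K] by (simp add: field_simps)
      then have "m K < m (Suc (J \<epsilon>))" using J[of \<epsilon>] e by simp
      then show "K \<le> J \<epsilon>" using strict_mono_less[OF m_mono] by simp
    qed
  qed
  have e_small: "eventually (\<lambda>\<epsilon>. 0 < \<epsilon> \<and> \<epsilon> < 1 / m 0) (at_right 0)"
    by (rule small) (use m_gt1[of 0] in simp)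
  have x: "ln (m (J \<epsilon>)) \<le> - ln \<epsilon> \<and> - ln \<epsilon> \<le> ln (m (Suc (J \<epsilon>)))" if "0 < \<epsilon> \<and> \<epsilon> < 1 / m 0" for \<epsilon>
  proof -
    have "- ln \<epsilon> = ln (1 / \<epsilon>)" using that by (simp add: ln_div)
    moreover have "m (J \<epsilon>) \<le> 1 / \<epsilon>" "1 / \<epsilon> \<le> m (Suc (J \<epsilon>))" using J[of \<epsilon>] that by auto
    moreover have "0 < 1 / \<epsilon>" "0 < m (J \<epsilon>)" "0 < m (Suc (J \<epsilon>))"
      using that m_gt1[of "J \<epsilon>"] m_gt1[of "Suc (J \<epsilon>)"] by auto
    ultimately show ?thesis by (simp only: ln_le_cancel_iff)
  qed
  have n: "ln c + ln (a (J \<epsilon>)) \<le> ln (N \<epsilon>) \<and> ln (N \<epsilon>) \<le> ln 2 + ln (a (Suc (Suc (J \<epsilon>))))"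
    if e: "0 < \<epsilon> \<and> \<epsilon> < 1 / m 0" for \<epsilon>
  proof -
    have J': "m (J \<epsilon>) \<le> 1 / \<epsilon>" "1 / \<epsilon> < m (Suc (J \<epsilon>))" using J[of \<epsilon>] e by auto
    have pos: "0 < m (J \<epsilon>)" "0 < m (Suc (Suc (J \<epsilon>)))" using m_gt1[of "J \<epsilon>"] m_gt1[of "Suc (Suc (J \<epsilon>))"] by linarith+
    have "\<epsilon> \<le> 1 / m (J \<epsilon>)" using J'(1) e pos by (simp add: field_simps)
    then have lo: "c * a (J \<epsilon>) \<le> N \<epsilon>" using lower e by blast
    have "2 / \<epsilon> \<le> m (Suc (Suc (J \<epsilon>)))" using J'(2) double[of "Suc (J \<epsilon>)"] by simp
    then have "2 / m (Suc (Suc (J \<epsilon>))) \<le> \<epsilon>" using e pos by (simp add: field_simps)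
    then have hi: "N \<epsilon> \<le> 2 * a (Suc (Suc (J \<epsilon>)))" by (rule upper)
    have "0 < c * a (J \<epsilon>)" using a c by simp
    then have "0 < N \<epsilon>" using lo by linarith
    then have "ln (c * a (J \<epsilon>)) \<le> ln (N \<epsilon>)" "ln (N \<epsilon>) \<le> ln (2 * a (Suc (Suc (J \<epsilon>))))"
      using lo hi \<open>0 < c * a (J \<epsilon>)\<close> by simp_all
    then show ?thesis using a[of "J \<epsilon>"] a[of "Suc (Suc (J \<epsilon>))"] c by (simp add: ln_mult)
  qed
  have inv_ln: "(\<lambda>j. C / ln (m j)) \<longlonglongrightarrow> 0" for C :: real
    by (rule tendsto_divide_0[OF tendsto_const filterlim_at_top_imp_at_infinity[OF ln_top]])
  have lo_lim: "(\<lambda>j. (ln c + ln (a j)) / ln (m j)) \<longlonglongrightarrow> s"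
    using tendsto_add[OF inv_ln[of "ln c"] ratio] by (simp add: add_divide_distrib)
  have hi_lim: "(\<lambda>j. (ln 2 + ln (a (Suc (Suc j)))) / ln (m j)) \<longlonglongrightarrow> s"
  proof -
    have "(\<lambda>j. ln 2 / ln (m j) + (ln (a (Suc (Suc j))) / ln (m (Suc (Suc j)))) *
        ((ln (m (Suc (Suc j))) / ln (m (Suc j))) * (ln (m (Suc j)) / ln (m j)))) \<longlonglongrightarrow> 0 + s * (1 * 1)"
      by (intro tendsto_add tendsto_mult inv_ln growth LIMSEQ_Suc[OF growth] LIMSEQ_Suc[OF LIMSEQ_Suc[OF ratio]])
    moreover have "ln 2 / ln (m j) + (ln (a (Suc (Suc j))) / ln (m (Suc (Suc j)))) *
        ((ln (m (Suc (Suc j))) / ln (m (Suc j))) * (ln (m (Suc j)) / ln (m j))) =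
        (ln 2 + ln (a (Suc (Suc j)))) / ln (m j)" for j
      using ln_m[of j] ln_m[of "Suc j"] ln_m[of "Suc (Suc j)"] by (simp add: add_divide_distrib)
    ultimately show ?thesis by simp
  qed
  have N_lim: "((\<lambda>\<epsilon>. ln (N \<epsilon>) / ln (m (J \<epsilon>))) \<longlongrightarrow> s) (at_right 0)"
  proof (rule tendsto_sandwich)
    show "((\<lambda>\<epsilon>. (ln c + ln (a (J \<epsilon>))) / ln (m (J \<epsilon>))) \<longlongrightarrow> s) (at_right 0)"
      by (rule filterlim_compose[OF lo_lim J_top])
    show "((\<lambda>\<epsilon>. (ln 2 + ln (a (Suc (Suc (J \<epsilon>))))) / ln (m (J \<epsilon>))) \<longlongrightarrow> s) (at_right 0)"
      by (rule filterlim_compose[OF hi_lim J_top])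
    show "eventually (\<lambda>\<epsilon>. (ln c + ln (a (J \<epsilon>))) / ln (m (J \<epsilon>)) \<le> ln (N \<epsilon>) / ln (m (J \<epsilon>))) (at_right 0)"
      "eventually (\<lambda>\<epsilon>. ln (N \<epsilon>) / ln (m (J \<epsilon>)) \<le> (ln 2 + ln (a (Suc (Suc (J \<epsilon>))))) / ln (m (J \<epsilon>))) (at_right 0)"
      using e_small by (rule eventually_mono; use n ln_m in \<open>simp add: divide_right_mono less_imp_le\<close>)+
  qed
  have x_lim: "((\<lambda>\<epsilon>. - ln \<epsilon> / ln (m (J \<epsilon>))) \<longlongrightarrow> 1) (at_right 0)"
  proof (rule tendsto_sandwich)
    show "((\<lambda>\<epsilon>. 1) \<longlongrightarrow> (1::real)) (at_right 0)" for x :: real by simp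
    show "((\<lambda>\<epsilon>. ln (m (Suc (J \<epsilon>))) / ln (m (J \<epsilon>))) \<longlongrightarrow> 1) (at_right 0)"
      by (rule filterlim_compose[OF growth J_top])
    have "1 \<le> - ln \<epsilon> / ln (m (J \<epsilon>)) \<and> - ln \<epsilon> / ln (m (J \<epsilon>)) \<le> ln (m (Suc (J \<epsilon>))) / ln (m (J \<epsilon>))"
      if "0 < \<epsilon> \<and> \<epsilon> < 1 / m 0" for \<epsilon>
    proof
      show "1 \<le> - ln \<epsilon> / ln (m (J \<epsilon>))"
        unfolding pos_le_divide_eq[OF ln_m] using x[OF that] by simp
      show "- ln \<epsilon> / ln (m (J \<epsilon>)) \<le> ln (m (Suc (J \<epsilon>))) / ln (m (J \<epsilon>))"
        using x[OF that] ln_m[of "J \<epsilon>"] by (intro divide_right_mono) auto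
    qed
    with e_small show "eventually (\<lambda>\<epsilon>. 1 \<le> - ln \<epsilon> / ln (m (J \<epsilon>))) (at_right 0)"
      "eventually (\<lambda>\<epsilon>. - ln \<epsilon> / ln (m (J \<epsilon>)) \<le> ln (m (Suc (J \<epsilon>))) / ln (m (J \<epsilon>))) (at_right 0)"
      by (auto elim!: eventually_mono)
  qed
  have "((\<lambda>\<epsilon>. (ln (N \<epsilon>) / ln (m (J \<epsilon>))) / (- ln \<epsilon> / ln (m (J \<epsilon>)))) \<longlongrightarrow> s / 1) (at_right 0)"
    by (rule tendsto_divide[OF N_lim x_lim]) simp
  moreover have "(ln (N \<epsilon>) / ln (m (J \<epsilon>))) / (- ln \<epsilon> / ln (m (J \<epsilon>))) = ln (N \<epsilon>) / - ln \<epsilon>" for \<epsilon>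
    using ln_m[of "J \<epsilon>"] by simp
  ultimately show ?thesis by (simp only: div_by_1)
qed

definition unit_pattern :: pattern where
  "unit_pattern = (1, {(0, 0)})"

lemma subst_unit_pattern [simp]:
  "subst_pattern unit_pattern A = A" "subst_pattern A unit_pattern = A"
  by (rule prod_eqI; auto simp: white_subst_UN unit_pattern_def)+

definition pattern_product :: "pattern list \<Rightarrow> pattern" where
  "pattern_product ps = foldr subst_pattern ps unit_pattern"

lemma pattern_product_simps [simp]:
  "pattern_product [] = unit_pattern"
  "pattern_product (p # ps) = subst_pattern p (pattern_product ps)"
  by (simp_all add: pattern_product_def)

lemma pattern_product_append:
  "pattern_product (ps @ qs) = subst_pattern (pattern_product ps) (pattern_product qs)"
  by (induction ps) (simp_all add: subst_pattern_assoc)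

lemma pattern_product_concat:
  "pattern_product (concat pss) = pattern_product (map pattern_product pss)"
  by (induction pss) (simp_all add: pattern_product_append)

lemma width_pattern_product: "width (pattern_product ps) = prod_list (map width ps)"
  by (induction ps) (simp_all add: unit_pattern_def)

lemma level_eq_product: "level B n = pattern_product (map B [0..<Suc n])"
  by (induction n) (simp_all add: pattern_product_append subst_pattern_assoc)

lemma mixed_block_eq_product:
  assumes "0 < p + q"
  shows "mixed_block k p q = pattern_product (map base_pattern (replicate p k @ replicate q (k + 1)))"
proof -
  have "map (\<lambda>i. if i < p then base_pattern k else base_pattern (k + 1)) [0..<p + q] =
      replicate p (base_pattern k) @ replicate q (base_pattern (k + 1))"
    by (rule nth_equalityI) (auto simp: nth_append)
  then show ?thesis using assms
    by (simp add: mixed_block_def level_eq_product del: upt_Suc)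
qed

text \<open>The entries of the consecutive lists \<open>blk 0\<close>, \<open>blk 1\<close>, ... as one sequence; if all the lists are
  nonempty, then the first \<open>n + 1\<close> of them have more than \<open>n\<close> entries.\<close>
definition flatten :: "(nat \<Rightarrow> 'a list) \<Rightarrow> nat \<Rightarrow> 'a" where
  "flatten blk n = concat (map blk [0..<Suc n]) ! n"

lemma length_concat_ge:
  assumes "\<And>j. blk j \<noteq> []"
  shows "n \<le> length (concat (map blk [0..<n]))"
proof (induction n)
  case (Suc n)
  have "1 \<le> length (blk n)" using assms[of n] by (cases "blk n") auto
  then show ?case using Suc by simp
qed simp

lemma map_flatten:
  assumes ne: "\<And>j. blk j \<noteq> []"
  shows "map (flatten blk) [0..<length (concat (map blk [0..<j]))] = concat (map blk [0..<j])"
proof (rule nth_equalityI)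
  fix i assume "i < length (map (flatten blk) [0..<length (concat (map blk [0..<j]))])"
  then have i: "i < length (concat (map blk [0..<j]))" by simp
  have i': "i < length (concat (map blk [0..<Suc i]))" using length_concat_ge[of blk "Suc i", OF ne] by linarith
  have split: "concat (map blk [0..<b]) = concat (map blk [0..<a]) @ concat (map blk [a..<b])" if "a \<le> b" for a b
    using upt_add_eq_append[of 0 a "b - a"] that by simp
  have "concat (map blk [0..<Suc i]) ! i = concat (map blk [0..<j]) ! i"
  proof (cases "Suc i \<le> j")
    case True
    then show ?thesis using split[OF True] i' by (metis nth_append)
  next
    case False
    then have "j \<le> Suc i" by simp
    then show ?thesis using split[of j "Suc i"] i by (metis nth_append)
  qed
  then show "map (flatten blk) [0..<length (concat (map blk [0..<j]))] ! i = concat (map blk [0..<j]) ! i"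
    using i by (simp add: flatten_def)
qed simp

text \<open>The levels of the block sequence \<open>B\<close> are among the levels of the sequence of single patterns, at the
  indices \<open>n j\<close>, so its limit set is contained in that of the single patterns. Widths being moderate,
  the ends of the blocks are dense enough on a logarithmic scale to determine the dimension.\<close>
lemma arc_dimension_of_blocks:
  fixes pat :: "nat \<Rightarrow> pattern" and len :: "nat \<Rightarrow> nat" and blk :: "nat \<Rightarrow> nat list"
  assumes sp: "\<And>j i. i \<in> set (blk j) \<Longrightarrow> \<exists>h leg rk. spider (pat i) h leg rk \<and> len i = 2 * h + 1"
    and ne: "\<And>j. blk j \<noteq> []"
    and B: "B = (\<lambda>j. pattern_product (map pat (blk j)))"
    and moderate: "moderate_widths B"
    and ratio: "(\<lambda>j. ln (real (prod_list (map len (concat (map blk [0..<Suc j]))))) / ln (real (width (level B j)))) \<longlonglongrightarrow> s"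
    and g: "arc g" "path_image g \<subseteq> limit_set B"
  shows "has_box_dimension (path_image g) s"
proof -
  define C where "C n = pat (flatten blk n)" for n
  define n where "n j = length (concat (map blk [0..<Suc j]))" for j
  have n_ge: "Suc j \<le> n j" for j unfolding n_def by (rule length_concat_ge[OF ne])
  have flat: "map (flatten blk) [0..<n j] = concat (map blk [0..<Suc j])" for j
    unfolding n_def by (rule map_flatten[OF ne])
  have mem: "\<exists>j. flatten blk i \<in> set (blk j)" for i
  proof -
    have "i < n i" using n_ge[of i] by simp
    then have "flatten blk i \<in> set (map (flatten blk) [0..<n i])" by simp
    then show ?thesis unfolding flat by auto
  qed
  then have "\<exists>h leg rk. spider (C i) h leg rk \<and> len (flatten blk i) = 2 * h + 1" for i
    unfolding C_def using sp by blast
  then obtain h where h: "\<And>i. \<exists>leg rk. spider (C i) (h i) leg rk" "\<And>i. len (flatten blk i) = 2 * h i + 1"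
    by metis
  have wf: "well_formed (C i)" for i using h(1)[of i] spider_well_formed by blast
  have "map C [0..<n j] = map pat (concat (map blk [0..<Suc j]))" for j
  proof -
    have "map C [0..<n j] = map pat (map (flatten blk) [0..<n j])" by (simp add: C_def)
    then show ?thesis by (simp only: flat)
  qed
  then have product: "pattern_product (map C [0..<n j]) = level B j" for j
    by (simp add: map_concat pattern_product_concat level_eq_product B comp_def del: upt_Suc concat.simps)
  have level_C: "level C (n j - 1) = level B j" for j
    using product[of j] n_ge[of j] by (simp add: level_eq_product[of C] del: upt_Suc)
  have "limit_set B \<subseteq> limit_set C"
  proof
    fix z assume z: "z \<in> limit_set B"
    have "z \<in> region (level C i)" for i
    proof -
      have "z \<in> region (level C (n i - 1))" using z unfolding level_C limit_set_region by blast
      moreover have "i \<le> n i - 1" using n_ge[of i] by simp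
      ultimately show ?thesis using region_level_antimono[of C i "n i - 1"] wf by blast
    qed
    then show "z \<in> limit_set C" by (simp add: limit_set_region)
  qed
  then have gC: "path_image g \<subseteq> limit_set C" using g(2) by blast
  obtain c where c: "c > 0"
    "\<And>n \<epsilon>. 2 / real (\<Prod>i<n. width (C i)) \<le> \<epsilon> \<Longrightarrow> covering_number (path_image g) \<epsilon> \<le> 2 * (\<Prod>i<n. 2 * h i + 1)"
    "\<And>n \<epsilon>. 0 < \<epsilon> \<Longrightarrow> \<epsilon> \<le> 1 / real (\<Prod>i<n. width (C i)) \<Longrightarrow>
      c * real (\<Prod>i<n. 2 * h i + 1) \<le> real (covering_number (path_image g) \<epsilon>)"
    using arc_covering_bounds[OF h(1) g(1) gC] by blast
  have prod_eq: "prod_list (map f [0..<k]) = (\<Prod>i<k. f i)" for f :: "nat \<Rightarrow> nat" and k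
    by (induction k) (simp_all add: mult.commute)
  have width_eq: "(\<Prod>i<n j. width (C i)) = width (level B j)" for j
    by (simp add: width_pattern_product comp_def prod_eq flip: product)
  have "prod_list (map len (map (flatten blk) [0..<n j])) = (\<Prod>i<n j. 2 * h i + 1)" for j
    by (simp add: comp_def h(2) prod_eq)
  then have len_eq: "(\<Prod>i<n j. 2 * h i + 1) = prod_list (map len (concat (map blk [0..<Suc j])))" for j
    unfolding flat by simp
  define m where "m j = real (width (level B j))" for j
  have C3: "3 \<le> width (C i)" for i using h(1)[of i] spider.width_ge by blast
  have B3: "3 \<le> width (B j)" for j
  proof -
    obtain i where i: "i \<in> set (blk j)" using ne[of j] by (cases "blk j") auto
    have "3 \<le> width (pat i)" if "i \<in> set (blk j)" for i using sp[OF that] spider.width_ge by blast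
    moreover have "prod_list (map width (map pat xs)) \<ge> 3" if "xs \<noteq> []" "\<forall>i\<in>set xs. 3 \<le> width (pat i)" for xs
      using that
    proof (induction xs)
      case (Cons x xs)
      show ?case
      proof (cases "xs = []")
        case False
        then have "3 \<le> prod_list (map width (map pat xs))" using Cons by simp
        then have "3 * 1 \<le> width (pat x) * prod_list (map width (map pat xs))"
          using Cons.prems by (intro mult_le_mono) auto
        then show ?thesis by simp
      qed (use Cons in simp)
    qed simp
    ultimately show ?thesis using ne[of j] by (simp add: B width_pattern_product)
  qed
  have m_Suc: "m (Suc j) = m j * real (width (B (Suc j)))" for j by (simp add: m_def)
  have m_ge1: "1 \<le> m j" for j
  proof (induction j)
    case 0
    then show ?case using B3[of 0] by (simp add: m_def)
  next
    case (Suc j)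
    then show ?case using B3[of "Suc j"] unfolding m_Suc
      using mult_mono[of 1 "m j" 1 "real (width (B (Suc j)))"] by simp
  qed
  have m0: "1 < m 0" using B3[of 0] by (simp add: m_def)
  have m_double: "2 * m j \<le> m (Suc j)" for j
    unfolding m_Suc using m_ge1[of j] B3[of "Suc j"] by (simp add: mult.commute)
  have m_gt1: "1 < m j" for j
  proof (cases j)
    case (Suc i)
    then show ?thesis using m_ge1[of i] m_double[of i] by simp
  qed (use m0 in simp)
  \<comment> \<open>This is where moderate widths enter: \<open>ln (m j) / ln (m (j + 1))\<close> is 1 minus a quotient
    that tends to 0.\<close>
  have growth: "(\<lambda>j. ln (m (Suc j)) / ln (m j)) \<longlonglongrightarrow> 1"
  proof -
    have "(\<lambda>j. ln (real (width (B (Suc j)))) / ln (m (Suc j))) \<longlonglongrightarrow> 0"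
      using LIMSEQ_Suc[OF moderate[unfolded moderate_widths_def]] by (simp add: m_def del: level.simps)
    then have "(\<lambda>j. inverse (1 - ln (real (width (B (Suc j)))) / ln (m (Suc j)))) \<longlonglongrightarrow> inverse (1 - 0)"
      by (intro tendsto_intros) auto
    moreover have "inverse (1 - ln (real (width (B (Suc j)))) / ln (m (Suc j))) = ln (m (Suc j)) / ln (m j)" for j
    proof -
      have pos: "0 < ln (m (Suc j))" using m_gt1[of "Suc j"] by simp
      have "ln (m (Suc j)) = ln (m j) + ln (real (width (B (Suc j))))"
        unfolding m_Suc using m_gt1[of j] B3[of "Suc j"] by (simp add: ln_mult)
      then have "1 - ln (real (width (B (Suc j)))) / ln (m (Suc j)) = ln (m j) / ln (m (Suc j))"
        using pos by (simp add: field_simps)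
      then show ?thesis by simp
    qed
    ultimately show ?thesis by simp
  qed
  have "((\<lambda>\<epsilon>. ln (real (covering_number (path_image g) \<epsilon>)) / - ln \<epsilon>) \<longlongrightarrow> s) (at_right 0)"
  proof (rule tendsto_log_quotient_at_scales[OF m0 m_double _ c(1) _ _ _ growth])
    let ?a = "\<lambda>j. real (prod_list (map len (concat (map blk [0..<Suc j]))))"
    show "0 < ?a j" for j unfolding len_eq[symmetric] by (simp add: prod_pos)
    show "real (covering_number (path_image g) \<epsilon>) \<le> 2 * ?a j" if "2 / m j \<le> \<epsilon>" for j \<epsilon>
      using c(2)[of "n j" \<epsilon>] that unfolding width_eq len_eq m_def by (metis of_nat_le_iff of_nat_mult of_nat_numeral)
    show "c * ?a j \<le> real (covering_number (path_image g) \<epsilon>)" if "0 < \<epsilon>" "\<epsilon> \<le> 1 / m j" for j \<epsilon>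
      using c(3)[of \<epsilon> "n j"] that unfolding width_eq len_eq m_def by blast
    show "(\<lambda>j. ln (?a j) / ln (m j)) \<longlonglongrightarrow> s" using ratio by (simp only: m_def)
  qed
  then show ?thesis by (simp add: has_box_dimension_def)
qed

text \<open>Weights that are bounded away from zero have a divergent sum, so any initial segment becomes negligible.\<close>
lemma weighted_average_tendsto:
  fixes u v :: "nat \<Rightarrow> real"
  assumes v: "\<And>i. e \<le> v i" and e: "0 < e" and lim: "(\<lambda>i. u i / v i) \<longlonglongrightarrow> s"
  shows "(\<lambda>j. (\<Sum>i\<le>j. u i) / (\<Sum>i\<le>j. v i)) \<longlonglongrightarrow> s"
proof (rule LIMSEQ_I)
  fix r :: real assume r: "0 < r"
  have v_pos: "0 < v i" for i using v[of i] e by linarith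
  obtain N where N: "\<And>i. N \<le> i \<Longrightarrow> norm (u i / v i - s) < r / 2"
    using LIMSEQ_D[OF lim, of "r / 2"] r by auto
  have N': "\<bar>u i - s * v i\<bar> \<le> r / 2 * v i" if "N \<le> i" for i
  proof -
    have "\<bar>u i - s * v i\<bar> = \<bar>u i / v i - s\<bar> * v i"
      using v_pos[of i] by (simp add: abs_mult_pos' [symmetric] field_simps flip: abs_mult_pos)
    also have "\<dots> \<le> r / 2 * v i" using N[OF that] v_pos[of i] by (intro mult_right_mono) auto
    finally show ?thesis .
  qed
  define K where "K = (\<Sum>i<N. \<bar>u i - s * v i\<bar>)"
  have K0: "0 \<le> K" by (simp add: K_def sum_nonneg)
  obtain M :: nat where M: "2 * K / (r * e) < real M" using reals_Archimedean2 by blast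
  have "norm ((\<Sum>i\<le>j. u i) / (\<Sum>i\<le>j. v i) - s) < r" if j: "M \<le> j" for j
  proof -
    let ?V = "\<Sum>i\<le>j. v i"
    have "real (Suc j) * e \<le> ?V" using sum_mono[of "{..j}" "\<lambda>_. e" v] v by simp
    moreover have "real M * e \<le> real (Suc j) * e" using j e by (intro mult_right_mono) auto
    moreover have "2 * K / r < real M * e" using M r e by (simp add: field_simps)
    ultimately have V: "2 * K / r < ?V" by linarith
    then have V0: "0 < ?V" using K0 r by (smt (verit) divide_nonneg_pos)
    have bound: "\<bar>u i - s * v i\<bar> \<le> (if i < N then \<bar>u i - s * v i\<bar> else 0) + r / 2 * v i" for i
      using N'[of i] v_pos[of i] r by (cases "i < N") auto
    have "\<bar>(\<Sum>i\<le>j. u i) - s * ?V\<bar> = \<bar>\<Sum>i\<le>j. u i - s * v i\<bar>"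
      by (simp add: sum_subtractf sum_distrib_left)
    also have "\<dots> \<le> (\<Sum>i\<le>j. \<bar>u i - s * v i\<bar>)" by (rule sum_abs)
    also have "\<dots> \<le> (\<Sum>i\<le>j. (if i < N then \<bar>u i - s * v i\<bar> else 0) + r / 2 * v i)"
      by (rule sum_mono) (rule bound)
    also have "\<dots> = (\<Sum>i\<le>j. if i < N then \<bar>u i - s * v i\<bar> else 0) + r / 2 * ?V"
      by (simp only: sum.distrib sum_distrib_left)
    also have "(\<Sum>i\<le>j. if i < N then \<bar>u i - s * v i\<bar> else 0) = (\<Sum>i\<in>{..j} \<inter> {..<N}. \<bar>u i - s * v i\<bar>)"
      by (simp add: sum.inter_restrict)
    also have "\<dots> \<le> K" unfolding K_def by (rule sum_mono2) auto
    finally have "\<bar>(\<Sum>i\<le>j. u i) - s * ?V\<bar> \<le> K + r / 2 * ?V" by simp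
    also have "\<dots> < r * ?V" using V r by (simp add: field_simps)
    finally have "\<bar>(\<Sum>i\<le>j. u i) - s * ?V\<bar> / ?V < r" using V0 by (simp add: divide_less_eq)
    moreover have "(\<Sum>i\<le>j. u i) / ?V - s = ((\<Sum>i\<le>j. u i) - s * ?V) / ?V" using V0 by (simp add: field_simps)
    ultimately show ?thesis using V0 by (simp add: abs_divide)
  qed
  then show "\<exists>no. \<forall>n\<ge>no. norm ((\<Sum>i\<le>n. u i) / (\<Sum>i\<le>n. v i) - s) < r" by blast
qed

section \<open>The mixed fractals and their dimension\<close>

lemma width_base_pattern: "width (base_pattern k) = (if k = 0 then 3 else 4 * k + 7)"
  by (simp add: base_pattern_def cross_def snake_cross_def)

lemma width_base_pattern_ge: "3 \<le> width (base_pattern k)"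
  by (simp add: width_base_pattern)

lemma exit_path_length_ge: "3 \<le> exit_path_length k"
  by (simp add: exit_path_length_def)

lemma width_mixed_block:
  assumes "0 < p + q"
  shows "width (mixed_block k p q) = width (base_pattern k) ^ p * width (base_pattern (k + 1)) ^ q"
  by (simp add: mixed_block_eq_product[OF assms] width_pattern_product comp_def)

lemma width_level: "width (level B n) = (\<Prod>i\<le>n. width (B i))"
  by (induction n) (simp_all add: mult.commute)

lemma base_dim_tendsto: "base_dim \<longlonglongrightarrow> 2"
proof -
  have "(\<lambda>k. ln (4 * real k ^ 2 + 4 * real k + 7) / ln (4 * real k + 7)) \<longlonglongrightarrow> 2"
    by real_asymp
  moreover have "eventually (\<lambda>k. ln (4 * real k ^ 2 + 4 * real k + 7) / ln (4 * real k + 7) = base_dim k) sequentially"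
    using eventually_gt_at_top[of 0]
    by (rule eventually_mono) (simp add: base_dim_def exit_path_length_def width_base_pattern)
  ultimately show ?thesis using Lim_transform_eventually by blast
qed

lemma spider_base: "\<exists>h leg rk. spider (base_pattern k) h leg rk \<and> exit_path_length k = 2 * h + 1"
  using spider_base_pattern[of k] exit_path_length_odd[of k] by metis

text \<open>The dimensions \<open>base_dim k\<close> start at 1 and tend to 2; the first one above \<open>\<delta>\<close> is the upper
  end.\<close>
lemma base_dim_bracket:
  assumes "1 \<le> \<delta>" "\<delta> < 2" "\<delta> \<noteq> 1" "\<not> (\<exists>k\<ge>1. \<delta> = base_dim k)"
  obtains k where "base_dim k < \<delta>" "\<delta> < base_dim (k + 1)"
proof -
  have dim0: "base_dim 0 = 1" by (simp add: base_dim_def exit_path_length_def width_base_pattern)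
  obtain n where n: "\<delta> < base_dim n"
    using order_tendstoD(1)[OF base_dim_tendsto assms(2)] by (auto simp: eventually_sequentially)
  define K where "K = (LEAST n. \<delta> < base_dim n)"
  have K: "\<delta> < base_dim K" unfolding K_def by (rule LeastI[of _ n]) (rule n)
  have "K \<noteq> 0" using K dim0 assms by (intro notI) simp
  then obtain k where k: "K = Suc k" using not0_implies_Suc by blast
  have "\<not> \<delta> < base_dim k" using not_less_Least[of k "\<lambda>n. \<delta> < base_dim n"] k by (simp add: K_def)
  moreover have "\<delta> \<noteq> base_dim k"
  proof (cases "k = 0")
    case False
    then have "1 \<le> k" by simp
    then show ?thesis using assms(4) by blast
  qed (use dim0 assms(3) in simp)
  ultimately show thesis using that[of k] K k by simp
qed

text \<open>The logarithm of the product of \<open>n + 1\<close> widths is at least \<open>(n + 1) * ln 3\<close>.\<close>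
lemma moderate_if_sublinear:
  assumes w: "\<And>n. 3 \<le> width (B n)"
    and lim: "(\<lambda>n. ln (real (width (B n))) / real (Suc n)) \<longlonglongrightarrow> 0"
  shows "moderate_widths B"
  unfolding moderate_widths_def
proof (rule tendsto_sandwich)
  have level_ge: "real (Suc n) * ln 3 \<le> ln (real (width (level B n)))" for n
  proof -
    have "(3::nat) ^ Suc n \<le> width (level B n)"
    proof (induction n)
      case (Suc n)
      then show ?case using mult_le_mono[OF Suc w[of "Suc n"]] by (simp add: mult.commute)
    qed (simp add: w)
    then have "(3::real) ^ Suc n \<le> real (width (level B n))"
      by (metis of_nat_le_iff of_nat_numeral of_nat_power)
    then have "ln ((3::real) ^ Suc n) \<le> ln (real (width (level B n)))"
      by (intro ln_mono) (auto intro: zero_less_power)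
    then show ?thesis by (simp only: ln_realpow zero_less_numeral)
  qed
  have num: "0 \<le> ln (real (width (B n)))" for n using w[of n] by simp
  have pos: "0 < real (Suc n) * ln (3::real)" for n by simp
  show "eventually (\<lambda>n. 0 \<le> ln (real (width (B n))) / ln (real (width (level B n)))) sequentially"
    using num order_trans[OF less_imp_le[OF pos] level_ge] by (auto intro: always_eventually)
  show "eventually (\<lambda>n. ln (real (width (B n))) / ln (real (width (level B n)))
      \<le> ln (real (width (B n))) / real (Suc n) * (1 / ln 3)) sequentially"
  proof (intro always_eventually allI)
    fix n
    show "ln (real (width (B n))) / ln (real (width (level B n))) \<le> ln (real (width (B n))) / real (Suc n) * (1 / ln 3)"
      using divide_left_mono[OF level_ge num, of n n] pos[of n] level_ge[of n] by simp
  qed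
  show "(\<lambda>n. ln (real (width (B n))) / real (Suc n) * (1 / ln 3)) \<longlonglongrightarrow> 0"
    using tendsto_mult_right[OF lim, of "1 / ln 3"] by simp
qed simp

lemma arc_dimension_crosses:
  assumes "moderate_widths (\<lambda>n. cross (n + 1))" "arc g" "path_image g \<subseteq> limit_set (\<lambda>n. cross (n + 1))"
  shows "has_box_dimension (path_image g) 1"
proof (rule arc_dimension_of_blocks[where blk = "\<lambda>j. [j + 1]" and pat = cross and len = "\<lambda>i. 2 * i + 1"])
  fix j i :: nat assume "i \<in> set [j + 1]"
  then show "\<exists>h leg rk. spider (cross i) h leg rk \<and> 2 * i + 1 = 2 * h + 1"
    using spider_cross[of i] by (intro exI[of _ i]) auto
next
  let ?B = "\<lambda>n. cross (n + 1)"
  have eq: "prod_list (map (\<lambda>i. 2 * i + 1) (concat (map (\<lambda>j. [j + 1]) [0..<Suc j]))) = width (level ?B j)" for j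
  proof -
    have prod: "prod_list (map f (concat (map (\<lambda>j. [g j]) [0..<n]))) = (\<Prod>i<n. f (g i))"
      for f g :: "nat \<Rightarrow> nat" and n
      by (induction n) (simp_all add: mult.commute)
    show ?thesis unfolding prod width_level lessThan_Suc_atMost by (simp add: cross_def)
  qed
  have "3 ^ Suc j \<le> width (level ?B j)" for j
  proof (induction j)
    case (Suc j)
    have "3 \<le> width (?B (Suc j))" by (simp add: cross_def)
    from mult_le_mono[OF Suc this] show ?case by (simp add: mult.commute)
  qed (simp add: cross_def)
  then have gt1: "1 < width (level ?B j)" for j
    by (metis one_less_numeral_iff one_less_power order_less_le_trans semiring_norm(77) zero_less_Suc)
  have "0 < ln (real (width (level ?B j)))" for j
    using gt1[of j] by (intro ln_gt_zero) simp
  then have "ln (real (width (level ?B j))) / ln (real (width (level ?B j))) = 1" for j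
    using less_imp_neq by (metis divide_self)
  then show "(\<lambda>j. ln (real (prod_list (map (\<lambda>i. 2 * i + 1) (concat (map (\<lambda>j. [j + 1]) [0..<Suc j]))))) /
      ln (real (width (level ?B j)))) \<longlonglongrightarrow> 1"
    unfolding eq by simp
qed (use assms in \<open>simp_all\<close>)

lemma arc_dimension_snake_cross:
  assumes "moderate_widths (\<lambda>n. base_pattern k)" "arc g" "path_image g \<subseteq> limit_set (\<lambda>n. base_pattern k)"
  shows "has_box_dimension (path_image g) (base_dim k)"
proof (rule arc_dimension_of_blocks[where blk = "\<lambda>j. [k]" and pat = base_pattern and len = exit_path_length])
  fix j i assume "i \<in> set [k]"
  show "\<exists>h leg rk. spider (base_pattern i) h leg rk \<and> exit_path_length i = 2 * h + 1" by (rule spider_base)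
next
  have "prod_list (map exit_path_length (concat (map (\<lambda>j. [k]) [0..<Suc j]))) = exit_path_length k ^ Suc j" for j
    by (induction j) (simp_all add: mult.commute)
  moreover have "width (level (\<lambda>n. base_pattern k) j) = width (base_pattern k) ^ Suc j" for j
    by (simp add: width_level)
  moreover have "ln (real (exit_path_length k ^ Suc j)) / ln (real (width (base_pattern k) ^ Suc j)) = base_dim k" for j
    using exit_path_length_ge[of k] width_base_pattern_ge[of k]
    by (simp only: of_nat_power) (subst ln_realpow; simp add: base_dim_def del: power_Suc)+
  ultimately show "(\<lambda>j. ln (real (prod_list (map exit_path_length (concat (map (\<lambda>j. [k]) [0..<Suc j]))))) /
      ln (real (width (level (\<lambda>n. base_pattern k) j)))) \<longlonglongrightarrow> base_dim k"
    by (simp only: tendsto_const)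
qed (use assms in \<open>simp_all\<close>)

lemma arc_dimension_mixed_blocks:
  assumes pq: "\<And>j. 0 < p j \<and> 0 < q j" and lim: "(\<lambda>j. mixing_ratio k (p j) (q j)) \<longlonglongrightarrow> \<delta>"
    and B: "moderate_widths (\<lambda>j. mixed_block k (p j) (q j))"
    and g: "arc g" "path_image g \<subseteq> limit_set (\<lambda>j. mixed_block k (p j) (q j))"
  shows "has_box_dimension (path_image g) \<delta>"
proof (rule arc_dimension_of_blocks[where blk = "\<lambda>j. replicate (p j) k @ replicate (q j) (k + 1)"
      and pat = base_pattern and len = exit_path_length])
  show "\<exists>h leg rk. spider (base_pattern i) h leg rk \<and> exit_path_length i = 2 * h + 1" for i by (rule spider_base)
  show "replicate (p j) k @ replicate (q j) (k + 1) \<noteq> []" for j using pq[of j] by simp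
  show "(\<lambda>j. mixed_block k (p j) (q j)) = (\<lambda>j. pattern_product (map base_pattern (replicate (p j) k @ replicate (q j) (k + 1))))"
    using mixed_block_eq_product pq by fastforce
next
  let ?blk = "\<lambda>j. replicate (p j) k @ replicate (q j) (k + 1)"
  let ?B = "\<lambda>j. mixed_block k (p j) (q j)"
  define u where "u j = real (p j) * ln (real (exit_path_length k)) + real (q j) * ln (real (exit_path_length (k + 1)))" for j
  define v where "v j = real (p j) * ln (real (width (base_pattern k))) + real (q j) * ln (real (width (base_pattern (k + 1))))" for j
  have pos: "0 < real (exit_path_length i)" "0 < real (width (base_pattern i))" for i
    using exit_path_length_ge[of i] width_base_pattern_ge[of i] by simp_all
  have block_u: "ln (real (exit_path_length k) ^ p j * real (exit_path_length (k + 1)) ^ q j) = u j" for j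
    using pos by (simp add: ln_mult ln_realpow u_def)
  have block_v: "ln (real (width (base_pattern k)) ^ p j * real (width (base_pattern (k + 1))) ^ q j) = v j" for j
    using pos by (simp add: ln_mult ln_realpow v_def)
  have prod_u: "real (prod_list (map exit_path_length (concat (map ?blk [0..<n])))) =
      (\<Prod>i<n. real (exit_path_length k) ^ p i * real (exit_path_length (k + 1)) ^ q i)" for n
    by (induction n) (simp_all add: mult.assoc)
  have u_sum: "ln (real (prod_list (map exit_path_length (concat (map ?blk [0..<Suc j]))))) = (\<Sum>i\<le>j. u i)" for j
    unfolding prod_u lessThan_Suc_atMost using pos by (subst ln_prod) (auto simp: block_u[unfolded Suc_eq_plus1[symmetric]])
  have v_sum: "ln (real (width (level ?B j))) = (\<Sum>i\<le>j. v i)" for j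
    unfolding width_level of_nat_prod using pos pq
    by (subst ln_prod) (auto simp: width_mixed_block block_v[unfolded Suc_eq_plus1[symmetric]])
  have "(\<lambda>j. (\<Sum>i\<le>j. u i) / (\<Sum>i\<le>j. v i)) \<longlonglongrightarrow> \<delta>"
  proof (rule weighted_average_tendsto)
    have l3: "ln 3 \<le> ln (real (width (base_pattern i)))" for i
      using width_base_pattern_ge[of i] by simp
    show "ln 3 \<le> v i" for i
    proof -
      have "1 * ln 3 \<le> real (p i) * ln (real (width (base_pattern k)))"
        using pq[of i] l3 by (intro mult_mono) auto
      moreover have "0 \<le> real (q i) * ln (real (width (base_pattern (k + 1))))"
        using width_base_pattern_ge[of "k + 1"] by simp
      ultimately show ?thesis by (simp add: v_def)
    qed
    show "(\<lambda>i. u i / v i) \<longlonglongrightarrow> \<delta>" using lim by (simp add: u_def v_def mixing_ratio_def)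
  qed simp
  then show "(\<lambda>j. ln (real (prod_list (map exit_path_length (concat (map ?blk [0..<Suc j]))))) / ln (real (width (level ?B j)))) \<longlonglongrightarrow> \<delta>"
    unfolding u_sum v_sum .
qed (use B g in simp_all)

text \<open>The mixing ratio of \<open>p\<close> and \<open>q\<close> is an increasing function of \<open>q / p\<close> and equals \<open>\<delta>\<close> if \<open>q / p = t\<close>. Dyadic
  approximations of \<open>t\<close> from below are increasing. Their denominators have to grow slowly enough for
  the widths to be moderate, so each of them is repeated.\<close>
lemma mixing_sequences_exist:
  assumes k: "base_dim k < \<delta>" "\<delta> < base_dim (k + 1)"
  obtains p q :: "nat \<Rightarrow> nat" where "\<And>j. 0 < p j \<and> 0 < q j" "incseq (\<lambda>j. mixing_ratio k (p j) (q j))"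
    "(\<lambda>j. mixing_ratio k (p j) (q j)) \<longlonglongrightarrow> \<delta>" "moderate_widths (\<lambda>j. mixed_block k (p j) (q j))"
proof -
  define a where "a = ln (real (exit_path_length k))"
  define b where "b = ln (real (width (base_pattern k)))"
  define c where "c = ln (real (exit_path_length (k + 1)))"
  define d where "d = ln (real (width (base_pattern (k + 1))))"
  have pos: "0 < a" "0 < b" "0 < c" "0 < d"
    using exit_path_length_ge[of k] exit_path_length_ge[of "k + 1"] width_base_pattern_ge[of k] width_base_pattern_ge[of "k + 1"]
    by (simp_all add: a_def b_def c_def d_def)
  have ab: "a < \<delta> * b" "\<delta> * d < c"
    using k pos by (simp_all add: base_dim_def a_def b_def c_def d_def field_simps)
  define t where "t = (\<delta> * b - a) / (c - \<delta> * d)"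
  have t: "0 < t" using ab by (simp add: t_def)
  define f where "f x = (a + x * c) / (b + x * d)" for x
  have ft: "f t = \<delta>"
  proof -
    have "t * (c - \<delta> * d) = \<delta> * b - a" using ab by (simp add: t_def)
    then have "a + t * c = \<delta> * (b + t * d)" by (simp add: algebra_simps)
    moreover have "b + t * d > 0" using pos t by (simp add: add_pos_pos)
    ultimately show ?thesis by (simp add: f_def)
  qed
  have f_mono: "f x \<le> f y" if "0 \<le> x" "x \<le> y" for x y
  proof -
    have "0 < \<delta>" using ab(1) pos by (metis less_trans zero_less_mult_pos2)
    have "a * d \<le> c * b"
    proof -
      have "a * d \<le> (\<delta> * b) * d" using ab pos by (intro mult_right_mono) auto
      also have "\<dots> = (\<delta> * d) * b" by simp
      also have "\<dots> \<le> c * b" using ab pos by (intro mult_right_mono) auto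
      finally show ?thesis .
    qed
    then have "(y - x) * (a * d) \<le> (y - x) * (c * b)" using that by (intro mult_left_mono) auto
    then have "(a + x * c) * (b + y * d) \<le> (a + y * c) * (b + x * d)" by (simp add: algebra_simps)
    moreover have "0 < b + x * d" "0 < b + y * d" using pos that by (auto intro: add_pos_nonneg)
    ultimately show ?thesis by (simp add: f_def frac_le_eq divide_le_eq le_divide_eq)
  qed
  \<comment> \<open>The offset \<open>m0\<close> makes already the first numerator \<open>q 0\<close> positive.\<close>
  obtain m0 :: nat where m0: "1 / t < 2 ^ m0" using real_arch_pow[of 2 "1 / t"] by auto
  \<comment> \<open>With this exponent \<open>p j\<close> grows at most like \<open>sqrt j\<close>.\<close>
  define ex where "ex j = nat \<lfloor>log 4 (real (Suc j))\<rfloor>" for j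
  define p where "p j = (2::nat) ^ (m0 + ex j)" for j
  define q where "q j = nat \<lfloor>t * real (p j)\<rfloor>" for j
  have ex_mono: "ex i \<le> ex j" if "i \<le> j" for i j
    unfolding ex_def using that by (intro nat_mono floor_mono) simp
  have ex_sqrt: "2 ^ ex j \<le> sqrt (real (Suc j))" for j
  proof -
    have "0 \<le> log 4 (real (Suc j))" by simp
    then have "real (ex j) \<le> log 4 (real (Suc j))" unfolding ex_def by simp
    then have "4 powr real (ex j) \<le> real (Suc j)" by (simp add: le_log_iff)
    then have "(2 ^ ex j) ^ 2 \<le> real (Suc j)"
      by (simp add: powr_realpow flip: power_mult_distrib power_mult) (simp add: power_mult mult.commute[of _ 2])
    then show ?thesis by (rule real_le_rsqrt)
  qed
  have ex_top: "filterlim ex at_top sequentially"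
  proof -
    have "filterlim (\<lambda>j. log 4 (real (Suc j))) at_top sequentially" by real_asymp
    then have "filterlim (\<lambda>j. nat \<lfloor>log 4 (real (Suc j))\<rfloor>) at_top sequentially"
      by (intro filterlim_compose[OF filterlim_nat_sequentially filterlim_compose[OF filterlim_floor_sequentially]])
    then show ?thesis by (simp add: ex_def[abs_def])
  qed
  have p_pos: "0 < p j" for j by (simp add: p_def)
  have tp: "1 \<le> t * real (p j)" for j
  proof -
    have "1 / t \<le> 2 ^ m0" using m0 by simp
    also have "\<dots> \<le> real (p j)" by (simp add: p_def)
    finally show ?thesis using t by (simp add: field_simps)
  qed
  have q_le: "real (q j) \<le> t * real (p j)" and q_ge: "t * real (p j) - 1 \<le> real (q j)" for j
    using tp[of j] by (simp_all add: q_def)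
  have q_pos: "0 < q j" for j using tp[of j] by (simp add: q_def)
  have mix: "mixing_ratio k (p j) (q j) = f (real (q j) / real (p j))" for j
  proof -
    have "f (real (q j) / real (p j)) = ((a + real (q j) / real (p j) * c) * real (p j)) / ((b + real (q j) / real (p j) * d) * real (p j))"
      unfolding f_def using p_pos[of j] by (intro mult_divide_mult_cancel_right[symmetric]) simp
    also have "\<dots> = (real (p j) * a + real (q j) * c) / (real (p j) * b + real (q j) * d)"
    proof -
      have "(s + real (q j) / real (p j) * s') * real (p j) = real (p j) * s + real (q j) * s'" for s s' :: real
        using p_pos[of j] by (simp add: ring_distribs)
      then show ?thesis by simp
    qed
    finally show ?thesis by (simp add: mixing_ratio_def a_def b_def c_def d_def)
  qed
  have ratio_mono: "real (q i) / real (p i) \<le> real (q j) / real (p j)" if ij: "i \<le> j" for i j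
  proof -
    obtain e where e: "ex j = ex i + e" using le_Suc_ex[OF ex_mono[OF ij]] by blast
    then have pj: "p j = p i * 2 ^ e" by (simp add: p_def power_add)
    have "real (q i * 2 ^ e) \<le> t * real (p j)"
      using mult_right_mono[OF q_le[of i], of "2 ^ e"] by (simp add: pj mult.assoc)
    then have "q i * 2 ^ e \<le> q j" unfolding q_def[of j] by (rule le_nat_floor)
    then have "real (q i) * 2 ^ e \<le> real (q j)" by (metis of_nat_le_iff of_nat_mult of_nat_numeral of_nat_power)
    then show ?thesis using p_pos[of i] by (simp add: pj field_simps)
  qed
  have ratio_lim: "(\<lambda>j. real (q j) / real (p j)) \<longlonglongrightarrow> t"
  proof (rule tendsto_sandwich)
    have "(\<lambda>e. t - 1 / 2 ^ (m0 + e)) \<longlonglongrightarrow> t" by real_asymp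
    then have "(\<lambda>j. t - 1 / 2 ^ (m0 + ex j)) \<longlonglongrightarrow> t" by (rule filterlim_compose[OF _ ex_top])
    then show "(\<lambda>j. t - 1 / real (p j)) \<longlonglongrightarrow> t" by (simp add: p_def)
    show "eventually (\<lambda>j. t - 1 / real (p j) \<le> real (q j) / real (p j)) sequentially"
    proof (intro always_eventually allI)
      fix j show "t - 1 / real (p j) \<le> real (q j) / real (p j)"
        using divide_right_mono[OF q_ge[of j], of "real (p j)"] p_pos[of j] by (simp add: diff_divide_distrib)
    qed
    show "eventually (\<lambda>j. real (q j) / real (p j) \<le> t) sequentially"
    proof (intro always_eventually allI)
      fix j show "real (q j) / real (p j) \<le> t" using q_le[of j] p_pos[of j] by (simp add: divide_le_eq)
    qed
  qed simp
  show thesis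
  proof (rule that)
    show "0 < p j \<and> 0 < q j" for j using p_pos q_pos by simp
    show "incseq (\<lambda>j. mixing_ratio k (p j) (q j))"
      unfolding mix by (intro incseq_SucI f_mono ratio_mono) auto
    have "(\<lambda>j. f (real (q j) / real (p j))) \<longlonglongrightarrow> (a + t * c) / (b + t * d)"
      unfolding f_def using pos t by (intro tendsto_intros ratio_lim) (auto simp: add_pos_pos less_imp_neq[symmetric])
    then show "(\<lambda>j. mixing_ratio k (p j) (q j)) \<longlonglongrightarrow> \<delta>" using ft unfolding mix by (simp add: f_def)
    show "moderate_widths (\<lambda>j. mixed_block k (p j) (q j))"
    proof (rule moderate_if_sublinear)
      have w: "width (mixed_block k (p j) (q j)) = width (base_pattern k) ^ p j * width (base_pattern (k + 1)) ^ q j" for j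
        using width_mixed_block p_pos[of j] by simp
      show "3 \<le> width (mixed_block k (p j) (q j))" for j
      proof -
        have "width (base_pattern k) ^ 1 \<le> width (base_pattern k) ^ p j"
          using p_pos[of j] width_base_pattern_ge[of k] by (intro power_increasing) auto
        then have "3 * 1 \<le> width (base_pattern k) ^ p j * width (base_pattern (k + 1)) ^ q j"
          using width_base_pattern_ge[of k] width_base_pattern_ge[of "k + 1"] by (intro mult_le_mono) (auto simp: Suc_le_eq)
        then show ?thesis by (simp add: w)
      qed
      have ln_w: "ln (real (width (mixed_block k (p j) (q j)))) = real (p j) * b + real (q j) * d" for j
        using width_base_pattern_ge[of k] width_base_pattern_ge[of "k + 1"]
        by (simp add: w b_def d_def ln_mult ln_realpow)
      define K where "K = 2 ^ m0 * (b + t * d)"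
      have "real (p j) * b + real (q j) * d \<le> K * sqrt (real (Suc j))" for j
      proof -
        have "real (p j) * b + real (q j) * d \<le> real (p j) * (b + t * d)"
          using mult_right_mono[OF q_le[of j], of d] pos by (simp add: algebra_simps)
        also have "\<dots> = K * 2 ^ ex j" by (simp add: p_def K_def power_add)
        also have "\<dots> \<le> K * sqrt (real (Suc j))"
          using ex_sqrt[of j] pos t by (intro mult_left_mono) (auto simp: K_def)
        finally show ?thesis .
      qed
      then have le: "ln (real (width (mixed_block k (p j) (q j)))) / real (Suc j) \<le> K * sqrt (real (Suc j)) / real (Suc j)" for j
        unfolding ln_w by (intro divide_right_mono) auto
      show "(\<lambda>j. ln (real (width (mixed_block k (p j) (q j)))) / real (Suc j)) \<longlonglongrightarrow> 0"
      proof (rule tendsto_sandwich[OF _ always_eventually[OF allI[OF le]]])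
        show "eventually (\<lambda>j. 0 \<le> ln (real (width (mixed_block k (p j) (q j)))) / real (Suc j)) sequentially"
          unfolding ln_w using pos by (intro always_eventually allI) (simp add: add_nonneg_nonneg)
        show "(\<lambda>j. K * sqrt (real (Suc j)) / real (Suc j)) \<longlonglongrightarrow> 0" by real_asymp
      qed simp
    qed
  qed
qed

theorem theorem6:
  fixes \<delta> :: real
  assumes "1 \<le> \<delta>" and "\<delta> < 2"
  shows "(\<exists>B. generates_for \<delta> B \<and> moderate_widths B) \<and>
    (\<forall>B. generates_for \<delta> B \<and> moderate_widths B \<longrightarrow>
      (\<forall>x y g. x \<in> limit_set B \<and> y \<in> limit_set B \<and> x \<noteq> y \<and>
         arc g \<and> pathstart g = x \<and> pathfinish g = y \<and> path_image g \<subseteq> limit_set B \<longrightarrow>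
         has_box_dimension (path_image g) \<delta>))"
proof (intro conjI allI impI; (elim conjE)?)
  show "\<exists>B. generates_for \<delta> B \<and> moderate_widths B"
  proof -
    consider "\<delta> = 1" | k where "\<delta> \<noteq> 1" "k \<ge> 1" "\<delta> = base_dim k" | "\<delta> \<noteq> 1" "\<not> (\<exists>k\<ge>1. \<delta> = base_dim k)" by blast
    then show ?thesis
    proof cases
      case 1
      have "moderate_widths (\<lambda>n. cross (n + 1))"
      proof (rule moderate_if_sublinear)
        have "(\<lambda>n. ln (real (2 * (n + 1) + 1)) / real (Suc n)) \<longlonglongrightarrow> 0" by real_asymp
        then show "(\<lambda>n. ln (real (width (cross (n + 1)))) / real (Suc n)) \<longlonglongrightarrow> 0" by (simp add: cross_def)
      qed (simp add: cross_def)
      then show ?thesis using 1 by (intro exI[of _ "\<lambda>n. cross (n + 1)"]) (simp add: generates_for_def)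
    next
      case (2 k)
      have "moderate_widths (\<lambda>n. base_pattern k)"
        by (rule moderate_if_sublinear[OF width_base_pattern_ge]) real_asymp
      then show ?thesis using 2 by (intro exI[of _ "\<lambda>n. base_pattern k"]) (auto simp: generates_for_def)
    next
      case 3
      obtain k where k: "base_dim k < \<delta>" "\<delta> < base_dim (k + 1)" using base_dim_bracket assms 3 by blast
      obtain p q where pq: "\<And>j. 0 < p j \<and> 0 < q j" "incseq (\<lambda>j. mixing_ratio k (p j) (q j))"
        "(\<lambda>j. mixing_ratio k (p j) (q j)) \<longlonglongrightarrow> \<delta>" "moderate_widths (\<lambda>j. mixed_block k (p j) (q j))"
        using mixing_sequences_exist[OF k] by blast
      have "generates_for \<delta> (\<lambda>j. mixed_block k (p j) (q j))"
        unfolding generates_for_def if_not_P[OF 3(1)] if_not_P[OF 3(2)] using k pq by blast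
      then show ?thesis using pq(4) by blast
    qed
  qed
next
  fix B x y g
  assume gen: "generates_for \<delta> B" and mod: "moderate_widths B"
    and g: "arc g" "path_image g \<subseteq> limit_set B"
  show "has_box_dimension (path_image g) \<delta>"
  proof (cases "\<delta> = 1")
    case True
    then have "B = (\<lambda>n. cross (n + 1))" using gen by (simp add: generates_for_def)
    then show ?thesis using arc_dimension_crosses mod g True by simp
  next
    case False
    show ?thesis
    proof (cases "\<exists>k\<ge>1. \<delta> = base_dim k")
      case True
      then obtain k where "\<delta> = base_dim k" "B = (\<lambda>n. base_pattern k)"
        using gen False by (auto simp: generates_for_def)
      then show ?thesis using arc_dimension_snake_cross mod g by simp
    next
      case F2: False
      obtain k p q where "\<And>j. 0 < p j \<and> 0 < q j" "(\<lambda>j. mixing_ratio k (p j) (q j)) \<longlonglongrightarrow> \<delta>"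
        "B = (\<lambda>j. mixed_block k (p j) (q j))"
        using gen unfolding generates_for_def if_not_P[OF False] if_not_P[OF F2] by blast
      then show ?thesis using arc_dimension_mixed_blocks[of p q k \<delta> g] mod g by blast
    qed
  qed
qed

end
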